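(* Let $\eta$ be a nilpotent endomorphism of Jordan type $\lambda$ of an $n$-dimensional vector space $V$ over an infinite field. Let $P,Q\in\mathcal T_\lambda$, and let $\sigma\in\mathbf S_n$ with $(P,Q)=RS(\sigma)$. For all $(f,f')$ in a dense open subset of $\mathcal F_{\eta,P}\times\mathcal F_{\eta,Q}$, the family $\bigl(J(\eta|_{f_i\cap f'_j})\bigr)_{0\le i,j\le n}$ is of type $RS$, and in particular $\pi(f,f')=\sigma$.
   Context: Varieties carry the Zariski topology. A complete flag $f$ in $V$ is a chain $0=f_0\subset f_1\subset\cdots\subset f_n=V$ with $\dim f_i=i$; it is $\eta$-stable if $\eta(f_i)\subset f_i$ for all $i$; $\mathcal F_\eta$ is the variety of these. For $\eta$-stable $V'$, $\eta|_{V'}$ is the restriction. $J(\xi)$ is the Jordan type of a nilpotent $\xi$ (the partition formed by the sizes of its Jordan blocks). A partition $\lambda$ is a weakly decreasing sequence $\lambda_0\ge\lambda_1\ge\cdots$ of natural numbers with finite sum $|\lambda|$, with Young diagram $Y(\lambda)=\{(i,j)\in\mathbb N^2:j<\lambda_i\}$. Write $\mu\prec\lambda$ if $Y(\mu)\subset Y(\lambda)$ and $|\mu|=|\lambda|-1$, and $\mu\preceq\lambda$ if $\mu\prec\lambda$ or $\mu=\lambda$. $\mathcal T_\lambda$ is the set of standard Young tableaux of shape $\lambda$ with entries $0,\dots,|\lambda|-1$ (rows and columns increasing); $\operatorname{ch}T$ is the chain of shapes from $\lambda$ to $(0)$ obtained by removing squares in order of decreasing entries. For $f\in\mathcal F_\eta$,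 $r_\eta(f)\in\mathcal T_\lambda$ is the tableau with $\operatorname{ch}r_\eta(f)=(J(\eta),J(\eta|_{f_{n-1}}),\dots,J(\eta|_{f_0}))$, and $\mathcal F_{\eta,T}=\{f\in\mathcal F_\eta:r_\eta(f)=T\}$. $\mathbf S_n$ is the group of permutations of $\{0,\dots,n-1\}$, written as sequences $\sigma_0,\dots,\sigma_{n-1}$. $RS(\sigma)=(P,Q)$ is the pair of tableaux given by the Schensted row insertion algorithm: $P$ is obtained by successively row-inserting $\sigma_0,\dots,\sigma_{n-1}$, and $Q$ is the recording tableau, with entry $j$ in the square added when $\sigma_j$ is inserted. The relative position $\pi(f,f')\in\mathbf S_n$ of two complete flags is the unique $\sigma$ such that there is a basis $e_0,\dots,e_{n-1}$ of $V$ with $f_i=\langle e_0,\dots,e_{i-1}\rangle$ and $f'_i=\langle e_{\sigma_0},\dots,e_{\sigma_{i-1}}\rangle$ for all $i\le n$. An arrangement of four partitions $\begin{pmatrix}\nu&\mu\\ \mu'&\lambda\end{pmatrix}$ is of type $RS1$ if $\nu=\mu=\mu'\prec\lambda$ and $\mu_0=\lambda_0-1$; $RS2$ if $\nu\prec\mu=\mu'\prec\lambda$, with $\mu_{i+1}=\lambda_{i+1}-1$ and $\nu_i=\mu_i-1$ for some $i\ge0$; $RS3$ if $\nu\prec\mu\prec\lambda$, $\nu\prec\mu'\prec\lambda$ and $\mu\ne\mu'$; $RS0$ if $\nu=\mu\preceq\mu'=\lambda$ or $\nu=\mu'\preceq\mu=\lambda$. A family of partitions $(\lambda^{[i,j]})$,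 with $i$ and $j$ each ranging over an interval of $\mathbb Z$, is of type $RS$ if every configuration $\begin{pmatrix}\lambda^{[i,j]}&\lambda^{[i,j+1]}\\ \lambda^{[i+1,j]}&\lambda^{[i+1,j+1]}\end{pmatrix}$ is of one of the types $RS0$, $RS1$, $RS2$, $RS3$. *)

theory Defs
  imports
    "HOL-Analysis.Abstract_Topology"
    "HOL-Combinatorics.Permutations"
    "HOL-Library.FuncSet"
begin

section \<open>Partitions and configurations of type RS\<close>

definition is_partition :: "(nat \<Rightarrow> nat) \<Rightarrow> bool" where
  "is_partition lam \<longleftrightarrow> antimono lam \<and> finite {i. lam i \<noteq> 0}"

definition psize :: "(nat \<Rightarrow> nat) \<Rightarrow> nat" where
  "psize lam = (\<Sum>i | lam i \<noteq> 0. lam i)"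

definition young :: "(nat \<Rightarrow> nat) \<Rightarrow> (nat \<times> nat) set" where
  "young lam = {(i, j). j < lam i}"

definition pprec :: "(nat \<Rightarrow> nat) \<Rightarrow> (nat \<Rightarrow> nat) \<Rightarrow> bool" (infix \<open>\<prec>\<close> 50) where
  "mu \<prec> lam \<longleftrightarrow> young mu \<subseteq> young lam \<and> psize mu + 1 = psize lam"

definition ppreceq :: "(nat \<Rightarrow> nat) \<Rightarrow> (nat \<Rightarrow> nat) \<Rightarrow> bool" (infix \<open>\<preceq>\<close> 50) where
  "mu \<preceq> lam \<longleftrightarrow> mu \<prec> lam \<or> mu = lam"

text \<open>The arguments \<open>nu mu mu' lam\<close> are the entries of the 2 by 2 arrangement read row by row.\<close>

definition RS0 :: "(nat \<Rightarrow> nat) \<Rightarrow> (nat \<Rightarrow> nat) \<Rightarrow> (nat \<Rightarrow> nat) \<Rightarrow> (nat \<Rightarrow> nat) \<Rightarrow> bool" where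
  "RS0 nu mu mu' lam \<longleftrightarrow>
     (nu = mu \<and> mu \<preceq> mu' \<and> mu' = lam) \<or> (nu = mu' \<and> mu' \<preceq> mu \<and> mu = lam)"

definition RS1 :: "(nat \<Rightarrow> nat) \<Rightarrow> (nat \<Rightarrow> nat) \<Rightarrow> (nat \<Rightarrow> nat) \<Rightarrow> (nat \<Rightarrow> nat) \<Rightarrow> bool" where
  "RS1 nu mu mu' lam \<longleftrightarrow> nu = mu \<and> mu = mu' \<and> mu' \<prec> lam \<and> mu 0 + 1 = lam 0"

definition RS2 :: "(nat \<Rightarrow> nat) \<Rightarrow> (nat \<Rightarrow> nat) \<Rightarrow> (nat \<Rightarrow> nat) \<Rightarrow> (nat \<Rightarrow> nat) \<Rightarrow> bool" where
  "RS2 nu mu mu' lam \<longleftrightarrow> nu \<prec> mu \<and> mu = mu' \<and> mu' \<prec> lam \<and>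
     (\<exists>i. mu (i + 1) + 1 = lam (i + 1) \<and> nu i + 1 = mu i)"

definition RS3 :: "(nat \<Rightarrow> nat) \<Rightarrow> (nat \<Rightarrow> nat) \<Rightarrow> (nat \<Rightarrow> nat) \<Rightarrow> (nat \<Rightarrow> nat) \<Rightarrow> bool" where
  "RS3 nu mu mu' lam \<longleftrightarrow> nu \<prec> mu \<and> mu \<prec> lam \<and> nu \<prec> mu' \<and> mu' \<prec> lam \<and> mu \<noteq> mu'"

definition RS_family :: "nat set \<Rightarrow> nat set \<Rightarrow> (nat \<Rightarrow> nat \<Rightarrow> nat \<Rightarrow> nat) \<Rightarrow> bool" where
  "RS_family A B L \<longleftrightarrow>
     (\<forall>i\<in>A. \<forall>j\<in>B. is_partition (L i j)) \<and>
     (\<forall>i j. i \<in> A \<and> i + 1 \<in> A \<and> j \<in> B \<and> j + 1 \<in> B \<longrightarrow>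
        (let nu = L i j; mu = L i (j + 1); mu' = L (i + 1) j; lam = L (i + 1) (j + 1)
         in RS0 nu mu mu' lam \<or> RS1 nu mu mu' lam \<or> RS2 nu mu mu' lam \<or> RS3 nu mu mu' lam))"

section \<open>Standard Young tableaux and the Schensted correspondence\<close>

text \<open>A tableau is the list of its rows, none of which is empty.\<close>

definition shape :: "nat list list \<Rightarrow> nat \<Rightarrow> nat" where
  "shape T = (\<lambda>i. if i < length T then length (T ! i) else 0)"

definition SYT :: "(nat \<Rightarrow> nat) \<Rightarrow> nat list list set" where
  "SYT lam = {T. [] \<notin> set T \<and> shape T = lam \<and> is_partition lam \<and>
     distinct (concat T) \<and> set (concat T) = {..<psize lam} \<and>
     (\<forall>row\<in>set T. sorted_wrt (<) row) \<and>
     (\<forall>i j. i + 1 < length T \<and> j < length (T ! (i + 1)) \<longrightarrow> T ! i ! j < T ! (i + 1) ! j)}"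

text \<open>The \<open>m\<close>-th shape from the end is that of the squares whose entries are less than \<open>m\<close>.\<close>

definition shape_chain :: "nat list list \<Rightarrow> (nat \<Rightarrow> nat) list" where
  "shape_chain T = map (\<lambda>m. shape (map (filter (\<lambda>x. x < m)) T)) (rev [0..<psize (shape T) + 1])"

fun row_insert :: "nat \<Rightarrow> nat list \<Rightarrow> nat list \<times> nat option" where
  "row_insert x [] = ([x], None)"
| "row_insert x (y # ys) =
     (if x < y then (x # ys, Some y)
      else let (zs, b) = row_insert x ys in (y # zs, b))"

text \<open>The second component of the result is the index of the row that has grown.\<close>

fun tab_insert :: "nat \<Rightarrow> nat list list \<Rightarrow> nat list list \<times> nat" where
  "tab_insert x [] = ([[x]], 0)"
| "tab_insert x (row # rows) =
     (case row_insert x row of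
        (row', None) \<Rightarrow> (row' # rows, 0)
      | (row', Some y) \<Rightarrow> (let (rows', i) = tab_insert y rows in (row' # rows', i + 1)))"

definition add_entry :: "nat \<Rightarrow> nat \<Rightarrow> nat list list \<Rightarrow> nat list list" where
  "add_entry i x T = (if i < length T then T[i := T ! i @ [x]] else T @ [[x]])"

definition RS :: "nat \<Rightarrow> (nat \<Rightarrow> nat) \<Rightarrow> nat list list \<times> nat list list" where
  "RS n \<sigma> = fold (\<lambda>j (P, Q). let (P', i) = tab_insert (\<sigma> j) P in (P', add_entry i j Q))
     [0..<n] ([], [])"

section \<open>Zariski topologies\<close>

text \<open>The algebra of functions generated by a set \<open>C\<close> of coordinate functions.\<close>

inductive_set poly_funs :: "('x \<Rightarrow> 'k::field) set \<Rightarrow> ('x \<Rightarrow> 'k) set"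
  for C :: "('x \<Rightarrow> 'k) set" where
  const: "(\<lambda>_. c) \<in> poly_funs C"
| coord: "p \<in> C \<Longrightarrow> p \<in> poly_funs C"
| add: "p \<in> poly_funs C \<Longrightarrow> q \<in> poly_funs C \<Longrightarrow> (\<lambda>x. p x + q x) \<in> poly_funs C"
| mult: "p \<in> poly_funs C \<Longrightarrow> q \<in> poly_funs C \<Longrightarrow> (\<lambda>x. p x * q x) \<in> poly_funs C"

definition zariski_open :: "'x set \<Rightarrow> ('x \<Rightarrow> 'k::field) set \<Rightarrow> 'x set \<Rightarrow> bool" where
  "zariski_open X C U \<longleftrightarrow>
     U \<subseteq> X \<and> (\<exists>S \<subseteq> poly_funs C. X - U = {x \<in> X. \<forall>p\<in>S. p x = 0})"

definition zariski :: "'x set \<Rightarrow> ('x \<Rightarrow> 'k::field) set \<Rightarrow> 'x topology" where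
  "zariski X C = topology (zariski_open X C)"

lemma istopology_zariski_open: "istopology (zariski_open X C)"
  unfolding istopology_def
proof (intro conjI allI impI)
  fix U V assume "zariski_open X C U" "zariski_open X C V"
  then obtain S R where
    S: "U \<subseteq> X" "S \<subseteq> poly_funs C" "X - U = {x \<in> X. \<forall>p\<in>S. p x = 0}" and
    R: "V \<subseteq> X" "R \<subseteq> poly_funs C" "X - V = {x \<in> X. \<forall>p\<in>R. p x = 0}"
    unfolding zariski_open_def by blast
  let ?M = "\<Union>p\<in>S. (\<lambda>q x. p x * q x) ` R"
  have "?M \<subseteq> poly_funs C" using S(2) R(2) by (auto intro: poly_funs.mult)
  moreover have "X - (U \<inter> V) = {x \<in> X. \<forall>p\<in>?M. p x = 0}"
  proof -
    have "X - (U \<inter> V) = (X - U) \<union> (X - V)" by (rule Diff_Int)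
    also have "\<dots> = {x \<in> X. (\<forall>p\<in>S. p x = 0) \<or> (\<forall>p\<in>R. p x = 0)}"
      unfolding S(3) R(3) by blast
    also have "\<dots> = {x \<in> X. \<forall>p\<in>S. \<forall>q\<in>R. p x * q x = 0}"
      unfolding mult_eq_0_iff by blast
    also have "\<dots> = {x \<in> X. \<forall>p\<in>?M. p x = 0}" by (simp only: ball_UN ball_simps)
    finally show ?thesis .
  qed
  moreover have "U \<inter> V \<subseteq> X" using S(1) by blast
  ultimately show "zariski_open X C (U \<inter> V)"
    unfolding zariski_open_def by (intro conjI exI[of _ ?M])
next
  fix \<K> assume K: "\<forall>U\<in>\<K>. zariski_open X C U"
  have "\<forall>U\<in>\<K>. \<exists>S. U \<subseteq> X \<and> S \<subseteq> poly_funs C \<and> X - U = {x \<in> X. \<forall>p\<in>S. p x = 0}"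
    using K unfolding zariski_open_def by simp
  from bchoice[OF this] obtain S where S: "\<forall>U\<in>\<K>. U \<subseteq> X \<and> S U \<subseteq> poly_funs C \<and>
      X - U = {x \<in> X. \<forall>p\<in>S U. p x = 0}"
    by (rule exE)
  let ?S = "\<Union>(S ` \<K>)"
  have "?S \<subseteq> poly_funs C" using S by auto
  moreover have "X - \<Union>\<K> = {x \<in> X. \<forall>p\<in>?S. p x = 0}"
  proof -
    have "X - \<Union>\<K> = {x \<in> X. \<forall>U\<in>\<K>. x \<in> X - U}" by auto
    also have "\<dots> = {x \<in> X. \<forall>U\<in>\<K>. \<forall>p\<in>S U. p x = 0}"
    proof (rule Collect_cong, rule conj_cong[OF refl], rule ball_cong[OF refl])
      fix x U assume "x \<in> X" "U \<in> \<K>"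
      then have "X - U = {x \<in> X. \<forall>p\<in>S U. p x = 0}" using S by simp
      then show "x \<in> X - U \<longleftrightarrow> (\<forall>p\<in>S U. p x = 0)" using \<open>x \<in> X\<close> by simp
    qed
    also have "\<dots> = {x \<in> X. \<forall>p\<in>?S. p x = 0}" by simp
    finally show ?thesis .
  qed
  moreover have "\<Union>\<K> \<subseteq> X" using S by auto
  ultimately show "zariski_open X C (\<Union>\<K>)"
    unfolding zariski_open_def by (intro conjI exI[of _ ?S])
qed

lemma openin_zariski: "openin (zariski X C) U \<longleftrightarrow> zariski_open X C U"
  by (simp add: zariski_def istopology_zariski_open)

lemma topspace_zariski:
  fixes C :: "('x \<Rightarrow> 'k::field) set"
  shows "topspace (zariski X C) = X"
proof -
  have "zariski_open X C X"
    unfolding zariski_open_def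
  proof (intro conjI exI)
    show "{\<lambda>_. 1} \<subseteq> poly_funs C" by (simp add: poly_funs.const)
    show "X - X = {x \<in> X. \<forall>p\<in>{\<lambda>_. 1::'k}. p x = 0}" by simp
  qed simp
  then have "X \<subseteq> topspace (zariski X C)"
    by (intro openin_subset) (simp add: openin_zariski)
  moreover have "topspace (zariski X C) \<subseteq> X"
    using openin_topspace[of "zariski X C"] unfolding openin_zariski zariski_open_def by (rule conjunct1)
  ultimately show ?thesis by (rule subset_antisym[rotated])
qed

definition quotient_topology :: "'x topology \<Rightarrow> ('x \<Rightarrow> 'y) \<Rightarrow> 'y topology" where
  "quotient_topology X q =
     topology (\<lambda>U. U \<subseteq> q ` topspace X \<and> openin X {x \<in> topspace X. q x \<in> U})"

lemma openin_quotient_topology: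
  "openin (quotient_topology X q) U \<longleftrightarrow>
     U \<subseteq> q ` topspace X \<and> openin X {x \<in> topspace X. q x \<in> U}"
proof -
  have "istopology (\<lambda>U. U \<subseteq> q ` topspace X \<and> openin X {x \<in> topspace X. q x \<in> U})"
    unfolding istopology_def
  proof (intro conjI allI impI)
    fix S T
    assume S: "S \<subseteq> q ` topspace X \<and> openin X {x \<in> topspace X. q x \<in> S}"
      and T: "T \<subseteq> q ` topspace X \<and> openin X {x \<in> topspace X. q x \<in> T}"
    show "S \<inter> T \<subseteq> q ` topspace X" by (rule le_infI1) (rule conjunct1[OF S])
    have "{x \<in> topspace X. q x \<in> S \<inter> T}
        = {x \<in> topspace X. q x \<in> S} \<inter> {x \<in> topspace X. q x \<in> T}" by blast
    then show "openin X {x \<in> topspace X. q x \<in> S \<inter> T}"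
      using openin_Int[OF conjunct2[OF S] conjunct2[OF T]] by (simp only:)
  next
    fix \<K> assume K: "\<forall>K\<in>\<K>. K \<subseteq> q ` topspace X \<and> openin X {x \<in> topspace X. q x \<in> K}"
    then show "\<Union>\<K> \<subseteq> q ` topspace X" by (simp add: Sup_le_iff)
    have "{x \<in> topspace X. q x \<in> \<Union>\<K>} = (\<Union>K\<in>\<K>. {x \<in> topspace X. q x \<in> K})" by blast
    moreover have "openin X (\<Union>K\<in>\<K>. {x \<in> topspace X. q x \<in> K})"
      using K by (intro openin_Union ballI) (elim imageE, simp)
    ultimately show "openin X {x \<in> topspace X. q x \<in> \<Union>\<K>}" by (simp only:)
  qed
  then show ?thesis by (simp add: quotient_topology_def)
qed

lemma quotient_map_quotient_topology: "quotient_map X (quotient_topology X q) q"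
proof -
  have "topspace (quotient_topology X q) = q ` topspace X"
  proof
    have "openin (quotient_topology X q) (q ` topspace X)"
    proof -
      have "{x \<in> topspace X. q x \<in> q ` topspace X} = topspace X" by blast
      then show ?thesis by (simp add: openin_quotient_topology)
    qed
    then show "q ` topspace X \<subseteq> topspace (quotient_topology X q)" by (rule openin_subset)
    show "topspace (quotient_topology X q) \<subseteq> q ` topspace X"
      using openin_topspace[of "quotient_topology X q"]
      unfolding openin_quotient_topology by (rule conjunct1)
  qed
  then show ?thesis by (simp add: quotient_map_def openin_quotient_topology)
qed

section \<open>Flags\<close>

text \<open>
  A separate locale, because names declared in \<open>vector_space\<close> itself are captured by the global
  interpretation for real vector spaces.
\<close>

locale flag_space = vector_space scale
  for scale :: "'a::field \<Rightarrow> 'b::ab_group_add \<Rightarrow> 'b"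
begin

text \<open>
  The vectors \<open>b (i, 0), \<dots>, b (i, lam i - 1)\<close> span the \<open>i\<close>-th Jordan block of the restriction
  of the nilpotent map \<open>\<eta>\<close> to \<open>W\<close>.
\<close>

definition jordan_basis ::
  "('b \<Rightarrow> 'b) \<Rightarrow> 'b set \<Rightarrow> (nat \<Rightarrow> nat) \<Rightarrow> (nat \<times> nat \<Rightarrow> 'b) \<Rightarrow> bool" where
  "jordan_basis \<eta> W lam b \<longleftrightarrow>
     inj_on b (young lam) \<and> independent (b ` young lam) \<and> span (b ` young lam) = W \<and>
     (\<forall>(i, j)\<in>young lam. \<eta> (b (i, j)) = (if j = 0 then 0 else b (i, j - 1)))"

definition jordan_type :: "('b \<Rightarrow> 'b) \<Rightarrow> 'b set \<Rightarrow> nat \<Rightarrow> nat" where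
  "jordan_type \<eta> W = (THE lam. is_partition lam \<and> (\<exists>b. jordan_basis \<eta> W lam b))"

text \<open>A complete flag is extended by \<open>f i = V\<close> to all \<open>i > dim V\<close>.\<close>

definition complete_flags :: "(nat \<Rightarrow> 'b set) set" where
  "complete_flags = {f. (\<forall>i. subspace (f i)) \<and> (\<forall>i. f i \<subseteq> f (i + 1)) \<and> f 0 = {0} \<and>
     (\<forall>i\<le>dim UNIV. dim (f i) = i) \<and> (\<forall>i\<ge>dim UNIV. f i = UNIV)}"

definition stable_flags :: "('b \<Rightarrow> 'b) \<Rightarrow> (nat \<Rightarrow> 'b set) set" where
  "stable_flags \<eta> = {f \<in> complete_flags. \<forall>i. \<eta> ` f i \<subseteq> f i}"

definition flag_tableau :: "('b \<Rightarrow> 'b) \<Rightarrow> (nat \<Rightarrow> 'b set) \<Rightarrow> nat list list" where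
  "flag_tableau \<eta> f = (THE T. T \<in> SYT (jordan_type \<eta> UNIV) \<and>
     shape_chain T = map (\<lambda>i. jordan_type \<eta> (f i)) (rev [0..<dim UNIV + 1]))"

definition tableau_flags :: "('b \<Rightarrow> 'b) \<Rightarrow> nat list list \<Rightarrow> (nat \<Rightarrow> 'b set) set" where
  "tableau_flags \<eta> T = {f \<in> stable_flags \<eta>. flag_tableau \<eta> f = T}"

text \<open>Ordered bases \<open>e 0, \<dots>, e (dim V - 1)\<close> of the whole space.\<close>

definition frames :: "(nat \<Rightarrow> 'b) set" where
  "frames = {e \<in> {..<dim UNIV} \<rightarrow>\<^sub>E UNIV.
     inj_on e {..<dim UNIV} \<and> independent (e ` {..<dim UNIV}) \<and> span (e ` {..<dim UNIV}) = UNIV}"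

definition flag_of :: "(nat \<Rightarrow> 'b) \<Rightarrow> nat \<Rightarrow> 'b set" where
  "flag_of e i = span (e ` {..<min i (dim UNIV)})"

definition relative_position :: "(nat \<Rightarrow> 'b set) \<Rightarrow> (nat \<Rightarrow> 'b set) \<Rightarrow> nat \<Rightarrow> nat" where
  "relative_position f f' = (THE \<sigma>. \<sigma> permutes {..<dim UNIV} \<and>
     (\<exists>e\<in>frames. \<forall>i\<le>dim UNIV.
        f i = span (e ` {..<i}) \<and> f' i = span ((\<lambda>k. e (\<sigma> k)) ` {..<i})))"

text \<open>Coordinate functions on pairs of \<open>dim V\<close>-tuples of vectors.\<close>

definition frame_pair_coords :: "((nat \<Rightarrow> 'b) \<times> (nat \<Rightarrow> 'b) \<Rightarrow> 'a) set" where
  "frame_pair_coords =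
     {\<lambda>(e, e'). \<phi> (e i) | \<phi> i. Vector_Spaces.linear scale (*) \<phi> \<and> i < dim UNIV} \<union>
     {\<lambda>(e, e'). \<phi> (e' i) | \<phi> i. Vector_Spaces.linear scale (*) \<phi> \<and> i < dim UNIV}"

text \<open>
  The Zariski topology on the (rational points of the) product of two copies of the flag variety,
  the latter taken as the homogeneous space \<open>GL(V)/B\<close>, whose topology is the quotient topology:
  \<open>frames\<close> is a torsor under \<open>GL(V)\<close>, open in the affine space of \<open>dim V\<close>-tuples of vectors, and
  the fibres of \<open>flag_of\<close> are the orbits of the upper triangular changes of basis. As \<open>flag_of\<close> has
  polynomial sections over the big cells, whose translates cover the flag variety, the result is
  the same as for the embedding in projective spaces by Pluecker coordinates. Note that it is
  finer than the product of the Zariski topologies of the two factors.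
\<close>

definition flag_pairs_zariski :: "((nat \<Rightarrow> 'b set) \<times> (nat \<Rightarrow> 'b set)) topology" where
  "flag_pairs_zariski =
     quotient_topology (zariski (frames \<times> frames) frame_pair_coords)
       (\<lambda>(e, e'). (flag_of e, flag_of e'))"

definition tableau_flag_pairs_zariski ::
  "('b \<Rightarrow> 'b) \<Rightarrow> nat list list \<Rightarrow> nat list list \<Rightarrow>
     ((nat \<Rightarrow> 'b set) \<times> (nat \<Rightarrow> 'b set)) topology" where
  "tableau_flag_pairs_zariski \<eta> P Q =
     subtopology flag_pairs_zariski (tableau_flags \<eta> P \<times> tableau_flags \<eta> Q)"

end

end

theory Submission
  imports Defs "HOL-Computational_Algebra.Polynomial"
begin

text \<open>
  Any two flags with the same tableau are joined by a rational curve of such flags: the automorphism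
  group of a nilpotent space is open in a linear space and acts transitively on the stable hyperplanes
  of a given type. Hence the variety of pairs is irreducible, and as the numbers
  \<open>dim (ker \<eta>^k \<inter> f i \<inter> f' j)\<close> are upper semicontinuous, the pairs for which all of them are minimal
  form a dense open subset.

  That a minimal pair is of type RS is shown by induction on the length of the first flag, with
  \<open>H\<close> its last proper member. For the squares in the last row, a square violating the rule could be
  improved by moving \<open>f' j\<close> inside \<open>f' (j + 1)\<close>. For the others it suffices that the traces of
  both flags on \<open>H\<close> form again a minimal pair. A curve from these traces to any other pair of flags in
  \<open>H\<close> of the same types lifts generically to the whole space, at the cost of deforming the nilpotent
  map by a map of rank one: by semicontinuity the types of the lifted flag can only move in one
  direction from the given ones, and the RS rules say that these are already extremal in that
  direction. The deformed nilpotent map has the same Jordan type, so it can be conjugated back.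

  Finally, the rules determine the upper left corner of a square from the other three, and the shapes
  of the restricted insertion tableaux of the prefixes of \<open>\<sigma>\<close> obey the same rules.
\<close>

section \<open>Partitions and Jordan bases\<close>


text \<open>A stable hyperplane \<open>H\<close> of a nilpotent space \<open>V\<close> is governed
  by one number, the largest \<open>c\<close> with
  \<open>V \<inter> ker_pow \<eta> c \<subseteq> H\<close>: it is the length of the row of the type
  of \<open>H\<close> that receives the new square. While types stay constant, such a containment
  persists for general parameters of a curve, so this length can only grow there. That is the
  one-sided control of types on which lifting rests.

  A curve of flags in \<open>H\<close> does not lift with \<eta> fixed: if \<open>v\<close> outside
  \<open>H\<close> is added to the later members, stability requires \<open>\<eta> v\<close> to lie
  in the moving member just before \<open>v\<close> enters, while \<open>\<eta> v\<close> is a fixed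
  vector. Altering \<eta> on \<open>v\<close> alone repairs this and leaves \<open>H\<close>
  untouched.

  The field is merely infinite and only rational points occur, so no dimension theory of varieties
  is invoked: each genericity claim is reduced to the independence of the columns of a polynomial
  matrix, which holds on a curve outside finitely many parameters.\<close>

lemma young_eq_Sigma: "young lam = (SIGMA i:{i. lam i \<noteq> 0}. {..<lam i})"
  by (auto simp: young_def)

lemma finite_young: "finite {i. lam i \<noteq> 0} \<Longrightarrow> finite (young lam)"
  unfolding young_eq_Sigma by (intro finite_SigmaI) auto

lemma card_young: "finite {i. lam i \<noteq> 0} \<Longrightarrow> card (young lam) = psize lam"
  unfolding young_eq_Sigma psize_def by simp

lemma is_partition_finite: "is_partition lam \<Longrightarrow> finite {i. lam i \<noteq> 0}"
  by (simp add: is_partition_def)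

lemma is_partition_antimono: "is_partition lam \<Longrightarrow> i \<le> j \<Longrightarrow> lam j \<le> lam i"
  by (simp add: is_partition_def antimono_def)

lemma mem_young: "(i, j) \<in> young lam \<longleftrightarrow> j < lam i"
  by (simp add: young_def)

lemma young_add: "young (mu(r := Suc (mu r))) = insert (r, mu r) (young mu)"
  by (auto simp: young_def split: if_splits)

lemma finite_support_add: "finite {i. mu i \<noteq> (0::nat)} \<Longrightarrow> finite {i. (mu(r := x)) i \<noteq> 0}"
  by (rule finite_subset[of _ "insert r {i. mu i \<noteq> 0}"]) auto

lemma psize_add:
  assumes "finite {i. mu i \<noteq> 0}"
  shows "psize (mu(r := Suc (mu r))) = Suc (psize mu)"
proof -
  have "psize (mu(r := Suc (mu r))) = card (insert (r, mu r) (young mu))"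
    using card_young[OF finite_support_add[OF assms, of r "Suc (mu r)"]] by (simp only: young_add)
  also have "\<dots> = Suc (psize mu)"
    using finite_young[OF assms] card_young[OF assms] by (simp add: mem_young)
  finally show ?thesis .
qed

lemma pprec_add: "finite {i. mu i \<noteq> 0} \<Longrightarrow> mu \<prec> mu(r := Suc (mu r))"
  by (simp add: pprec_def psize_add young_add) auto


text \<open>For a Jordan basis these squares index a basis of the kernel of the \<open>k\<close>-th
  power (\<open>jordan_basis_ker_pow\<close>); their number is the sum of the first \<open>k\<close>
  parts of the conjugate partition.\<close>

definition cols :: "(nat \<Rightarrow> nat) \<Rightarrow> nat \<Rightarrow> (nat \<times> nat) set" where
  "cols lam k = {(i, j). j < lam i \<and> j < k}"

lemma cols_subset: "cols lam k \<subseteq> young lam"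
  by (auto simp: cols_def young_def)

text \<open>Successive differences of the counts are the column lengths, that is, the conjugate
  partition. As rows decrease, a column is an initial segment of the rows, so its length tells which
  rows reach it.\<close>

lemma partition_eqI_cols:
  assumes "is_partition lam" "is_partition mu" "\<And>k. card (cols lam k) = card (cols mu k)"
  shows "lam = mu"
proof -
  have *: "i < card {i. k < lam i} \<longleftrightarrow> k < lam i" if "is_partition lam" for lam :: "nat \<Rightarrow> nat" and i k
  proof -
    have fin: "finite {i. k < lam i}"
      by (rule finite_subset[OF _ is_partition_finite[OF that]]) auto
    show ?thesis
    proof
      assume "k < lam i"
      then have "{..i} \<subseteq> {i. k < lam i}"
        using is_partition_antimono[OF that] by (auto intro: less_le_trans)
      from card_mono[OF fin this] show "i < card {i. k < lam i}" by simp
    next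
      assume l: "i < card {i. k < lam i}"
      show "k < lam i"
      proof (rule ccontr)
        assume "\<not> k < lam i"
        then have "{i. k < lam i} \<subseteq> {..<i}"
          using is_partition_antimono[OF that, of i]
          by (auto simp: not_less) (meson leI le_trans not_less)
        from card_mono[OF _ this] l show False by simp
      qed
    qed
  qed
  have **: "card (cols lam (Suc k)) = card (cols lam k) + card {i. k < lam i}"
    if "is_partition lam" for lam :: "nat \<Rightarrow> nat" and k
  proof -
    have "cols lam (Suc k) = cols lam k \<union> (\<lambda>i. (i, k)) ` {i. k < lam i}"
      by (auto simp: cols_def)
    moreover have "cols lam k \<inter> (\<lambda>i. (i, k)) ` {i. k < lam i} = {}"
      by (auto simp: cols_def)
    moreover have "finite (cols lam k)" "finite {i. k < lam i}"
      using finite_subset[OF cols_subset finite_young[OF is_partition_finite[OF that]]]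
        finite_subset[OF _ is_partition_finite[OF that], of "{i. k < lam i}"] by force+
    ultimately show ?thesis by (simp add: card_Un_disjoint card_image inj_on_def)
  qed
  have "card {i. k < lam i} = card {i. k < mu i}" for k
    using **[OF assms(1), of k] **[OF assms(2), of k] assms(3)[of k] assms(3)[of "Suc k"] by simp
  then have "k < lam i \<longleftrightarrow> k < mu i" for i k
    using *[OF assms(1), of i k] *[OF assms(2), of i k] by simp
  then show ?thesis by (metis ext nat_neq_iff less_irrefl)
qed

section \<open>Linear algebra by bases and functionals, and Jordan bases\<close>

locale fd_flag_space = finite_dimensional_vector_space scale Basis + flag_space scale
  for scale :: "'a::field \<Rightarrow> 'b::ab_group_add \<Rightarrow> 'b" and Basis :: "'b set"
begin

notation scale (infixr \<open>*s\<close> 75)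

sublocale endo: finite_dimensional_vector_space_pair scale Basis scale Basis
  by unfold_locales

sublocale dual: vector_space_pair scale "(*)"
  by unfold_locales (simp_all add: algebra_simps)

abbreviation lin :: "('b \<Rightarrow> 'b) \<Rightarrow> bool" where
  "lin \<equiv> Vector_Spaces.linear scale scale"

abbreviation fnl :: "('b \<Rightarrow> 'a) \<Rightarrow> bool" where
  "fnl \<equiv> Vector_Spaces.linear scale (*)"

lemmas lin_simps = endo.linear_0 endo.linear_add endo.linear_scale endo.linear_diff endo.linear_neg
lemmas fnl_simps = dual.linear_0 dual.linear_add dual.linear_scale dual.linear_diff dual.linear_neg

lemma linI:
  "(\<And>x y. f (x + y) = f x + f y) \<Longrightarrow> (\<And>c x. f (c *s x) = c *s f x) \<Longrightarrow> lin f"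
  by (simp add: Vector_Spaces.linear_iff vector_space_axioms)

lemma fnlI:
  "(\<And>x y. f (x + y) = f x + f y) \<Longrightarrow> (\<And>c x. f (c *s x) = c * f x) \<Longrightarrow> fnl f"
  using dual.vs2.vector_space_axioms by (simp add: Vector_Spaces.linear_iff vector_space_axioms)

lemma lin_funpow: "lin f \<Longrightarrow> lin (f ^^ k)"
proof (induction k)
  case 0 then show ?case by (auto intro: linI)
next
  case (Suc k)
  then have "lin (f ^^ k)" by simp
  then show ?case by (auto intro!: linI simp: lin_simps[OF Suc.prems] lin_simps[OF \<open>lin (f ^^ k)\<close>])
qed

lemma fnl_comp:
  assumes "fnl \<phi>" "lin f"
  shows "fnl (\<lambda>x. \<phi> (f x))"
  by (rule fnlI) (simp_all add: lin_simps[OF assms(2)] fnl_simps[OF assms(1)])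

definition ker_pow :: "('b \<Rightarrow> 'b) \<Rightarrow> nat \<Rightarrow> 'b set" where
  "ker_pow \<eta> k = {x. (\<eta> ^^ k) x = 0}"

lemma subspace_ker_pow: "lin \<eta> \<Longrightarrow> subspace (ker_pow \<eta> k)"
  unfolding ker_pow_def by (rule endo.linear_subspace_kernel[OF lin_funpow])

lemma funpow_stable: "(\<eta> ` W \<subseteq> W) \<Longrightarrow> x \<in> W \<Longrightarrow> (\<eta> ^^ k) x \<in> W"
  by (induction k) auto

lemma hyperplane_decomp:
  assumes "subspace H" "subspace V" "H \<subseteq> V" "dim V = Suc (dim H)" "v \<in> V" "v \<notin> H"
  shows "span (insert v H) = V"
    and "x \<in> V \<Longrightarrow> \<exists>a. x - a *s v \<in> H"
proof -
  have "span (insert v H) \<subseteq> V" using assms by (intro span_minimal) auto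
  moreover have "v \<notin> span H" using assms by (metis span_eq_iff)
  then have "dim (span (insert v H)) = Suc (dim H)"
    by (simp add: dim_insert)
  ultimately show *: "span (insert v H) = V"
    using assms by (intro subspace_dim_equal) auto
  show "\<exists>a. x - a *s v \<in> H" if "x \<in> V"
    using that span_eq_iff[THEN iffD2, OF assms(1)] unfolding *[symmetric] span_insert by auto
qed

lemma dim_hyperplane_eq:
  assumes "subspace H" "subspace V" "H \<subseteq> V" "v \<in> V" "v \<notin> H" "V \<subseteq> span (insert v H)"
  shows "dim V = Suc (dim H)"
proof -
  have "span (insert v H) = V" using assms by (intro antisym span_minimal) auto
  then have "dim V = dim (insert v H)" by (metis dim_span)
  moreover have "v \<notin> span H" using assms by (metis span_eq_iff)
  ultimately show ?thesis by (simp add: dim_insert)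
qed

lemma dim_Int_hyperplane:
  assumes "subspace H" "subspace V" "H \<subseteq> V" "dim V = Suc (dim H)" "subspace W" "W \<subseteq> V" "\<not> W \<subseteq> H"
  shows "dim W = Suc (dim (W \<inter> H))"
proof -
  obtain w where w: "w \<in> W" "w \<notin> H" using assms by auto
  show ?thesis
  proof (rule dim_hyperplane_eq)
    show "W \<subseteq> span (insert w (W \<inter> H))"
    proof
      fix x assume x: "x \<in> W"
      obtain a where "x - a *s w \<in> H"
        using hyperplane_decomp(2)[OF assms(1-4), of w x] w x assms(6) by auto
      moreover have "x - a *s w \<in> W" using x w assms by (auto intro: subspace_diff subspace_scale)
      ultimately show "x \<in> span (insert w (W \<inter> H))"
        unfolding span_insert by (auto intro: span_base)
    qed
  qed (use w assms in \<open>auto intro: subspace_inter\<close>)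
qed

lemma separating_functional:
  assumes "subspace S" "x \<notin> S"
  obtains \<phi> where "fnl \<phi>" "\<And>y. y \<in> S \<Longrightarrow> \<phi> y = 0" "\<phi> x = 1"
proof -
  obtain B0 where B0: "B0 \<subseteq> S" "independent B0" "S \<subseteq> span B0"
    using maximal_independent_subset[of S] by blast
  have spB0: "span B0 = S" using B0 assms(1) by (intro span_subspace)
  have "independent (insert x B0)" using B0 spB0 assms(2) by (intro independent_insertI) auto
  then obtain \<phi> where \<phi>: "fnl \<phi>" "\<forall>y\<in>insert x B0. \<phi> y = (if y = x then 1 else 0)"
    using dual.linear_independent_extend[of "insert x B0" "\<lambda>y. if y = x then 1 else 0"] by blast
  have "\<phi> y = 0" if "y \<in> S" for y
  proof (rule dual.linear_eq_0_on_span[OF \<phi>(1)])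
    show "y \<in> span B0" using that spB0 by simp
    show "\<phi> b = 0" if "b \<in> B0" for b using \<phi>(2) that assms(2) B0 by auto
  qed
  with \<phi> show thesis by (intro that[of \<phi>]) auto
qed

lemma eq_0_if_functionals_0: "(\<And>\<phi>. fnl \<phi> \<Longrightarrow> \<phi> x = 0) \<Longrightarrow> x = 0"
  using separating_functional[OF subspace_single_0, of x] by (metis singletonI zero_neq_one singletonD)

lemma hyperplane_of_functional:
  assumes "subspace V" "fnl \<phi>" "w \<in> V" "\<phi> w \<noteq> 0"
  shows "dim V = Suc (dim {x\<in>V. \<phi> x = 0})" "subspace {x\<in>V. \<phi> x = 0}"
proof -
  show s: "subspace {x\<in>V. \<phi> x = 0}"
    using subspace_inter[OF assms(1) dual.linear_subspace_kernel[OF assms(2)]]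
    by (simp add: Int_def)
  show "dim V = Suc (dim {x\<in>V. \<phi> x = 0})"
  proof (rule dim_hyperplane_eq[OF s assms(1)])
    show "V \<subseteq> span (insert w {x \<in> V. \<phi> x = 0})"
    proof
      fix x assume x: "x \<in> V"
      have "x - (\<phi> x / \<phi> w) *s w \<in> {x \<in> V. \<phi> x = 0}"
        using assms x by (auto simp: fnl_simps[OF assms(2)] intro: subspace_diff subspace_scale)
      then show "x \<in> span (insert w {x \<in> V. \<phi> x = 0})"
        unfolding span_insert by (auto intro: span_base)
    qed
  qed (use assms in auto)
qed

text \<open>The functionals dual to a Jordan basis. They are zero outside the diagram, so that the
  shift rule in the last clause holds for all indices, also when \<open>j + k\<close> runs past the
  end of a row.\<close>

definition coords :: "('b \<Rightarrow> 'b) \<Rightarrow> 'b set \<Rightarrow> (nat \<Rightarrow> nat) \<Rightarrow> (nat \<times> nat \<Rightarrow> 'b) \<Rightarrow>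
    (nat \<times> nat \<Rightarrow> 'b \<Rightarrow> 'a) \<Rightarrow> bool" where
  "coords \<eta> W lam b co \<longleftrightarrow> (\<forall>p. fnl (co p)) \<and>
     (\<forall>p. \<forall>q\<in>young lam. co p (b q) = (if p = q then 1 else 0)) \<and>
     (\<forall>p x. p \<notin> young lam \<longrightarrow> co p x = 0) \<and>
     (\<forall>x\<in>W. x = (\<Sum>p\<in>young lam. co p x *s b p)) \<and>
     (\<forall>x\<in>W. \<forall>i j k. co (i, j) ((\<eta> ^^ k) x) = co (i, j + k) x)"

text \<open>Relational counterpart of \<open>jordan_type\<close>: it carries the existence of a
  Jordan basis, which the definite description does not.\<close>

definition JT :: "('b \<Rightarrow> 'b) \<Rightarrow> 'b set \<Rightarrow> (nat \<Rightarrow> nat) \<Rightarrow> bool" where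
  "JT \<eta> W lam \<longleftrightarrow> is_partition lam \<and> (\<exists>b. jordan_basis \<eta> W lam b)"

lemma JT_partition: "JT \<eta> W lam \<Longrightarrow> is_partition lam"
  by (simp add: JT_def)

lemma dual_family:
  assumes "inj_on b Y" "independent (b ` Y)"
  obtains co where "\<forall>p. fnl (co p)" "\<forall>p. \<forall>q\<in>Y. co p (b q) = (if p = q then 1 else 0)"
    "\<forall>p x. p \<notin> Y \<longrightarrow> co p x = 0"
proof -
  have "\<exists>c. fnl c \<and> (\<forall>q\<in>Y. c (b q) = (if p = q then 1 else 0)) \<and> (p \<notin> Y \<longrightarrow> c = (\<lambda>_. 0))" for p
  proof (cases "p \<in> Y")
    case True
    obtain c where c: "fnl c" "\<forall>x\<in>b ` Y. c x = (if x = b p then 1 else 0)"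
      using dual.linear_independent_extend[OF assms(2), of "\<lambda>x. if x = b p then 1 else 0"] by blast
    then have "\<forall>q\<in>Y. c (b q) = (if p = q then 1 else 0)"
      using True assms(1) by (auto simp: inj_on_def)
    with c True show ?thesis by blast
  next
    case False then show ?thesis by (intro exI[of _ "\<lambda>_. 0"]) (auto intro: fnlI)
  qed
  then obtain co where "\<And>p. fnl (co p) \<and> (\<forall>q\<in>Y. co p (b q) = (if p = q then 1 else 0)) \<and>
      (p \<notin> Y \<longrightarrow> co p = (\<lambda>_. 0))" by metis
  then show thesis by (intro that[of co]) auto
qed

lemma lin_rank_one:
  assumes "fnl \<phi>"
  shows "lin (\<lambda>x. \<phi> x *s v)"
  by (rule linI) (simp_all add: fnl_simps[OF assms] scale_left_distrib)

lemma lin_sum: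
  assumes "\<And>i. i \<in> I \<Longrightarrow> lin (f i)"
  shows "lin (\<lambda>x. \<Sum>i\<in>I. f i x)"
proof (rule linI)
  show "(\<Sum>i\<in>I. f i (x + y)) = (\<Sum>i\<in>I. f i x) + (\<Sum>i\<in>I. f i y)" for x y
    unfolding sum.distrib[symmetric] by (intro sum.cong refl endo.linear_add assms)
  show "(\<Sum>i\<in>I. f i (c *s x)) = c *s (\<Sum>i\<in>I. f i x)" for x c
    unfolding scale_sum_right by (intro sum.cong refl endo.linear_scale assms)
qed

lemma dual_family_expand:
  assumes "finite Y" "\<And>p. fnl (co p)" "\<And>p q. q \<in> Y \<Longrightarrow> co p (b q) = (if p = q then 1 else 0)"
    "x \<in> span (b ` Y)"
  shows "x = (\<Sum>p\<in>Y. co p x *s b p)"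
proof (rule endo.linear_eq_on[OF _ _ assms(4)])
  show "lin (\<lambda>x. x)" by (rule linI) auto
  show "lin (\<lambda>x. \<Sum>p\<in>Y. co p x *s b p)" by (intro lin_sum lin_rank_one assms)
  fix z assume "z \<in> b ` Y"
  then obtain q where q: "q \<in> Y" "z = b q" by auto
  have "(\<Sum>p\<in>Y. co p z *s b p) = (\<Sum>p\<in>Y. if p = q then b p else 0)"
    using q assms(3) by (intro sum.cong) auto
  then show "z = (\<Sum>p\<in>Y. co p z *s b p)" using q assms(1) by simp
qed

lemma jordan_basis_subspace: "jordan_basis \<eta> W lam b \<Longrightarrow> subspace W"
  by (auto simp: jordan_basis_def)

lemma jordan_basis_mem: "jordan_basis \<eta> W lam b \<Longrightarrow> j < lam i \<Longrightarrow> b (i, j) \<in> W"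
  by (auto simp: jordan_basis_def mem_young intro!: span_base)

lemma jordan_basis_apply:
  "jordan_basis \<eta> W lam b \<Longrightarrow> j < lam i \<Longrightarrow> \<eta> (b (i, j)) = (if j = 0 then 0 else b (i, j - 1))"
  by (fastforce simp: jordan_basis_def young_def)

lemma jordan_basis_apply_pow:
  assumes "jordan_basis \<eta> W lam b" "j < lam i" "lin \<eta>"
  shows "(\<eta> ^^ k) (b (i, j)) = (if k \<le> j then b (i, j - k) else 0)"
proof (induction k)
  case (Suc k)
  show ?case
    using Suc jordan_basis_apply[OF assms(1), of "j - k" i] assms(2,3)
    by (auto simp: lin_simps[OF assms(3)])
qed simp

lemma jordan_basis_stable:
  assumes "jordan_basis \<eta> W lam b" "lin \<eta>"
  shows "\<eta> ` W \<subseteq> W"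
proof -
  have "\<eta> ` W = span (\<eta> ` (b ` young lam))"
    using assms by (auto simp: jordan_basis_def endo.linear_span_image)
  also have "\<dots> \<subseteq> W"
    using jordan_basis_apply[OF assms(1)] jordan_basis_mem[OF assms(1)] jordan_basis_subspace[OF assms(1)]
    by (intro span_minimal) (auto simp: mem_young subspace_0)
  finally show ?thesis .
qed

lemma jordan_basis_coords:
  assumes jb: "jordan_basis \<eta> W lam b" and "lin \<eta>" and fin: "finite {i. lam i \<noteq> 0}"
  obtains co where "coords \<eta> W lam b co"
proof -
  have jb': "inj_on b (young lam)" "independent (b ` young lam)" "span (b ` young lam) = W"
    using jb by (auto simp: jordan_basis_def)
  obtain co where co': "\<forall>p. fnl (co p)"
    "\<forall>p. \<forall>q\<in>young lam. co p (b q) = (if p = q then 1 else 0)"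
    "\<forall>p x. p \<notin> young lam \<longrightarrow> co p x = 0"
    by (rule dual_family[OF jb'(1,2)])
  then have co: "\<And>p. fnl (co p)"
    "\<And>p q. q \<in> young lam \<Longrightarrow> co p (b q) = (if p = q then 1 else 0)"
    "\<And>p x. p \<notin> young lam \<Longrightarrow> co p x = 0" by blast+
  have shift: "co (i, j) ((\<eta> ^^ k) x) = co (i, j + k) x" if "x \<in> W" for x i j k
  proof (rule dual.linear_eq_on[of "\<lambda>x. co (i, j) ((\<eta> ^^ k) x)" "co (i, j + k)"])
    show "fnl (\<lambda>x. co (i, j) ((\<eta> ^^ k) x))" by (rule fnl_comp[OF co(1) lin_funpow[OF assms(2)]])
    show "fnl (co (i, j + k))" by (rule co)
    show "x \<in> span (b ` young lam)" using that jb' by simp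
    fix z assume "z \<in> b ` young lam"
    then obtain i' j' where z: "z = b (i', j')" "j' < lam i'" by (auto simp: mem_young)
    then show "co (i, j) ((\<eta> ^^ k) z) = co (i, j + k) z"
      using jordan_basis_apply_pow[OF jb z(2) assms(2), of k] co(2)[of "(i', j')"]
        co(2)[of "(i', j' - k)"]
      by (auto simp: mem_young fnl_simps[OF co(1)] split: if_splits)
  qed
  have "x = (\<Sum>p\<in>young lam. co p x *s b p)" if "x \<in> W" for x
    using dual_family_expand[OF finite_young[OF fin] co(1,2), where x=x] that jb' by blast
  then have "coords \<eta> W lam b co" unfolding coords_def using co' shift by blast
  then show thesis by (rule that)
qed

lemma jordan_basis_dim:
  assumes "jordan_basis \<eta> W lam b" "finite {i. lam i \<noteq> 0}"
  shows "dim W = psize lam"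
proof -
  have "dim W = card (b ` young lam)"
    using assms(1) dim_span_eq_card_independent[of "b ` young lam"] by (simp add: jordan_basis_def)
  also have "\<dots> = psize lam"
    using assms card_young[OF assms(2)] by (auto simp: jordan_basis_def card_image)
  finally show ?thesis .
qed

lemma JT_dim: "JT \<eta> W lam \<Longrightarrow> dim W = psize lam"
  unfolding JT_def using jordan_basis_dim is_partition_finite by blast

lemma JT_subspace: "JT \<eta> W lam \<Longrightarrow> subspace W"
  by (auto simp: JT_def dest: jordan_basis_subspace)

lemma JT_stable: "JT \<eta> W lam \<Longrightarrow> lin \<eta> \<Longrightarrow> \<eta> ` W \<subseteq> W"
  by (auto simp: JT_def dest: jordan_basis_stable)

text \<open>By the shift rule, a coordinate of \<open>x\<close> in a column at or beyond
  \<open>k\<close> is a coordinate of \<open>(\<eta> ^^ k) x\<close>. It vanishes when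
  \<open>x\<close> is in the kernel, and only \<open>cols lam k\<close> remains.\<close>

lemma jordan_basis_ker_pow:
  assumes jb: "jordan_basis \<eta> W lam b" and "lin \<eta>" and fin: "finite {i. lam i \<noteq> 0}"
  shows "W \<inter> ker_pow \<eta> k = span (b ` cols lam k)"
proof
  show "span (b ` cols lam k) \<subseteq> W \<inter> ker_pow \<eta> k"
  proof (rule span_minimal)
    show "b ` cols lam k \<subseteq> W \<inter> ker_pow \<eta> k"
      using jordan_basis_mem[OF jb] jordan_basis_apply_pow[OF jb _ assms(2)]
      by (auto simp: cols_def ker_pow_def)
    show "subspace (W \<inter> ker_pow \<eta> k)"
      using jordan_basis_subspace[OF jb] subspace_ker_pow[OF assms(2)] by (rule subspace_inter)
  qed
  obtain co where "coords \<eta> W lam b co" by (rule jordan_basis_coords[OF assms])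
  then have co: "\<And>p. fnl (co p)"
    "\<And>x. x \<in> W \<Longrightarrow> x = (\<Sum>p\<in>young lam. co p x *s b p)"
    "\<And>x i j k. x \<in> W \<Longrightarrow> co (i, j) ((\<eta> ^^ k) x) = co (i, j + k) x"
    unfolding coords_def by blast+
  show "W \<inter> ker_pow \<eta> k \<subseteq> span (b ` cols lam k)"
  proof
    fix x assume x: "x \<in> W \<inter> ker_pow \<eta> k"
    have "co p x *s b p \<in> span (b ` cols lam k)" if "p \<in> young lam" for p
    proof (cases "snd p < k")
      case True then have "p \<in> cols lam k" using that by (auto simp: cols_def young_def)
      then show ?thesis by (intro span_scale span_base) auto
    next
      case False
      have "co (fst p, snd p - k) ((\<eta> ^^ k) x) = 0" using x by (simp add: ker_pow_def fnl_simps[OF co(1)])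
      then have "co p x = 0" using co(3)[of x "fst p" "snd p - k" k] x False by simp
      then show ?thesis by (simp add: span_zero)
    qed
    then have "(\<Sum>p\<in>young lam. co p x *s b p) \<in> span (b ` cols lam k)" by (intro span_sum)
    then show "x \<in> span (b ` cols lam k)" using co(2)[of x] x by simp
  qed
qed

lemma JT_dim_ker_pow:
  assumes "JT \<eta> W lam" "lin \<eta>"
  shows "dim (W \<inter> ker_pow \<eta> k) = card (cols lam k)"
proof -
  obtain b where b: "jordan_basis \<eta> W lam b" and p: "is_partition lam" using assms by (auto simp: JT_def)
  have "independent (b ` cols lam k)" "inj_on b (cols lam k)"
    using b cols_subset[of lam k] independent_mono[of "b ` young lam" "b ` cols lam k"]
      inj_on_subset[of b "young lam" "cols lam k"]
    by (auto simp: jordan_basis_def)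
  then show ?thesis
    using jordan_basis_ker_pow[OF b assms(2) is_partition_finite[OF p], of k]
    by (simp add: dim_eq_card_independent card_image)
qed

lemma JT_unique:
  assumes "JT \<eta> W lam" "JT \<eta> W mu" "lin \<eta>"
  shows "lam = mu"
  by (rule partition_eqI_cols)
    (use assms JT_dim_ker_pow[OF assms(1,3)] JT_dim_ker_pow[OF assms(2,3)] in \<open>auto dest: JT_partition\<close>)

lemma JT_jordan_type: "JT \<eta> W lam \<Longrightarrow> lin \<eta> \<Longrightarrow> jordan_type \<eta> W = lam"
  unfolding jordan_type_def JT_def[symmetric] using JT_unique by (blast intro: the_equality)

lemma JT_nilpotent:
  assumes "JT \<eta> W lam" "lin \<eta>" "x \<in> W"
  shows "(\<eta> ^^ lam 0) x = 0"
proof -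
  obtain b where b: "jordan_basis \<eta> W lam b" and p: "is_partition lam" using assms by (auto simp: JT_def)
  have "cols lam (lam 0) = young lam"
    using is_partition_antimono[OF p le0] by (auto simp: cols_def young_def intro: less_le_trans)
  then have "W \<inter> ker_pow \<eta> (lam 0) = W"
    using jordan_basis_ker_pow[OF b assms(2) is_partition_finite[OF p], of "lam 0"] b
    by (simp add: jordan_basis_def)
  then show ?thesis using assms(3) by (auto simp: ker_pow_def)
qed

text \<open>Isomorphism of the spaces with endomorphism \<open>V1\<close> and \<open>V2\<close>. It
  is given by a linear map of the ambient space, since subspaces are sets here and not types of
  their own.\<close>

definition iso :: "('b \<Rightarrow> 'b) \<Rightarrow> 'b set \<Rightarrow> ('b \<Rightarrow> 'b) \<Rightarrow> 'b set \<Rightarrow> ('b \<Rightarrow> 'b) \<Rightarrow> bool" where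
  "iso \<eta>1 V1 \<eta>2 V2 G \<longleftrightarrow> lin G \<and> inj_on G V1 \<and> G ` V1 = V2 \<and> (\<forall>x\<in>V1. G (\<eta>1 x) = \<eta>2 (G x))"

lemma iso_jordan_basis:
  assumes "iso \<eta>1 V1 \<eta>2 V2 G" "jordan_basis \<eta>1 W lam b" "W \<subseteq> V1"
  shows "jordan_basis \<eta>2 (G ` W) lam (G \<circ> b)"
proof -
  have G: "lin G" "inj_on G V1" "\<forall>x\<in>V1. G (\<eta>1 x) = \<eta>2 (G x)" using assms by (auto simp: iso_def)
  have jb: "inj_on b (young lam)" "independent (b ` young lam)" "span (b ` young lam) = W"
    using assms(2) by (auto simp: jordan_basis_def)
  have inj: "inj_on G W" using G(2) assms(3) by (rule inj_on_subset)
  have "inj_on (G \<circ> b) (young lam)"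
    using jb inj_on_subset[OF inj, of "b ` young lam"] span_superset[of "b ` young lam"]
    by (intro comp_inj_on) auto
  moreover have "independent (G ` (b ` young lam))"
    using jb inj G by (intro endo.linear_independent_injective_image) auto
  moreover have "span (G ` (b ` young lam)) = G ` W"
    using jb G by (simp add: endo.linear_span_image)
  moreover have "\<eta>2 (G (b (i, j))) = (if j = 0 then 0 else G (b (i, j - 1)))" if "j < lam i" for i j
    using G(3) jordan_basis_mem[OF assms(2) that] jordan_basis_apply[OF assms(2) that] assms(3)
    by (metis endo.linear_0 G(1) subsetD)
  ultimately show ?thesis by (auto simp: jordan_basis_def image_comp mem_young)
qed

lemma iso_JT: "iso \<eta>1 V1 \<eta>2 V2 G \<Longrightarrow> JT \<eta>1 W lam \<Longrightarrow> W \<subseteq> V1 \<Longrightarrow> JT \<eta>2 (G ` W) lam"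
  unfolding JT_def using iso_jordan_basis by blast

lemma jordan_basis_cong:
  assumes "jordan_basis \<eta> W lam b" "\<And>x. x \<in> W \<Longrightarrow> \<eta>' x = \<eta> x"
  shows "jordan_basis \<eta>' W lam b"
  using assms jordan_basis_mem[OF assms(1)] unfolding jordan_basis_def by (auto simp: mem_young)

lemma JT_cong: "JT \<eta> W lam \<Longrightarrow> (\<And>x. x \<in> W \<Longrightarrow> \<eta>' x = \<eta> x) \<Longrightarrow> JT \<eta>' W lam"
  unfolding JT_def using jordan_basis_cong by blast

lemma iso_inverse:
  assumes "iso \<eta>1 V1 \<eta>2 V2 G" "subspace V1" "\<eta>1 ` V1 \<subseteq> V1"
  obtains G' where "iso \<eta>2 V2 \<eta>1 V1 G'" "\<And>x. x \<in> V1 \<Longrightarrow> G' (G x) = x" "\<And>x. x \<in> V2 \<Longrightarrow> G (G' x) = x"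
proof -
  have G: "lin G" "inj_on G V1" "G ` V1 = V2" "\<forall>x\<in>V1. G (\<eta>1 x) = \<eta>2 (G x)"
    using assms by (auto simp: iso_def)
  obtain G' where G': "lin G'" "\<forall>v\<in>V1. G' (G v) = v"
    using endo.linear_exists_left_inverse_on[OF G(1) assms(2) G(2)] by blast
  have 2: "G (G' x) = x" if "x \<in> V2" for x using that G' G(3) by auto
  have "iso \<eta>2 V2 \<eta>1 V1 G'"
    unfolding iso_def
  proof (intro conjI ballI)
    show "inj_on G' V2" using 2 by (metis inj_onI)
    show "G' ` V2 = V1" using G(3) G'(2) by force
    fix x assume "x \<in> V2"
    then obtain y where y: "y \<in> V1" "x = G y" using G(3) by auto
    then have "\<eta>2 x = G (\<eta>1 y)" using G(4) by simp
    moreover have "\<eta>1 y \<in> V1" using assms(3) y by auto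
    ultimately show "G' (\<eta>2 x) = \<eta>1 (G' x)" using G'(2) y by simp
  qed (fact G')
  then show thesis using that G' 2 by blast
qed

lemma iso_of_jordan_bases:
  assumes "jordan_basis \<eta>1 V1 lam b1" "jordan_basis \<eta>2 V2 lam b2" "lin \<eta>1" "lin \<eta>2"
  obtains G where "iso \<eta>1 V1 \<eta>2 V2 G" "\<And>p. p \<in> young lam \<Longrightarrow> G (b1 p) = b2 p"
proof -
  note d1 = assms(1)[unfolded jordan_basis_def] and d2 = assms(2)[unfolded jordan_basis_def]
  let ?Y = "young lam"
  obtain G where G: "lin G" "\<forall>x\<in>b1 ` ?Y. G x = b2 (the_inv_into ?Y b1 x)"
    using endo.linear_independent_extend[of "b1 ` ?Y" "\<lambda>x. b2 (the_inv_into ?Y b1 x)"] d1 by blast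
  have Gb: "G (b1 p) = b2 p" if "p \<in> ?Y" for p
    using G(2) that d1 by (simp add: the_inv_into_f_f)
  then have im: "G ` b1 ` ?Y = b2 ` ?Y" by (force simp: image_comp)
  have "inj_on G (span (b1 ` ?Y))"
  proof (rule endo.linear_inj_on_span_independent_image[OF G(1)])
    show "independent (G ` b1 ` ?Y)" using im d2 by simp
    show "inj_on G (b1 ` ?Y)"
      using d2 Gb by (auto simp: inj_on_def)
  qed
  moreover have "G ` V1 = V2"
    using d1 d2 im endo.linear_span_image[OF G(1), of "b1 ` ?Y"] by simp
  moreover have "G (\<eta>1 x) = \<eta>2 (G x)" if "x \<in> V1" for x
  proof (rule endo.linear_eq_on[of "\<lambda>x. G (\<eta>1 x)" "\<lambda>x. \<eta>2 (G x)"])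
    show "x \<in> span (b1 ` ?Y)" using that d1 by simp
    show "lin (\<lambda>x. G (\<eta>1 x))" "lin (\<lambda>x. \<eta>2 (G x))"
      by (auto intro!: linI simp: lin_simps[OF assms(3)] lin_simps[OF assms(4)] lin_simps[OF G(1)])
    fix z assume "z \<in> b1 ` ?Y"
    then obtain i j where z: "z = b1 (i, j)" "j < lam i" by (auto simp: mem_young)
    then show "G (\<eta>1 z) = \<eta>2 (G z)"
      using jordan_basis_apply[OF assms(1) z(2)] jordan_basis_apply[OF assms(2) z(2)] Gb
      by (auto simp: mem_young lin_simps[OF G(1)])
  qed
  ultimately have "iso \<eta>1 V1 \<eta>2 V2 G" using G(1) d1 by (auto simp: iso_def)
  then show thesis using that Gb by blast
qed

end


section \<open>Adding one square: stable hyperplanes and common Jordan bases\<close>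

lemma is_partition_add:
  assumes "is_partition mu" "\<And>i. i < r \<Longrightarrow> mu r < mu i"
  shows "is_partition (mu(r := Suc (mu r)))"
  unfolding is_partition_def
proof
  show "antimono (mu(r := Suc (mu r)))"
  proof (rule antimonoI)
    fix i j :: nat assume "i \<le> j"
    then show "(mu(r := Suc (mu r))) j \<le> (mu(r := Suc (mu r))) i"
      using is_partition_antimono[OF assms(1), of i j] assms(2)[of i] by (auto simp: Suc_le_eq)
  qed
  show "finite {i. (mu(r := Suc (mu r))) i \<noteq> 0}"
    by (rule finite_support_add[OF is_partition_finite[OF assms(1)]])
qed

lemma is_partition_addD:
  assumes "is_partition (mu(r := Suc (mu r)))" "i < r"
  shows "mu r < mu i"
  using is_partition_antimono[OF assms(1), of i r] assms(2) by simp

context fd_flag_space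
begin

lemma intertwine_funpow:
  assumes "\<eta>1 ` V \<subseteq> V" "\<And>x. x \<in> V \<Longrightarrow> G (\<eta>1 x) = \<eta>2 (G x)" "x \<in> V"
  shows "G ((\<eta>1 ^^ k) x) = (\<eta>2 ^^ k) (G x)"
  by (induction k) (simp_all add: assms(2) funpow_stable[OF assms(1,3)])

text \<open>Lets a chosen row be moved to the first place among the rows of its length, the only one
  of them where a square may be added.\<close>

lemma jordan_basis_permute_rows:
  assumes jb: "jordan_basis \<eta> W mu b" and s: "\<And>i. s (s i) = i" "\<And>i. mu (s i) = mu i"
  shows "jordan_basis \<eta> W mu (\<lambda>(i, j). b (s i, j))"
proof -
  let ?s = "\<lambda>(i, j). (s i, j)"
  have im: "?s ` young mu = young mu"
  proof
    show "?s ` young mu \<subseteq> young mu" using s by (auto simp: mem_young)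
    show "young mu \<subseteq> ?s ` young mu"
    proof
      fix p assume "p \<in> young mu"
      then have "?s p \<in> young mu" "p = ?s (?s p)" using s by (auto simp: young_def)
      then show "p \<in> ?s ` young mu" by blast
    qed
  qed
  have "inj_on ?s (young mu)" using s(1) by (auto simp: inj_on_def) metis
  then have "inj_on (b \<circ> ?s) (young mu)"
    using jb im by (intro comp_inj_on) (auto simp: jordan_basis_def)
  moreover have "b \<circ> ?s = (\<lambda>(i, j). b (s i, j))" by auto
  moreover have "(b \<circ> ?s) ` young mu = b ` young mu" using im by (metis image_comp)
  ultimately show ?thesis
    using jb jordan_basis_apply[OF jb] s(2) by (auto simp: jordan_basis_def mem_young)
qed

text \<open>In the expansion of \<open>x\<close>, squares in columns before \<open>d - 1\<close>
  contribute to the kernel of \<open>\<eta> ^^ (d - 1)\<close>, those in column \<open>d - 1\<close>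
  of rows longer than \<open>d\<close> contribute to the image of \<eta>, and those further right
  have coefficient 0. By \<open>no\<close> something else must occur: the last square of a row of
  length \<open>d\<close>.\<close>

lemma jordan_basis_row_coeff:
  assumes co: "coords \<eta> H mu b co" and jb: "jordan_basis \<eta> H mu b" and "lin \<eta>"
    and fin: "finite {i. mu i \<noteq> 0}"
    and x: "x \<in> H" "(\<eta> ^^ d) x = 0" "0 < d"
    and no: "\<forall>y\<in>H. \<forall>z\<in>H. (\<eta> ^^ (d - 1)) z = 0 \<longrightarrow> x \<noteq> \<eta> y + z"
  obtains r where "mu r = d" "co (r, d - 1) x \<noteq> 0"
proof (rule ccontr)
  assume "\<not> thesis"
  then have co0: "\<And>r. mu r = d \<Longrightarrow> co (r, d - 1) x = 0" using that by blast
  note co' = co[unfolded coords_def]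
  let ?Y = "young mu"
  let ?Y1 = "{p \<in> ?Y. snd p = d - 1 \<and> d < mu (fst p)}"
  define y where "y = (\<Sum>p\<in>?Y1. co p x *s b (fst p, d))"
  define z where "z = (\<Sum>p\<in>?Y - ?Y1. co p x *s b p)"
  have fY: "finite ?Y" by (rule finite_young[OF fin])
  have sH: "subspace H" by (rule jordan_basis_subspace[OF jb])
  have y: "y \<in> H" unfolding y_def
    by (intro subspace_sum[OF sH] subspace_scale[OF sH] jordan_basis_mem[OF jb]) auto
  have "z \<in> H \<inter> ker_pow \<eta> (d - 1)" unfolding z_def
  proof (rule subspace_sum)
    show sub: "subspace (H \<inter> ker_pow \<eta> (d - 1))"
      by (rule subspace_inter[OF sH subspace_ker_pow[OF assms(3)]])
    fix p assume p: "p \<in> ?Y - ?Y1"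
    obtain i j where ij: "p = (i, j)" by (cases p)
    with p have j: "j < mu i" by (auto simp: mem_young)
    consider "j < d - 1" | "j = d - 1" "mu i = d" | "d \<le> j"
      using p ij j x(3) by fastforce
    then show "co p x *s b p \<in> H \<inter> ker_pow \<eta> (d - 1)"
    proof cases
      case 1
      then have "b p \<in> H \<inter> ker_pow \<eta> (d - 1)"
        using jordan_basis_mem[OF jb j] jordan_basis_apply_pow[OF jb j assms(3)] ij
        by (auto simp: ker_pow_def)
      then show ?thesis by (rule subspace_scale[OF sub])
    next
      case 2 then show ?thesis using co0 ij subspace_0[OF sub] by simp
    next
      case 3
      have "co (i, j - d) ((\<eta> ^^ d) x) = co (i, j - d + d) x" using co' x(1) by blast
      then have "co p x = 0" using 3 x(2) ij co' by (simp add: dual.linear_0[of "co (i, j - d)"])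
      then show ?thesis using subspace_0[OF sub] by simp
    qed
  qed
  then have z: "z \<in> H" "(\<eta> ^^ (d - 1)) z = 0" by (auto simp: ker_pow_def)
  have "\<eta> y = (\<Sum>p\<in>?Y1. co p x *s b p)"
    unfolding y_def endo.linear_sum[OF assms(3)]
    using x(3) by (intro sum.cong refl)
      (auto simp: endo.linear_scale[OF assms(3)] jordan_basis_apply[OF jb])
  moreover have "x = (\<Sum>p\<in>?Y. co p x *s b p)" using co' x(1) by blast
  then have "x = (\<Sum>p\<in>?Y1. co p x *s b p) + z"
    unfolding z_def using sum.subset_diff[of ?Y1 ?Y "\<lambda>p. co p x *s b p"] fY
    by (simp add: add.commute)
  ultimately have "x = \<eta> y + z" by simp
  then show False using no y z by blast
qed

text \<open>The chain \<open>x\<close>, \<open>\<eta> x\<close>, ... replaces a row of length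
  \<open>d\<close> in which \<open>x\<close> has a nonzero last coefficient. The replacement is
  effected by an automorphism \<open>g\<close> of \<open>H\<close>, so the new vectors again form a
  Jordan basis.\<close>

lemma jordan_basis_row_exchange:
  assumes jb: "jordan_basis \<eta> H mu b" and lin: "lin \<eta>" and part: "is_partition mu"
    and x: "x \<in> H" "(\<eta> ^^ d) x = 0" "0 < d"
    and no: "\<forall>y\<in>H. \<forall>z\<in>H. (\<eta> ^^ (d - 1)) z = 0 \<longrightarrow> x \<noteq> \<eta> y + z"
  obtains r b' where "jordan_basis \<eta> H mu b'" "mu r = d" "\<forall>i<r. mu r < mu i" "b' (r, d - 1) = x"
proof -
  note fin = is_partition_finite[OF part]
  have sH: "subspace H" by (rule jordan_basis_subspace[OF jb])
  have stab: "\<eta> ` H \<subseteq> H" by (rule jordan_basis_stable[OF jb lin])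
  have JTH: "JT \<eta> H mu" using jb part by (auto simp: JT_def)
  obtain co where co: "coords \<eta> H mu b co" by (rule jordan_basis_coords[OF jb lin fin])
  note co' = co[unfolded coords_def]
  have fco: "fnl (co p)" for p using co' by blast
  obtain r0 where r0: "mu r0 = d" "co (r0, d - 1) x \<noteq> 0"
    using jordan_basis_row_coeff[OF co jb lin fin x no] by blast
  \<comment> \<open>\<open>g = 1 + S\<close> sends \<open>b (r0, j)\<close> to
    \<open>(\<eta> ^^ (d - 1 - j)) x\<close> and fixes the vectors of all other rows.\<close>
  define S where "S = (\<lambda>y. \<Sum>j<d. co (r0, j) y *s ((\<eta> ^^ (d - 1 - j)) x - b (r0, j)))"
  define g where "g = (\<lambda>y. y + S y)"
  have xk: "(\<eta> ^^ k) x \<in> H" for k by (rule funpow_stable[OF stab x(1)])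
  have "lin S"
    unfolding S_def by (intro lin_sum lin_rank_one fco)
  note l' = lin_simps[OF this]
  have ling: "lin g" unfolding g_def by (rule linI) (simp_all add: l' scale_right_distrib)
  have gb: "g (b (i, j)) = (if i = r0 then (\<eta> ^^ (d - 1 - j)) x else b (i, j))" if "j < mu i" for i j
  proof -
    have "co (r0, j') (b (i, j)) = (if r0 = i \<and> j' = j then 1 else 0)" for j'
      using co' that by (auto simp: mem_young)
    then have "g (b (i, j)) = b (i, j) +
       (\<Sum>j'<d. if j' = j then (if r0 = i then (\<eta> ^^ (d - 1 - j)) x - b (r0, j) else 0) else 0)"
      unfolding g_def S_def by (intro arg_cong2[where f="(+)"] refl sum.cong) auto
    then show ?thesis using that r0(1) by auto
  qed
  have comm: "g (\<eta> y) = \<eta> (g y)" if "y \<in> H" for y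
  proof (rule endo.linear_eq_on[of "\<lambda>y. g (\<eta> y)" "\<lambda>y. \<eta> (g y)"])
    show "lin (\<lambda>y. g (\<eta> y))" "lin (\<lambda>y. \<eta> (g y))"
      by (auto intro!: linI simp: lin_simps[OF lin] lin_simps[OF ling])
    show "y \<in> span (b ` young mu)" using that jb by (simp add: jordan_basis_def)
    fix z assume "z \<in> b ` young mu"
    then obtain i j where z: "z = b (i, j)" "j < mu i" by (auto simp: mem_young)
    show "g (\<eta> z) = \<eta> (g z)"
    proof (cases "j = 0")
      case True
      then have "\<eta> z = 0" using z jordan_basis_apply[OF jb z(2)] by simp
      moreover have "\<eta> (g z) = 0"
      proof (cases "i = r0")
        case i: True
        have "\<eta> (g z) = (\<eta> ^^ (Suc (d - 1))) x" using gb[OF z(2)] z i True by simp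
        then show ?thesis using x by simp
      next
        case False then show ?thesis using gb[OF z(2)] z \<open>\<eta> z = 0\<close> by simp
      qed
      ultimately show ?thesis by (simp add: lin_simps[OF ling])
    next
      case False
      then have e: "\<eta> z = b (i, j - 1)" using z jordan_basis_apply[OF jb z(2)] by simp
      show ?thesis
      proof (cases "i = r0")
        case True
        then have d: "d - 1 - (j - 1) = Suc (d - 1 - j)" using False z r0 by simp
        have "g (\<eta> z) = (\<eta> ^^ (d - 1 - (j - 1))) x" using gb[of "j - 1" i] z e True by simp
        then show ?thesis unfolding d using gb[OF z(2)] z True by simp
      next
        case i: False then show ?thesis using gb[OF z(2)] gb[of "j - 1" i] z e by simp
      qed
    qed
  qed
  have gH: "g ` H \<subseteq> H" unfolding g_def S_def
    using r0(1) by (auto intro!: subspace_add[OF sH] subspace_sum[OF sH] subspace_scale[OF sH]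
        subspace_diff[OF sH] xk jordan_basis_mem[OF jb])
  \<comment> \<open>The kernel of \<open>g\<close> in \<open>H\<close> is stable under \<eta>, so if
    nonzero it contains some \<open>y'\<close> with \<open>\<eta> y' = 0\<close>. Such a
    \<open>y'\<close> lives in column 0, and the coefficient at \<open>(r0, 0)\<close> of
    \<open>g y' = 0\<close> is the product of \<open>co (r0, 0) y'\<close> and the nonzero
    \<open>co (r0, d - 1) x\<close>; hence \<open>g y' = y'\<close> and
    \<open>y' = 0\<close>.\<close>
  have inj: "inj_on g H"
    unfolding endo.linear_inj_on_iff_eq_0[OF ling sH]
  proof (intro ballI impI)
    fix y assume y: "y \<in> H" "g y = 0"
    show "y = 0"
    proof (rule ccontr)
      assume "y \<noteq> 0"
      define s where "s = (LEAST s. (\<eta> ^^ s) y = 0)"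
      have s: "(\<eta> ^^ s) y = 0" unfolding s_def using JT_nilpotent[OF JTH lin y(1)] by (rule LeastI)
      have s0: "s \<noteq> 0" using s \<open>y \<noteq> 0\<close> by (metis funpow_0)
      define y' where "y' = (\<eta> ^^ (s - 1)) y"
      have "y' \<noteq> 0" unfolding y'_def using not_less_Least[of "s - 1" "\<lambda>s. (\<eta> ^^ s) y = 0"] s0
        unfolding s_def by simp
      have "\<eta> y' = (\<eta> ^^ (Suc (s - 1))) y" by (simp add: y'_def)
      then have e0: "\<eta> y' = 0" using s s0 by simp
      have y'H: "y' \<in> H" unfolding y'_def by (rule funpow_stable[OF stab y(1)])
      have "g y' = (\<eta> ^^ (s - 1)) (g y)" unfolding y'_def
        using intertwine_funpow[OF stab, of g \<eta>] comm y(1) by blast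
      then have gy': "g y' = 0" using y(2) by (simp add: lin_simps[OF lin_funpow[OF lin]])
      have cj: "co (r0, j) y' = 0" if "0 < j" for j
      proof -
        have "co (r0, j - 1) ((\<eta> ^^ 1) y') = co (r0, j - 1 + 1) y'" using co' y'H by blast
        then show ?thesis using that e0 by (simp add: fnl_simps[OF fco])
      qed
      have "(\<Sum>j<d. co (r0, j) y' *s ((\<eta> ^^ (d - 1 - j)) x - b (r0, j))) =
          (\<Sum>j<d. if j = 0 then co (r0, 0) y' *s ((\<eta> ^^ (d - 1)) x - b (r0, 0)) else 0)"
        by (intro sum.cong) (auto simp: cj)
      then have g': "g y' = y' + co (r0, 0) y' *s ((\<eta> ^^ (d - 1)) x - b (r0, 0))"
        unfolding g_def S_def using x(3) by simp
      have c1: "co (r0, 0) (b (r0, 0)) = 1" using co' r0 x(3) by (simp add: mem_young)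
      have c2: "co (r0, 0) ((\<eta> ^^ (d - 1)) x) = co (r0, 0 + (d - 1)) x" using co' x(1) by blast
      have "co (r0, 0) (g y') = co (r0, 0) y' * co (r0, d - 1) x"
        unfolding g' using c1 c2 by (simp add: fnl_simps[OF fco] algebra_simps)
      then have "co (r0, 0) y' = 0" using gy' r0(2) by (simp add: fnl_simps[OF fco])
      then show False using g' gy' \<open>y' \<noteq> 0\<close> by simp
    qed
  qed
  have "g ` H = H"
  proof (rule subspace_dim_equal[OF endo.linear_subspace_image[OF ling sH] sH gH])
    show "dim H \<le> dim (g ` H)" using endo.dim_image_eq[OF ling, of H] inj sH
      by (metis order_refl span_eq_iff)
  qed
  then have "iso \<eta> H \<eta> H g" using ling inj comm by (auto simp: iso_def)
  from iso_jordan_basis[OF this jb order_refl] have jb2: "jordan_basis \<eta> H mu (g \<circ> b)"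
    using \<open>g ` H = H\<close> by simp
  \<comment> \<open>The first row of length \<open>d\<close>: one more square there keeps a
    partition. The exchanged row \<open>r0\<close> is moved to this place by a
    transposition.\<close>
  define r where "r = (LEAST i. mu i = d)"
  have r: "mu r = d" unfolding r_def using r0(1) by (rule LeastI)
  have least: "mu r < mu i" if "i < r" for i
  proof -
    have "mu i \<noteq> d" using that not_less_Least unfolding r_def by blast
    then show ?thesis using is_partition_antimono[OF part, of i r] that r by simp
  qed
  have "jordan_basis \<eta> H mu (\<lambda>(i, j). (g \<circ> b) (transpose r r0 i, j))"
    by (rule jordan_basis_permute_rows[OF jb2]) (auto simp: transpose_def r r0(1))
  moreover have "(g \<circ> b) (transpose r r0 r, d - 1) = x"
    using gb[of "d - 1" r0] r0(1) x(3) by simp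
  ultimately show thesis using r least
    by (intro that[of "\<lambda>(i, j). (g \<circ> b) (transpose r r0 i, j)" r]) auto
qed

lemma jordan_basis_extend:
  assumes jb: "jordan_basis \<eta> H mu b" and v: "v \<notin> H"
    and ev: "\<eta> v = (if mu r = 0 then 0 else b (r, mu r - 1))"
  shows "jordan_basis \<eta> H mu (b((r, mu r) := v))"
    and "jordan_basis \<eta> (span (insert v H)) (mu(r := Suc (mu r))) (b((r, mu r) := v))"
proof -
  let ?b = "b((r, mu r) := v)" and ?Y = "young mu"
  note d = jb[unfolded jordan_basis_def]
  have nin: "(r, mu r) \<notin> ?Y" by (simp add: mem_young)
  then have eq: "?b p = b p" if "p \<in> ?Y" for p using that by auto
  have im: "?b ` ?Y = b ` ?Y" using nin by (auto simp: image_def)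
  show jb': "jordan_basis \<eta> H mu ?b"
    using d eq im nin by (auto simp: jordan_basis_def inj_on_def mem_young split: if_splits)
  have im': "?b ` young (mu(r := Suc (mu r))) = insert v (b ` ?Y)"
    unfolding young_add image_insert im by simp
  have vn: "v \<notin> span (b ` ?Y)" using v d by simp
  have "inj_on ?b (insert (r, mu r) ?Y)"
    using jb' vn span_superset[of "b ` ?Y"] im by (auto simp: jordan_basis_def nin)
  moreover have "independent (insert v (b ` ?Y))" using d vn by (intro independent_insertI) auto
  moreover have "span (insert v (b ` ?Y)) = span (insert v H)"
  proof -
    have "span (insert v (span (b ` ?Y))) = span (insert v (b ` ?Y))"
      by (simp add: span_insert span_span)
    then show ?thesis using d by simp
  qed
  moreover have "\<eta> (?b (i, j)) = (if j = 0 then 0 else ?b (i, j - 1))"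
    if "(i, j) \<in> insert (r, mu r) ?Y" for i j
    using that ev jordan_basis_apply[OF jb, of j i] by (auto simp: mem_young)
  ultimately show "jordan_basis \<eta> (span (insert v H)) (mu(r := Suc (mu r))) ?b"
    unfolding jordan_basis_def im' unfolding young_add by blast
qed

text \<open>Let \<open>c\<close> be the least exponent for which the kernel of the power
  \<open>c\<close> in the big space is not contained in \<open>H\<close>, and \<open>w\<close> a
  vector outside \<open>H\<close> in that kernel. Then \<open>\<eta> w\<close> can be made the last
  vector of a row of length \<open>c - 1\<close> of \<open>H\<close>, and \<open>w\<close> extends
  this row. The last conclusion describes the length of the row without reference to a basis, which
  allows different hyperplanes to be compared.\<close>

lemma extend_jordan:
  assumes lin: "lin \<eta>" and JTH: "JT \<eta> H mu" and v: "v \<notin> H" "\<eta> v \<in> H"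
  obtains r b where "jordan_basis \<eta> H mu b" "is_partition (mu(r := Suc (mu r)))"
    "jordan_basis \<eta> (span (insert v H)) (mu(r := Suc (mu r))) b"
    "\<forall>c. span (insert v H) \<inter> ker_pow \<eta> c \<subseteq> H \<longleftrightarrow> c \<le> mu r"
proof -
  let ?V = "span (insert v H)"
  obtain b where b: "jordan_basis \<eta> H mu b" and part: "is_partition mu" using JTH by (auto simp: JT_def)
  have sH: "subspace H" by (rule JT_subspace[OF JTH])
  have HV: "H \<subseteq> ?V" by (meson span_superset subset_insertI subset_trans)
  have vV: "v \<in> ?V" by (simp add: span_base)
  have dV: "dim ?V = Suc (dim H)"
    using v sH HV vV by (intro dim_hyperplane_eq) auto
  have decomp: "\<exists>a. y - a *s w \<in> H" if "y \<in> ?V" "w \<in> ?V" "w \<notin> H" for y w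
    using hyperplane_decomp(2)[OF sH subspace_span HV dV] that by blast
  have VH: "\<eta> y \<in> H" if y: "y \<in> ?V" for y
  proof -
    obtain a where a: "y - a *s v \<in> H" using decomp[OF y vV v(1)] by blast
    have "\<eta> (y - a *s v) + a *s \<eta> v \<in> H"
      using a JT_stable[OF JTH lin] v(2) by (auto intro!: subspace_add[OF sH] subspace_scale[OF sH])
    then show ?thesis by (simp add: lin_simps[OF lin])
  qed
  let ?P = "\<lambda>c. \<not> ?V \<inter> ker_pow \<eta> c \<subseteq> H"
  have "(\<eta> ^^ (Suc (mu 0))) v = 0"
    using JT_nilpotent[OF JTH lin v(2)] by (simp add: funpow_swap1)
  then have ex: "?P (Suc (mu 0))" using vV v(1) by (auto simp: ker_pow_def)
  define c where "c = (LEAST c. ?P c)"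
  have c: "?P c" unfolding c_def using ex by (rule LeastI)
  have least: "?V \<inter> ker_pow \<eta> k \<subseteq> H" if "k < c" for k
    using not_less_Least that unfolding c_def by blast
  have c0: "c \<noteq> 0" using c subspace_0[OF sH] by (auto simp: ker_pow_def intro: ccontr)
  obtain w where w: "w \<in> ?V" "(\<eta> ^^ c) w = 0" "w \<notin> H" using c by (auto simp: ker_pow_def)
  have spw: "span (insert w H) = ?V"
    by (rule hyperplane_decomp(1)[OF sH subspace_span HV dV w(1,3)])
  have ew: "\<eta> w \<in> H" by (rule VH[OF w(1)])
  have ck: "?V \<inter> ker_pow \<eta> k \<subseteq> H \<longleftrightarrow> k < c" for k
  proof (cases "k < c")
    case False
    have "(\<eta> ^^ k) w = (\<eta> ^^ (k - c)) ((\<eta> ^^ c) w)"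
      using False by (metis comp_apply funpow_add le_add_diff_inverse2 not_less)
    then have "(\<eta> ^^ k) w = 0" using w(2) lin_simps(1)[OF lin_funpow[OF lin]] by simp
    then show ?thesis using w False by (auto simp: ker_pow_def)
  qed (use least in auto)
  have "\<exists>r b'. jordan_basis \<eta> H mu b' \<and> Suc (mu r) = c \<and> (\<forall>i<r. mu r < mu i) \<and>
      \<eta> w = (if mu r = 0 then 0 else b' (r, mu r - 1))"
  proof (cases "c = 1")
    \<comment> \<open>Here \<open>\<eta> w = 0\<close>, and \<open>w\<close> forms a new row of
      length one at the first empty place.\<close>
    case True
    define r where "r = (LEAST i. mu i = 0)"
    have "\<exists>i. mu i = 0"
      using ex_new_if_finite[OF infinite_UNIV_nat is_partition_finite[OF part]] by auto
    then have r: "mu r = 0" unfolding r_def by (rule LeastI_ex)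
    moreover have "mu r < mu i" if "i < r" for i
      using not_less_Least[of i "\<lambda>i. mu i = 0"] that r unfolding r_def[symmetric] by simp
    moreover have "\<eta> w = 0" using w(2) True by simp
    ultimately show ?thesis using b True by (intro exI[of _ r] exI[of _ b]) simp
  next
    case False
    then have d: "0 < c - 1" using c0 by simp
    have x: "(\<eta> ^^ (c - 1)) (\<eta> w) = 0"
      using w(2) c0 by (metis One_nat_def Suc_pred comp_apply funpow_Suc_right neq0_conv)
    \<comment> \<open>Otherwise \<open>w - y\<close> would lie outside \<open>H\<close> and be
      killed by the power \<open>c - 1\<close>, against the choice of \<open>c\<close>.\<close>
    have no: "\<forall>y\<in>H. \<forall>z\<in>H. (\<eta> ^^ (c - 1 - 1)) z = 0 \<longrightarrow> \<eta> w \<noteq> \<eta> y + z"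
    proof (intro ballI impI notI)
      fix y z assume y: "y \<in> H" and z: "z \<in> H" "(\<eta> ^^ (c - 1 - 1)) z = 0" and e: "\<eta> w = \<eta> y + z"
      have "(\<eta> ^^ (c - 1)) (w - y) = (\<eta> ^^ (c - 1 - 1)) (\<eta> (w - y))"
        using d by (metis One_nat_def Suc_pred comp_apply funpow_Suc_right)
      also have "\<eta> (w - y) = z" using e by (simp add: lin_simps[OF lin])
      finally have "w - y \<in> ker_pow \<eta> (c - 1)" using z by (simp add: ker_pow_def)
      moreover have "w - y \<in> ?V" using w(1) y HV by (auto intro: span_diff)
      ultimately have "w - y \<in> H" using least[of "c - 1"] c0 by auto
      then have "w - y + y \<in> H" using y by (rule subspace_add[OF sH])
      then show False using w(3) by simp
    qed
    obtain r b' where "jordan_basis \<eta> H mu b'" "mu r = c - 1" "\<forall>i<r. mu r < mu i"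
        "b' (r, c - 1 - 1) = \<eta> w"
      by (rule jordan_basis_row_exchange[OF b lin part ew x d no])
    then show ?thesis using d by (intro exI[of _ r] exI[of _ b']) simp
  qed
  then obtain r b' where rb: "jordan_basis \<eta> H mu b'" "Suc (mu r) = c" "\<And>i. i < r \<Longrightarrow> mu r < mu i"
      "\<eta> w = (if mu r = 0 then 0 else b' (r, mu r - 1))" by blast
  note ext = jordan_basis_extend[OF rb(1) w(3) rb(4)]
  show thesis
  proof (rule that)
    show "jordan_basis \<eta> H mu (b'((r, mu r) := w))" by (rule ext)
    show "is_partition (mu(r := Suc (mu r)))" using is_partition_add[OF part rb(3)] .
    show "jordan_basis \<eta> ?V (mu(r := Suc (mu r))) (b'((r, mu r) := w))"
      using ext(2) unfolding spw .
    show "\<forall>c. ?V \<inter> ker_pow \<eta> c \<subseteq> H \<longleftrightarrow> c \<le> mu r" using ck rb(2) by auto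
  qed
qed

text \<open>On the line \<open>V / H\<close> the map induces a scalar \<open>a\<close>; nilpotency
  gives \<open>a ^ m = 0\<close>, so \<open>a = 0\<close>.\<close>

lemma stable_hyperplane_image:
  assumes lin: "lin \<eta>" and sH: "subspace H" and sV: "subspace V" and HV: "H \<subseteq> V"
    and dV: "dim V = Suc (dim H)"
    and H: "\<eta> ` H \<subseteq> H" and V: "\<eta> ` V \<subseteq> V" and nil: "\<And>x. x \<in> V \<Longrightarrow> (\<eta> ^^ m) x = 0"
  shows "\<eta> ` V \<subseteq> H"
proof -
  obtain v where v: "v \<in> V" "v \<notin> H"
    using dV HV by (metis n_not_Suc_n subsetI subset_antisym)
  note decomp = hyperplane_decomp(2)[OF sH sV HV dV v]
  obtain a where a: "\<eta> v - a *s v \<in> H" using decomp V v by blast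
  have "(\<eta> ^^ k) v - a ^ k *s v \<in> H" for k
  proof (induction k)
    case (Suc k)
    have "\<eta> ((\<eta> ^^ k) v - a ^ k *s v) + a ^ k *s (\<eta> v - a *s v) \<in> H"
      using Suc H a by (intro subspace_add[OF sH] subspace_scale[OF sH]) auto
    then show ?case by (simp add: lin_simps[OF lin] scale_right_diff_distrib mult.commute)
  qed (simp add: subspace_0[OF sH])
  from this[of m] have "a ^ m *s v \<in> H" using nil[OF v(1)] subspace_neg[OF sH] by force
  then have "a = 0"
    using v(2) subspace_scale[OF sH, of "a ^ m *s v" "inverse (a ^ m)"] by (cases "a = 0") auto
  then have ev: "\<eta> v \<in> H" using a by simp
  show ?thesis
  proof
    fix y assume "y \<in> \<eta> ` V"
    then obtain x where x: "x \<in> V" "y = \<eta> x" by auto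
    obtain c where c: "x - c *s v \<in> H" using decomp x by blast
    have "\<eta> (x - c *s v) + c *s \<eta> v \<in> H"
      using c H ev by (intro subspace_add[OF sH] subspace_scale[OF sH]) auto
    then show "y \<in> H" using x by (simp add: lin_simps[OF lin])
  qed
qed

lemma JT_hyperplane_image:
  assumes "lin \<eta>" "JT \<eta> H mu" "JT \<eta> V lam" "H \<subseteq> V" "dim V = Suc (dim H)"
  shows "\<eta> ` V \<subseteq> H"
  by (rule stable_hyperplane_image[OF assms(1) JT_subspace[OF assms(2)] JT_subspace[OF assms(3)] assms(4,5)
      JT_stable[OF assms(2,1)] JT_stable[OF assms(3,1)] JT_nilpotent[OF assms(3,1)]])

lemma hyperplane_jordan:
  assumes lin: "lin \<eta>" and JTH: "JT \<eta> H mu" and JTV: "JT \<eta> V lam" and HV: "H \<subseteq> V"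
    and dV: "dim V = Suc (dim H)"
  obtains r b where "lam = mu(r := Suc (mu r))" "jordan_basis \<eta> H mu b" "jordan_basis \<eta> V lam b"
    "\<forall>c. V \<inter> ker_pow \<eta> c \<subseteq> H \<longleftrightarrow> c \<le> mu r"
proof -
  note sH = JT_subspace[OF JTH] and sV = JT_subspace[OF JTV]
  obtain v where v: "v \<in> V" "v \<notin> H"
    using dV HV by (metis n_not_Suc_n subsetI subset_antisym)
  have sp: "span (insert v H) = V" by (rule hyperplane_decomp(1)[OF sH sV HV dV v])
  have "\<eta> v \<in> H" using JT_hyperplane_image[OF assms] v(1) by blast
  then obtain r b where rb: "jordan_basis \<eta> H mu b" "is_partition (mu(r := Suc (mu r)))"
    "jordan_basis \<eta> (span (insert v H)) (mu(r := Suc (mu r))) b"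
    "\<forall>c. span (insert v H) \<inter> ker_pow \<eta> c \<subseteq> H \<longleftrightarrow> c \<le> mu r"
    by (rule extend_jordan[OF lin JTH v(2)])
  then have "JT \<eta> V (mu(r := Suc (mu r)))" unfolding sp by (auto simp: JT_def)
  from JT_unique[OF JTV this lin] rb show thesis unfolding sp by (intro that) auto
qed

text \<open>Induction on the dimension. A nilpotent map is not onto on a nonzero \<open>W\<close>,
  so some functional vanishing on the image cuts out a hyperplane that contains the image and is
  therefore stable; \<open>extend_jordan\<close> passes from it to \<open>W\<close>.\<close>

lemma JT_exists:
  assumes lin: "lin \<eta>" and "subspace W" "\<eta> ` W \<subseteq> W" "\<And>x. x \<in> W \<Longrightarrow> (\<eta> ^^ m) x = 0"
  shows "\<exists>lam. JT \<eta> W lam"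
  using assms(2-)
proof (induction "dim W" arbitrary: W rule: less_induct)
  case (less W)
  show ?case
  proof (cases "W = {0}")
    case True
    have "jordan_basis \<eta> W (\<lambda>_. 0) (\<lambda>_. 0)" using True independent_empty by (auto simp: jordan_basis_def young_def)
    then show ?thesis by (intro exI[of _ "\<lambda>_. 0"]) (auto simp: JT_def is_partition_def antimono_def)
  next
    case False
    have "\<eta> ` W \<noteq> W"
    proof
      assume e: "\<eta> ` W = W"
      have "(\<eta> ^^ k) ` W = W" for k
      proof (induction k)
        case (Suc k) then show ?case using e by (metis funpow.simps(2) image_comp)
      qed simp
      from this[of m] less.prems(3) have "W \<subseteq> {0}" by auto
      then show False using False subspace_0[OF less.prems(1)] by auto
    qed
    then obtain w where w: "w \<in> W" "w \<notin> \<eta> ` W" using less.prems(2) by auto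
    have "subspace (\<eta> ` W)" by (rule endo.linear_subspace_image[OF lin less.prems(1)])
    then obtain \<phi> where \<phi>: "fnl \<phi>" "\<And>y. y \<in> \<eta> ` W \<Longrightarrow> \<phi> y = 0" "\<phi> w = 1"
      using separating_functional w(2) by blast
    let ?H = "{x \<in> W. \<phi> x = 0}"
    have dW: "dim W = Suc (dim ?H)" and sH: "subspace ?H"
      using hyperplane_of_functional[OF less.prems(1) \<phi>(1) w(1)] \<phi>(3) by auto
    have "\<exists>mu. JT \<eta> ?H mu"
    proof (rule less.hyps[OF _ sH])
      show "dim ?H < dim W" using dW by simp
      show "\<eta> ` ?H \<subseteq> ?H" using less.prems(2) \<phi>(2) by auto
    qed (use less.prems(3) in auto)
    then obtain mu where mu: "JT \<eta> ?H mu" ..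
    have "w \<notin> ?H" "\<eta> w \<in> ?H" using w \<phi> less.prems(2) by auto
    from extend_jordan[OF lin mu this] obtain r b where
      "is_partition (mu(r := Suc (mu r)))" "jordan_basis \<eta> (span (insert w ?H)) (mu(r := Suc (mu r))) b"
      by metis
    moreover have "span (insert w ?H) = W"
      by (rule hyperplane_decomp(1)[OF sH less.prems(1) _ dW w(1) \<open>w \<notin> ?H\<close>]) auto
    ultimately have "JT \<eta> W (mu(r := Suc (mu r)))" by (auto simp: JT_def)
    then show ?thesis by blast
  qed
qed

lemma JT_exists_sub:
  assumes "lin \<eta>" "JT \<eta> V lam" "subspace W" "W \<subseteq> V" "\<eta> ` W \<subseteq> W"
  shows "\<exists>mu. JT \<eta> W mu"
  by (rule JT_exists[OF assms(1,3,5)]) (use JT_nilpotent[OF assms(2,1)] assms(4) in blast)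

lemma iso_of_JT:
  assumes "JT \<eta>1 V1 lam" "JT \<eta>2 V2 lam" "lin \<eta>1" "lin \<eta>2"
  obtains G where "iso \<eta>1 V1 \<eta>2 V2 G"
  using assms unfolding JT_def by (metis iso_of_jordan_bases)

text \<open>By \<open>hyperplane_jordan\<close> each pair has a Jordan basis of the big space whose
  squares in \<open>young mu\<close> span the hyperplane; the map matching two such bases respects
  the hyperplanes.\<close>

lemma iso_of_hyperplanes:
  assumes l: "lin \<eta>1" "lin \<eta>2"
    and 1: "JT \<eta>1 H1 mu" "JT \<eta>1 V1 lam" "H1 \<subseteq> V1" "dim V1 = Suc (dim H1)"
    and 2: "JT \<eta>2 H2 mu" "JT \<eta>2 V2 lam" "H2 \<subseteq> V2"
  obtains G where "iso \<eta>1 V1 \<eta>2 V2 G" "G ` H1 = H2"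
proof -
  have d2: "dim V2 = Suc (dim H2)"
    using JT_dim[OF 1(1)] JT_dim[OF 1(2)] JT_dim[OF 2(1)] JT_dim[OF 2(2)] 1(4) by simp
  obtain r1 b1 where b1: "lam = mu(r1 := Suc (mu r1))" "jordan_basis \<eta>1 H1 mu b1" "jordan_basis \<eta>1 V1 lam b1"
    by (rule hyperplane_jordan[OF l(1) 1])
  obtain r2 b2 where b2: "jordan_basis \<eta>2 H2 mu b2" "jordan_basis \<eta>2 V2 lam b2"
    by (rule hyperplane_jordan[OF l(2) 2 d2])
  obtain G where G: "iso \<eta>1 V1 \<eta>2 V2 G" "\<And>p. p \<in> young lam \<Longrightarrow> G (b1 p) = b2 p"
    using iso_of_jordan_bases[OF b1(3) b2(2) l] by metis
  have sub: "young mu \<subseteq> young lam" unfolding b1(1) young_add by auto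
  have "G ` H1 = G ` span (b1 ` young mu)" using b1(2) by (simp add: jordan_basis_def)
  also have "\<dots> = span (G ` b1 ` young mu)"
    using G(1) by (simp add: iso_def endo.linear_span_image)
  also have "G ` b1 ` young mu = b2 ` young mu"
    unfolding image_comp using G(2) sub by (intro image_cong) auto
  also have "span \<dots> = H2" using b2(1) by (simp add: jordan_basis_def)
  finally show thesis using that G(1) by blast
qed

end

section \<open>Polynomial families of subspaces\<close>


lemma poly_funs_uminus: "p \<in> poly_funs C \<Longrightarrow> (\<lambda>x. - p x) \<in> poly_funs C"
  using poly_funs.mult[OF poly_funs.const[of "-1"]] by fastforce

lemma poly_funs_diff: "p \<in> poly_funs C \<Longrightarrow> q \<in> poly_funs C \<Longrightarrow> (\<lambda>x. p x - q x) \<in> poly_funs C"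
  using poly_funs.add[OF _ poly_funs_uminus] by fastforce

lemma poly_funs_compose:
  assumes "p \<in> poly_funs C" "\<And>c. c \<in> C \<Longrightarrow> (\<lambda>y. c (h y)) \<in> poly_funs D"
  shows "(\<lambda>y. p (h y)) \<in> poly_funs D"
  using assms(1) by induction (auto intro: poly_funs.intros assms(2))

lemma poly_funs_id_poly: "p \<in> poly_funs {\<lambda>t. t} \<Longrightarrow> \<exists>q. \<forall>t. p t = poly q t"
proof (induction rule: poly_funs.induct)
  case (const c) show ?case by (intro exI[of _ "[:c:]"]) simp
next
  case (coord p) then show ?case by (intro exI[of _ "[:0, 1:]"]) simp
next
  case (add p q) then show ?case by (metis poly_add)
next
  case (mult p q) then show ?case by (metis poly_mult)
qed

text \<open>Curves are parametrized by the line, with coordinate set \<open>{\<lambda>t. t}\<close>.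
  This is how an open condition becomes the exclusion of finitely many parameters.\<close>

lemma poly_funs_finite_zeros:
  assumes "p \<in> poly_funs {\<lambda>t. t}" "p t0 \<noteq> 0"
  shows "finite {t. p t = 0}"
proof -
  obtain q where q: "\<And>t. p t = poly q t" using poly_funs_id_poly[OF assms(1)] by blast
  then have "q \<noteq> 0" using assms(2) by auto
  then show ?thesis using poly_roots_finite[of q] q by simp
qed

text \<open>The rows \<open>s\<close> range over a whole type, possibly infinite: in the
  applications they are given by linear functionals, so that no basis has to be chosen.\<close>

definition cols_indep :: "('s \<Rightarrow> 'c \<Rightarrow> 'k::field) \<Rightarrow> 'c set \<Rightarrow> bool" where
  "cols_indep a J \<longleftrightarrow> (\<forall>c. (\<forall>s. (\<Sum>b\<in>J. c b * a s b) = 0) \<longrightarrow> (\<forall>b\<in>J. c b = 0))"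

text \<open>Gaussian elimination, with polynomial instead of rational row operations.\<close>

lemma cols_indep_generic:
  fixes a :: "'x \<Rightarrow> 's \<Rightarrow> 'c \<Rightarrow> 'k::field"
  assumes "finite J" "\<forall>s. \<forall>b\<in>J. (\<lambda>x. a x s b) \<in> poly_funs C" "cols_indep (a x0) J"
  shows "\<exists>p\<in>poly_funs C. p x0 \<noteq> 0 \<and> (\<forall>x. p x \<noteq> 0 \<longrightarrow> cols_indep (a x) J)"
  using assms
proof (induction J arbitrary: a rule: finite_induct)
  case empty
  show ?case by (intro bexI[of _ "\<lambda>_. 1"]) (auto simp: cols_indep_def intro: poly_funs.const)
next
  case (insert b0 J)
  have ind: "\<And>c. (\<And>s. (\<Sum>b\<in>insert b0 J. c b * a x0 s b) = 0) \<Longrightarrow> \<forall>b\<in>insert b0 J. c b = 0"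
    using insert.prems(2) by (auto simp: cols_indep_def)
  obtain s0 where s0: "a x0 s0 b0 \<noteq> 0"
  proof (rule ccontr)
    assume "\<not> thesis"
    then have z: "\<And>s. a x0 s b0 = 0" using that by blast
    have "(\<Sum>b\<in>insert b0 J. (if b = b0 then 1 else 0) * a x0 s b) = 0" for s
      by (rule sum.neutral) (auto simp: z)
    from ind[OF this] show False by auto
  qed
  \<comment> \<open>Cross-multiplication with the pivot row \<open>s0\<close> clears column
    \<open>b0\<close>; dividing by the pivot \<open>a x s0 b0\<close>, which varies with
    \<open>x\<close>, would not give polynomials.\<close>
  define a' where "a' = (\<lambda>x s b. a x s0 b0 * a x s b - a x s0 b * a x s b0)"
  have key: "(\<Sum>b\<in>J. c b * a' x s b) =
      a x s0 b0 * (\<Sum>b\<in>J. c b * a x s b) - (\<Sum>b\<in>J. c b * a x s0 b) * a x s b0" for c x s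
    unfolding a'_def by (simp add: sum_distrib_left sum_distrib_right sum_subtractf algebra_simps)
  have "cols_indep (a' x0) J"
    unfolding cols_indep_def
  proof (intro allI impI)
    fix c assume c: "\<forall>s. (\<Sum>b\<in>J. c b * a' x0 s b) = 0"
    \<comment> \<open>A relation among the cleared columns becomes one among the old columns: it is
      scaled by the pivot, and the coefficient of \<open>b0\<close> is chosen to make row
      \<open>s0\<close> vanish.\<close>
    define C where "C = (\<lambda>b. if b = b0 then - (\<Sum>b\<in>J. c b * a x0 s0 b) else a x0 s0 b0 * c b)"
    have "(\<Sum>b\<in>insert b0 J. C b * a x0 s b) = 0" for s
    proof -
      have "(\<Sum>b\<in>J. C b * a x0 s b) = a x0 s0 b0 * (\<Sum>b\<in>J. c b * a x0 s b)"
        unfolding sum_distrib_left using insert.hyps(2) by (intro sum.cong) (auto simp: C_def)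
      then show ?thesis using c[rule_format, of s] insert.hyps key[of c x0 s] by (simp add: C_def)
    qed
    from ind[OF this] have C0: "\<forall>b\<in>insert b0 J. C b = 0" .
    show "\<forall>b\<in>J. c b = 0"
    proof
      fix b assume b: "b \<in> J"
      then have "C b = a x0 s0 b0 * c b" using insert.hyps(2) by (auto simp: C_def)
      moreover have "C b = 0" using C0 b by simp
      ultimately show "c b = 0" using s0 by simp
    qed
  qed
  moreover have "\<forall>s. \<forall>b\<in>J. (\<lambda>x. a' x s b) \<in> poly_funs C"
    using insert.prems(1) unfolding a'_def by (auto intro!: poly_funs_diff poly_funs.mult)
  ultimately obtain q where q: "q \<in> poly_funs C" "q x0 \<noteq> 0" "\<And>x. q x \<noteq> 0 \<Longrightarrow> cols_indep (a' x) J"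
    using insert.IH[of a'] by blast
  show ?case
  proof (intro bexI[of _ "\<lambda>x. a x s0 b0 * q x"] conjI allI impI)
    show "(\<lambda>x. a x s0 b0 * q x) \<in> poly_funs C" using q(1) insert.prems(1) by (auto intro: poly_funs.mult)
    show "a x0 s0 b0 * q x0 \<noteq> 0" using s0 q(2) by simp
    fix x assume x: "a x s0 b0 * q x \<noteq> 0"
    show "cols_indep (a x) (insert b0 J)"
      unfolding cols_indep_def
    proof (intro allI impI)
      fix c assume "\<forall>s. (\<Sum>b\<in>insert b0 J. c b * a x s b) = 0"
      then have e: "c b0 * a x s b0 + (\<Sum>b\<in>J. c b * a x s b) = 0" for s using insert.hyps by simp
      have "(\<Sum>b\<in>J. c b * a' x s b) = 0" for s
      proof -
        have "(\<Sum>b\<in>J. c b * a x s b) = - (c b0 * a x s b0)" for s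
          using e[of s] by (simp add: eq_neg_iff_add_eq_0 add.commute)
        then show ?thesis unfolding key by (simp add: algebra_simps)
      qed
      then have J: "\<forall>b\<in>J. c b = 0" using q(3)[of x] x by (auto simp: cols_indep_def)
      then have "(\<Sum>b\<in>J. c b * a x s0 b) = 0" by (intro sum.neutral) simp
      then have "c b0 = 0" using e[of s0] x by auto
      then show "\<forall>b\<in>insert b0 J. c b = 0" using J by simp
    qed
  qed
qed

context fd_flag_space
begin

section \<open>Polynomial vectors and semicontinuity of intersections\<close>

definition regular :: "('x \<Rightarrow> 'a) set \<Rightarrow> ('x \<Rightarrow> 'b) \<Rightarrow> bool" where
  "regular C v \<longleftrightarrow> (\<forall>\<phi>. fnl \<phi> \<longrightarrow> (\<lambda>x. \<phi> (v x)) \<in> poly_funs C)"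

lemma regular_const: "regular C (\<lambda>_. v)"
  by (auto simp: regular_def intro: poly_funs.const)

lemma regular_add: "regular C v \<Longrightarrow> regular C w \<Longrightarrow> regular C (\<lambda>x. v x + w x)"
  unfolding regular_def
proof (intro allI impI)
  fix \<phi> :: "'b \<Rightarrow> 'a" assume h: "fnl \<phi>" "\<forall>\<phi>. fnl \<phi> \<longrightarrow> (\<lambda>x. \<phi> (v x)) \<in> poly_funs C"
    "\<forall>\<phi>. fnl \<phi> \<longrightarrow> (\<lambda>x. \<phi> (w x)) \<in> poly_funs C"
  then show "(\<lambda>x. \<phi> (v x + w x)) \<in> poly_funs C"
    unfolding fnl_simps(2)[OF h(1)] by (intro poly_funs.add) auto
qed

lemma regular_scale: "p \<in> poly_funs C \<Longrightarrow> regular C v \<Longrightarrow> regular C (\<lambda>x. p x *s v x)"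
  unfolding regular_def
proof (intro allI impI)
  fix \<phi> :: "'b \<Rightarrow> 'a" assume h: "fnl \<phi>" "\<forall>\<phi>. fnl \<phi> \<longrightarrow> (\<lambda>x. \<phi> (v x)) \<in> poly_funs C"
    "p \<in> poly_funs C"
  then show "(\<lambda>x. \<phi> (p x *s v x)) \<in> poly_funs C"
    unfolding fnl_simps(3)[OF h(1)] by (intro poly_funs.mult) auto
qed

lemma regular_lin: "lin g \<Longrightarrow> regular C v \<Longrightarrow> regular C (\<lambda>x. g (v x))"
  unfolding regular_def using fnl_comp by blast

lemma regular_sum: "(\<And>i. i \<in> I \<Longrightarrow> regular C (v i)) \<Longrightarrow> regular C (\<lambda>x. \<Sum>i\<in>I. v i x)"
  by (induction I rule: infinite_finite_induct) (auto intro: regular_const regular_add)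

text \<open>Independence of an indexed family. Unlike \<open>independent\<close>, which speaks of
  sets, it fails when two members coincide, as may happen at special parameters.\<close>

definition famind :: "'i set \<Rightarrow> ('i \<Rightarrow> 'b) \<Rightarrow> bool" where
  "famind I v \<longleftrightarrow> (\<forall>c. (\<Sum>i\<in>I. c i *s v i) = 0 \<longrightarrow> (\<forall>i\<in>I. c i = 0))"

lemma famindD: "famind I v \<Longrightarrow> (\<Sum>i\<in>I. c i *s v i) = 0 \<Longrightarrow> i \<in> I \<Longrightarrow> c i = 0"
  unfolding famind_def by blast

lemma span_image_sum:
  assumes "finite I"
  shows "y \<in> span (v ` I) \<longleftrightarrow> (\<exists>c. y = (\<Sum>i\<in>I. c i *s v i))"
proof
  assume "\<exists>c. y = (\<Sum>i\<in>I. c i *s v i)"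
  then obtain c where y: "y = (\<Sum>i\<in>I. c i *s v i)" ..
  show "y \<in> span (v ` I)" unfolding y by (intro span_sum span_scale span_base imageI)
next
  assume "y \<in> span (v ` I)"
  then show "\<exists>c. y = (\<Sum>i\<in>I. c i *s v i)"
  proof (induction rule: span_induct_alt)
    case base show ?case by (intro exI[of _ "\<lambda>_. 0"]) simp
  next
    case (step a x y)
    then obtain i c where i: "i \<in> I" "x = v i" "y = (\<Sum>i\<in>I. c i *s v i)" by auto
    have "a *s x + y = (\<Sum>k\<in>I. (if k = i then a *s v k else 0)) + y" using i assms by simp
    also have "\<dots> = (\<Sum>k\<in>I. (if k = i then a else 0) *s v k + c k *s v k)"
      unfolding sum.distrib i(3) by (intro arg_cong2[where f="(+)"] sum.cong) auto
    also have "\<dots> = (\<Sum>k\<in>I. ((if k = i then a else 0) + c k) *s v k)"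
      by (simp add: scale_left_distrib)
    finally show ?case by (intro exI[of _ "\<lambda>k. (if k = i then a else 0) + c k"])
  qed
qed

lemma famind_iff:
  assumes "finite I"
  shows "famind I v \<longleftrightarrow> inj_on v I \<and> independent (v ` I)"
proof
  assume f: "famind I v"
  have inj: "inj_on v I"
  proof (rule inj_onI, rule ccontr)
    fix i j assume ij: "i \<in> I" "j \<in> I" "v i = v j" "i \<noteq> j"
    let ?c = "\<lambda>k. (if k = i then 1 else 0) - (if k = j then 1 else 0)"
    have "(\<Sum>k\<in>I. ?c k *s v k) = (\<Sum>k\<in>I. (if k = i then v k else 0) - (if k = j then v k else 0))"
      by (intro sum.cong) (auto simp: scale_left_diff_distrib)
    also have "\<dots> = 0" using ij assms by (simp add: sum_subtractf)
    finally have z: "(\<Sum>k\<in>I. ?c k *s v k) = 0" .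
    show False using famindD[OF f z ij(1)] ij by auto
  qed
  moreover have "independent (v ` I)"
  proof (rule independent_if_scalars_zero)
    fix c x assume c: "(\<Sum>x\<in>v ` I. c x *s x) = 0" and x: "x \<in> v ` I"
    have "(\<Sum>i\<in>I. c (v i) *s v i) = 0" using c by (simp add: sum.reindex[OF inj] o_def)
    then have "c (v i) = 0" if "i \<in> I" for i using famindD[OF f, of "\<lambda>i. c (v i)"] that by simp
    then show "c x = 0" using x by blast
  qed (use assms in simp)
  ultimately show "inj_on v I \<and> independent (v ` I)" by blast
next
  assume h: "inj_on v I \<and> independent (v ` I)"
  show "famind I v" unfolding famind_def
  proof (intro allI impI ballI)
    fix c i assume c: "(\<Sum>i\<in>I. c i *s v i) = 0" and i: "i \<in> I"
    let ?u = "\<lambda>x. c (the_inv_into I v x)"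
    have "(\<Sum>x\<in>v ` I. ?u x *s x) = (\<Sum>i\<in>I. c i *s v i)"
      using h by (simp add: sum.reindex o_def the_inv_into_f_f cong: sum.cong)
    then have "?u (v i) = 0"
      using independentD[of "v ` I" "v ` I" ?u "v i"] h c i assms by simp
    then show "c i = 0" using h i by (simp add: the_inv_into_f_f)
  qed
qed

lemma famind_dim: "finite I \<Longrightarrow> famind I v \<Longrightarrow> dim (v ` I) = card I"
  by (simp add: famind_iff dim_eq_card_independent card_image)

lemma famind_if_dim:
  assumes "finite I" "card I \<le> dim (v ` I)"
  shows "famind I v"
proof -
  have "dim (v ` I) \<le> card (v ` I)" using assms(1) dim_le_card[OF span_superset] by auto
  then have c: "card (v ` I) = card I" using assms card_image_le[of I v] by simp
  then have "inj_on v I" using assms(1) by (intro eq_card_imp_inj_on)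
  moreover have "independent (v ` I)"
    using card_le_dim_spanning[of "v ` I" "v ` I"] assms c span_superset by auto
  ultimately show ?thesis using famind_iff[OF assms(1)] by blast
qed

text \<open>Functionals separate points, so the family is independent iff the columns with entries
  \<open>\<phi> (v i x)\<close>, one row for each functional \<phi>, are independent.\<close>

lemma famind_generic:
  assumes "finite I" "\<And>i. i \<in> I \<Longrightarrow> regular C (v i)" "famind I (\<lambda>i. v i x0)"
  shows "\<exists>p\<in>poly_funs C. p x0 \<noteq> 0 \<and> (\<forall>x. p x \<noteq> 0 \<longrightarrow> famind I (\<lambda>i. v i x))"
proof -
  let ?a = "\<lambda>x \<phi> i. if fnl \<phi> then \<phi> (v i x) else 0"
  have eq: "cols_indep (?a x) I \<longleftrightarrow> famind I (\<lambda>i. v i x)" for x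
  proof -
    have "(\<forall>\<phi>. (\<Sum>i\<in>I. c i * ?a x \<phi> i) = 0) \<longleftrightarrow> (\<Sum>i\<in>I. c i *s v i x) = 0" for c
    proof -
      have e: "(\<Sum>i\<in>I. c i * ?a x \<phi> i) = \<phi> (\<Sum>i\<in>I. c i *s v i x)" if "fnl \<phi>" for \<phi>
        using that by (simp add: dual.linear_sum[OF that] fnl_simps(3)[OF that])
      show ?thesis
      proof
        assume "\<forall>\<phi>. (\<Sum>i\<in>I. c i * ?a x \<phi> i) = 0"
        then show "(\<Sum>i\<in>I. c i *s v i x) = 0"
          using e by (intro eq_0_if_functionals_0) metis
      next
        assume z: "(\<Sum>i\<in>I. c i *s v i x) = 0"
        show "\<forall>\<phi>. (\<Sum>i\<in>I. c i * ?a x \<phi> i) = 0"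
        proof
          fix \<phi> show "(\<Sum>i\<in>I. c i * ?a x \<phi> i) = 0"
            using e[of \<phi>] z fnl_simps(1)[of \<phi>] by (cases "fnl \<phi>") auto
        qed
      qed
    qed
    then show ?thesis by (simp add: cols_indep_def famind_def)
  qed
  have "\<forall>\<phi>. \<forall>i\<in>I. (\<lambda>x. ?a x \<phi> i) \<in> poly_funs C"
  proof (intro allI ballI)
    fix \<phi> :: "'b \<Rightarrow> 'a" and i assume "i \<in> I"
    then show "(\<lambda>x. ?a x \<phi> i) \<in> poly_funs C"
      using assms(2) by (cases "fnl \<phi>") (simp_all add: regular_def poly_funs.const)
  qed
  from cols_indep_generic[OF assms(1) this, of x0] show ?thesis using assms(3) unfolding eq by blast
qed

text \<open>The coefficients of a common vector with respect to the two families solve a homogeneous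
  linear system with polynomial entries. As the families are independent at \<open>x0\<close>,
  triviality of the intersection there means that the columns of the system are independent, and
  this persists.\<close>

lemma triple_Int_generic:
  fixes e :: "'i \<Rightarrow> 'x \<Rightarrow> 'b" and e' :: "'j \<Rightarrow> 'x \<Rightarrow> 'b"
  assumes fin: "finite I" "finite J" and M: "subspace M"
    and reg: "\<And>i. i \<in> I \<Longrightarrow> regular C (e i)" "\<And>j. j \<in> J \<Longrightarrow> regular C (e' j)"
    and ind: "famind I (\<lambda>i. e i x0)" "famind J (\<lambda>j. e' j x0)"
    and z: "M \<inter> span ((\<lambda>i. e i x0) ` I) \<inter> span ((\<lambda>j. e' j x0) ` J) \<subseteq> {0}"
  shows "\<exists>p\<in>poly_funs C. p x0 \<noteq> 0 \<and>
    (\<forall>x. p x \<noteq> 0 \<longrightarrow> M \<inter> span ((\<lambda>i. e i x) ` I) \<inter> span ((\<lambda>j. e' j x) ` J) \<subseteq> {0})"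
proof -
  \<comment> \<open>Rows \<open>(True, \<phi>)\<close> express that the two combinations agree, rows
    \<open>(False, \<phi>)\<close> with \<phi> vanishing on \<open>M\<close> that the first one lies
    in \<open>M\<close>; the remaining rows are zero.\<close>
  let ?a = "\<lambda>x (f, \<phi>) k. case k of
     Inl i \<Rightarrow> if fnl \<phi> \<and> (f \<or> (\<forall>y\<in>M. \<phi> y = 0)) then \<phi> (e i x) else 0
   | Inr j \<Rightarrow> if fnl \<phi> \<and> f then - \<phi> (e' j x) else 0"
  let ?u = "\<lambda>x c. \<Sum>i\<in>I. c (Inl i) *s e i x" and ?w = "\<lambda>x c. \<Sum>j\<in>J. c (Inr j) *s e' j x"
  have key: "(\<forall>s. (\<Sum>k\<in>I <+> J. c k * ?a x s k) = 0) \<longleftrightarrow> ?u x c = ?w x c \<and> ?u x c \<in> M" for x c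
  proof -
    have e1: "(\<Sum>k\<in>I <+> J. c k * ?a x (True, \<phi>) k) = \<phi> (?u x c - ?w x c)" if "fnl \<phi>" for \<phi>
      using that fin by (simp add: sum.Plus fnl_simps[OF that] dual.linear_sum[OF that] sum_negf)
    have e2: "(\<Sum>k\<in>I <+> J. c k * ?a x (False, \<phi>) k) = \<phi> (?u x c)" if "fnl \<phi>" "\<forall>y\<in>M. \<phi> y = 0" for \<phi>
      using that fin by (simp add: sum.Plus fnl_simps[OF that(1)] dual.linear_sum[OF that(1)])
    show ?thesis
    proof
      assume h: "\<forall>s. (\<Sum>k\<in>I <+> J. c k * ?a x s k) = 0"
      have "?u x c - ?w x c = 0"
      proof (rule eq_0_if_functionals_0)
        fix \<phi> :: "'b \<Rightarrow> 'a" assume \<phi>: "fnl \<phi>"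
        show "\<phi> (?u x c - ?w x c) = 0" using h[THEN spec, of "(True, \<phi>)"] unfolding e1[OF \<phi>] .
      qed
      moreover have "?u x c \<in> M"
      proof (rule ccontr)
        assume "?u x c \<notin> M"
        then obtain \<phi> where "fnl \<phi>" "\<And>y. y \<in> M \<Longrightarrow> \<phi> y = 0" "\<phi> (?u x c) = 1"
          using separating_functional[OF M] by blast
        then show False using e2[of \<phi>] h by (metis zero_neq_one)
      qed
      ultimately show "?u x c = ?w x c \<and> ?u x c \<in> M" by simp
    next
      assume h: "?u x c = ?w x c \<and> ?u x c \<in> M"
      show "\<forall>s. (\<Sum>k\<in>I <+> J. c k * ?a x s k) = 0"
      proof (rule allI)
        fix s :: "bool \<times> ('b \<Rightarrow> 'a)"
        obtain f \<phi> where s: "s = (f, \<phi>)" by (cases s)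
        consider "fnl \<phi>" "f" | "fnl \<phi>" "\<not> f" "\<forall>y\<in>M. \<phi> y = 0" |
          "\<not> fnl \<phi> \<or> \<not> f \<and> \<not> (\<forall>y\<in>M. \<phi> y = 0)" by blast
        then show "(\<Sum>k\<in>I <+> J. c k * ?a x s k) = 0"
        proof cases
          case 1 then show ?thesis using e1[of \<phi>] h s fnl_simps(1)[OF 1(1)] by simp
        next
          case 2
          then have "f = False" by simp
          moreover have "\<phi> (?u x c) = 0" using 2(3) h by blast
          ultimately show ?thesis using e2[OF 2(1,3)] unfolding s by simp
        next
          case 3
          then have "c k * ?a x s k = 0" for k unfolding s by (cases k) auto
          then show ?thesis by (rule sum.neutral[rule_format])
        qed
      qed
    qed
  qed
  have pa: "\<forall>s. \<forall>k\<in>I <+> J. (\<lambda>x. ?a x s k) \<in> poly_funs C"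
  proof (intro allI ballI)
    fix s :: "bool \<times> ('b \<Rightarrow> 'a)" and k assume k: "k \<in> I <+> J"
    obtain f \<phi> where s: "s = (f, \<phi>)" by (cases s)
    show "(\<lambda>x. ?a x s k) \<in> poly_funs C"
    proof (cases k)
      case (Inl i)
      then have "regular C (e i)" using k reg by auto
      moreover define c where "c \<longleftrightarrow> fnl \<phi> \<and> (f \<or> (\<forall>y\<in>M. \<phi> y = 0))"
      ultimately have "c \<Longrightarrow> (\<lambda>x. \<phi> (e i x)) \<in> poly_funs C" by (simp add: regular_def)
      then show ?thesis unfolding s Inl prod.case sum.case c_def[symmetric]
        by (cases c) (simp_all add: poly_funs.const)
    next
      case (Inr j)
      then have "regular C (e' j)" using k reg by auto
      moreover define c where "c \<longleftrightarrow> fnl \<phi> \<and> f"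
      ultimately have "c \<Longrightarrow> (\<lambda>x. - \<phi> (e' j x)) \<in> poly_funs C"
        by (simp add: regular_def poly_funs_uminus)
      then show ?thesis unfolding s Inr prod.case sum.case c_def[symmetric]
        by (cases c) (simp_all add: poly_funs.const)
    qed
  qed
  have "cols_indep (?a x0) (I <+> J)"
    unfolding cols_indep_def key
  proof (intro allI impI)
    fix c assume h: "?u x0 c = ?w x0 c \<and> ?u x0 c \<in> M"
    have "?u x0 c \<in> span ((\<lambda>i. e i x0) ` I)" "?w x0 c \<in> span ((\<lambda>j. e' j x0) ` J)"
      by (intro span_sum span_scale span_base imageI, assumption)+
    then have "?u x0 c = 0" "?w x0 c = 0" using h z by auto
    then show "\<forall>k\<in>I <+> J. c k = 0"
      using famindD[OF ind(1), of "\<lambda>i. c (Inl i)"] famindD[OF ind(2), of "\<lambda>j. c (Inr j)"] by auto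
  qed
  from cols_indep_generic[OF finite_Plus[OF fin] pa this]
  obtain p where p: "p \<in> poly_funs C" "p x0 \<noteq> 0" "\<And>x. p x \<noteq> 0 \<Longrightarrow> cols_indep (?a x) (I <+> J)"
    by blast
  have "M \<inter> span ((\<lambda>i. e i x) ` I) \<inter> span ((\<lambda>j. e' j x) ` J) \<subseteq> {0}" if "p x \<noteq> 0" for x
  proof
    fix y assume y: "y \<in> M \<inter> span ((\<lambda>i. e i x) ` I) \<inter> span ((\<lambda>j. e' j x) ` J)"
    obtain c1 where c1: "y = (\<Sum>i\<in>I. c1 i *s e i x)" using y fin by (auto simp: span_image_sum)
    obtain c2 where c2: "y = (\<Sum>j\<in>J. c2 j *s e' j x)" using y fin by (auto simp: span_image_sum)
    let ?c = "case_sum c1 c2"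
    have "?u x ?c = ?w x ?c \<and> ?u x ?c \<in> M" using c1 c2 y by simp
    then have "\<forall>k\<in>I <+> J. ?c k = 0"
      using p(3)[OF that] unfolding cols_indep_def key by blast
    then have "\<forall>i\<in>I. c1 i = 0" by force
    then show "y \<in> {0}" using c1 by simp
  qed
  then show ?thesis using p by blast
qed

text \<open>The last property turns a bound on a dimension into the triviality of an intersection,
  which is what \<open>triple_Int_generic\<close> controls.\<close>

lemma complement_exists:
  assumes "subspace A"
  obtains C where "subspace C" "A \<inter> C = {0}" "dim A + dim C = dim UNIV"
    "\<And>D. subspace D \<Longrightarrow> D \<inter> C \<subseteq> {0} \<Longrightarrow> dim D \<le> dim A"
proof -
  obtain B0 where B0: "B0 \<subseteq> A" "independent B0" "A \<subseteq> span B0"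
    using maximal_independent_subset[of A] by blast
  have spB0: "span B0 = A" using B0 assms by (intro span_subspace)
  obtain B1 where B1: "B0 \<subseteq> B1" "independent B1" "UNIV \<subseteq> span B1"
    using maximal_independent_subset_extend[of B0 UNIV] B0 by auto
  have fin: "finite B1" by (rule finiteI_independent[OF B1(2)])
  let ?C = "span (B1 - B0)"
  have ind2: "independent (B1 - B0)" by (rule independent_mono[OF B1(2)]) auto
  have dA: "dim A = card B0" using dim_span_eq_card_independent[OF B0(2)] spB0 by simp
  have dC: "dim ?C = card (B1 - B0)" using dim_span_eq_card_independent[OF ind2] .
  have dU: "dim UNIV = card B1" using B1 by (intro basis_card_eq_dim[symmetric]) auto
  have cc: "card B0 + card (B1 - B0) = card B1"
    using fin B1(1) by (metis card_Diff_subset card_mono finite_subset le_add_diff_inverse)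
  have general: "dim D + dim ?C \<le> dim UNIV" if "subspace D" "D \<inter> ?C \<subseteq> {0}" for D
  proof -
    obtain B2 where B2: "B2 \<subseteq> D" "independent B2" "D \<subseteq> span B2"
      using maximal_independent_subset[of D] by blast
    have spB2: "span B2 = D" using B2 that by (intro span_subspace)
    have fin2: "finite B2" by (rule finiteI_independent[OF B2(2)])
    have "famind (B2 <+> (B1 - B0)) (case_sum id id)"
      unfolding famind_def
    proof (intro allI impI)
      fix c :: "'b + 'b \<Rightarrow> 'a"
      assume "(\<Sum>i\<in>B2 <+> (B1 - B0). c i *s case_sum id id i) = 0"
      then have e: "(\<Sum>x\<in>B2. c (Inl x) *s x) = - (\<Sum>x\<in>B1 - B0. c (Inr x) *s x)"
        using fin fin2 by (simp add: sum.Plus eq_neg_iff_add_eq_0)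
      have "(\<Sum>x\<in>B2. c (Inl x) *s x) \<in> D" unfolding spB2[symmetric]
        by (intro span_sum span_scale span_base)
      moreover have "- (\<Sum>x\<in>B1 - B0. c (Inr x) *s x) \<in> ?C"
        by (intro span_neg span_sum span_scale span_base)
      ultimately have "(\<Sum>x\<in>B2. c (Inl x) *s x) = 0" using that(2) e by auto
      moreover from this have "(\<Sum>x\<in>B1 - B0. c (Inr x) *s x) = 0" using e by simp
      ultimately have "c (Inl x) = 0" if "x \<in> B2" for x
        using independentD[OF B2(2) fin2 order_refl, of "\<lambda>x. c (Inl x)"] that by blast
      moreover have "c (Inr x) = 0" if "x \<in> B1 - B0" for x
        using independentD[OF ind2 finite_Diff[OF fin] order_refl, of "\<lambda>x. c (Inr x)"] that
          \<open>(\<Sum>x\<in>B1 - B0. c (Inr x) *s x) = 0\<close> by blast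
      ultimately show "\<forall>i\<in>B2 <+> (B1 - B0). c i = 0" by auto
    qed
    then have "dim (case_sum id id ` (B2 <+> (B1 - B0))) = card (B2 <+> (B1 - B0))"
      using fin fin2 by (intro famind_dim) auto
    then have "card (B2 <+> (B1 - B0)) \<le> dim UNIV" using dim_subset[OF subset_UNIV] by metis
    moreover have "dim D = card B2" using dim_span_eq_card_independent[OF B2(2)] spB2 by simp
    ultimately show ?thesis using dC fin fin2 by (simp add: card_Plus)
  qed
  have "A \<inter> ?C \<subseteq> {0}"
  proof
    fix x assume x: "x \<in> A \<inter> ?C"
    have x1: "x \<in> span B0" and x2: "x \<in> span (B1 - B0)" using x spB0 by auto
    have r1: "representation B1 x b = 0" if "b \<notin> B0" for b
      using representation_extend[OF B1(2) x1 B1(1)] that by (metis representation_ne_zero)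
    have r2: "representation B1 x b = 0" if "b \<in> B0" for b
      using representation_extend[OF B1(2) x2] that by (metis Diff_iff Diff_subset representation_ne_zero)
    have "x \<in> span B1" using B1(3) by auto
    from sum_representation_eq[OF B1(2) this fin order_refl] have "x = (\<Sum>b\<in>B1. representation B1 x b *s b)"
      by simp
    also have "\<dots> = 0" using r1 r2 by (intro sum.neutral) (metis scale_zero_left)
    finally show "x \<in> {0}" by simp
  qed
  moreover have "0 \<in> A \<inter> ?C" using assms by (simp add: subspace_0 span_zero)
  ultimately have "A \<inter> ?C = {0}" by blast
  moreover have "dim D \<le> dim A" if "subspace D" "D \<inter> ?C \<subseteq> {0}" for D
    using general[OF that] dU dA dC cc by simp
  ultimately show thesis using that[of ?C] dU dA dC cc by auto
qed

text \<open>Upper semicontinuity: if \<open>D\<close> is a complement of the intersection at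
  \<open>x0\<close>, then the intersection at a general \<open>x\<close> still meets
  \<open>D\<close> trivially, and this bounds its dimension.\<close>

lemma dim_Int_generic:
  fixes e :: "'i \<Rightarrow> 'x \<Rightarrow> 'b" and e' :: "'j \<Rightarrow> 'x \<Rightarrow> 'b"
  assumes fin: "finite I" "finite J" and K: "subspace K"
    and reg: "\<And>i. i \<in> I \<Longrightarrow> regular C (e i)" "\<And>j. j \<in> J \<Longrightarrow> regular C (e' j)"
    and ind: "famind I (\<lambda>i. e i x0)" "famind J (\<lambda>j. e' j x0)"
  shows "\<exists>p\<in>poly_funs C. p x0 \<noteq> 0 \<and>
    (\<forall>x. p x \<noteq> 0 \<longrightarrow> dim (K \<inter> span ((\<lambda>i. e i x) ` I) \<inter> span ((\<lambda>j. e' j x) ` J))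
       \<le> dim (K \<inter> span ((\<lambda>i. e i x0) ` I) \<inter> span ((\<lambda>j. e' j x0) ` J)))"
proof -
  let ?A = "\<lambda>x. K \<inter> span ((\<lambda>i. e i x) ` I) \<inter> span ((\<lambda>j. e' j x) ` J)"
  have sA: "subspace (?A x)" for x using K by (intro subspace_inter) auto
  obtain D where D: "subspace D" "?A x0 \<inter> D = {0}"
    "\<And>S. subspace S \<Longrightarrow> S \<inter> D \<subseteq> {0} \<Longrightarrow> dim S \<le> dim (?A x0)"
    using complement_exists[OF sA[of x0]] by metis
  have "(K \<inter> D) \<inter> span ((\<lambda>i. e i x0) ` I) \<inter> span ((\<lambda>j. e' j x0) ` J) \<subseteq> {0}" using D(2) by blast
  from triple_Int_generic[OF fin subspace_inter[OF K D(1)] reg ind this]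
  obtain p where p: "p \<in> poly_funs C" "p x0 \<noteq> 0"
    "\<And>x. p x \<noteq> 0 \<Longrightarrow> (K \<inter> D) \<inter> span ((\<lambda>i. e i x) ` I) \<inter> span ((\<lambda>j. e' j x) ` J) \<subseteq> {0}"
    by blast
  have "dim (?A x) \<le> dim (?A x0)" if "p x \<noteq> 0" for x
    using D(3)[OF sA[of x]] p(3)[OF that] by (simp add: Int_ac)
  then show ?thesis using p by blast
qed

end

section \<open>Curves in varieties of flags\<close>


context fd_flag_space
begin

text \<open>Members of the flag may repeat, so that the traces of a flag on a hyperplane need no renumbering.\<close>

definition FL :: "('b \<Rightarrow> 'b) \<Rightarrow> 'b set \<Rightarrow> nat \<Rightarrow> (nat \<Rightarrow> nat \<Rightarrow> nat) \<Rightarrow> (nat \<Rightarrow> 'b set) set" where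
  "FL \<eta> V M q = {f. (\<forall>j\<le>M. JT \<eta> (f j) (q j)) \<and> (\<forall>j<M. f j \<subseteq> f (Suc j)) \<and> f M = V}"

lemma FL_JT: "f \<in> FL \<eta> V M q \<Longrightarrow> j \<le> M \<Longrightarrow> JT \<eta> (f j) (q j)"
  by (simp add: FL_def)

lemma FL_dim: "f \<in> FL \<eta> V M q \<Longrightarrow> j \<le> M \<Longrightarrow> dim (f j) = psize (q j)"
  using FL_JT JT_dim by blast

lemma FL_top: "f \<in> FL \<eta> V M q \<Longrightarrow> f M = V"
  by (simp add: FL_def)

lemma FL_mono:
  assumes "f \<in> FL \<eta> V M q" "i \<le> j" "j \<le> M"
  shows "f i \<subseteq> f j"
  using assms(2,3)
proof (induction rule: dec_induct)
  case (step n)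
  then have "f i \<subseteq> f n" by simp
  also have "f n \<subseteq> f (Suc n)" using step.prems assms(1) by (simp add: FL_def)
  finally show ?case .
qed simp

lemma FL_psize_mono: "f \<in> FL \<eta> V M q \<Longrightarrow> i \<le> j \<Longrightarrow> j \<le> M \<Longrightarrow> psize (q i) \<le> psize (q j)"
  using FL_dim[of f \<eta> V M q i] FL_dim[of f \<eta> V M q j] dim_subset[OF FL_mono[of f \<eta> V M q i j]] by simp

lemma FL_restrict: "f \<in> FL \<eta> V M q \<Longrightarrow> N \<le> M \<Longrightarrow> f \<in> FL \<eta> (f N) N q"
  by (auto simp: FL_def)

lemma FL_image:
  assumes "iso \<eta>1 V1 \<eta>2 V2 G" "f \<in> FL \<eta>1 V M q" "V \<subseteq> V1"
  shows "(\<lambda>j. G ` f j) \<in> FL \<eta>2 (G ` V) M q"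
  unfolding FL_def mem_Collect_eq
proof (intro conjI allI impI)
  fix j assume j: "j \<le> M"
  have "f j \<subseteq> V1" using FL_mono[OF assms(2) j] FL_top[OF assms(2)] assms(3) by auto
  then show "JT \<eta>2 (G ` f j) (q j)" by (rule iso_JT[OF assms(1) FL_JT[OF assms(2) j]])
next
  fix j assume "j < M"
  then show "G ` f j \<subseteq> G ` f (Suc j)" using FL_mono[OF assms(2), of j "Suc j"] by (intro image_mono) simp
qed (simp add: FL_top[OF assms(2)])

lemma FL_cong: "f \<in> FL \<eta> V M q \<Longrightarrow> (\<And>j. j \<le> M \<Longrightarrow> g j = f j) \<Longrightarrow> g \<in> FL \<eta> V M q"
  by (auto simp: FL_def)

lemma span_insert_span: "span (insert w (span S)) = span (insert w S)"
  by (simp add: span_insert span_span)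

lemma ex_basis_family:
  assumes "subspace V"
  obtains v where "famind {..<dim V} v" "span (v ` {..<dim V}) = V"
proof -
  obtain B0 where B0: "B0 \<subseteq> V" "independent B0" "V \<subseteq> span B0" "card B0 = dim V"
    using basis_exists[of V] by blast
  have "finite B0" by (rule finiteI_independent[OF B0(2)])
  then obtain v where v: "bij_betw v {..<dim V} B0"
    using ex_bij_betw_nat_finite[of B0] B0(4) by (auto simp: atLeast0LessThan)
  then have im: "v ` {..<dim V} = B0" "inj_on v {..<dim V}" by (auto simp: bij_betw_def)
  have "span B0 = V" using B0 assms by (intro span_subspace)
  then show thesis using im B0(2) by (intro that[of v]) (auto simp: famind_iff)
qed

text \<open>The pencil is the identity at \<open>t = 0\<close>, so the images of a basis are
  independent outside finitely many \<open>t\<close>.\<close>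

lemma finite_not_inj_pencil:
  assumes "lin G" "subspace V"
  shows "finite {t. \<not> inj_on (\<lambda>x. x + t *s (G x - x)) V}"
proof -
  let ?D = "\<lambda>t x. x + t *s (G x - x)"
  have linD: "lin (?D t)" for t
    by (rule linI) (simp_all add: lin_simps[OF assms(1)] algebra_simps scale_right_distrib scale_right_diff_distrib)
  obtain v where v: "famind {..<dim V} v" "span (v ` {..<dim V}) = V" by (rule ex_basis_family[OF assms(2)])
  have reg: "regular {\<lambda>t. t} (\<lambda>t. ?D t (v k))" for k
    by (intro regular_add regular_scale regular_const poly_funs.coord) simp
  have "famind {..<dim V} (\<lambda>k. ?D 0 (v k))" using v(1) by simp
  from famind_generic[OF _ reg this]
  obtain p where p: "p \<in> poly_funs {\<lambda>t. t}" "p 0 \<noteq> 0" "\<And>t. p t \<noteq> 0 \<Longrightarrow> famind {..<dim V} (\<lambda>k. ?D t (v k))"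
    by auto
  have "inj_on (?D t) V" if "p t \<noteq> 0" for t
    unfolding endo.linear_inj_on_iff_eq_0[OF linD assms(2)]
  proof (intro ballI impI)
    fix x assume x: "x \<in> V" "?D t x = 0"
    obtain c where c: "x = (\<Sum>k<dim V. c k *s v k)"
      using x(1) v(2) span_image_sum[of "{..<dim V}" x v] by auto
    have "?D t x = (\<Sum>k<dim V. c k *s ?D t (v k))"
      unfolding c endo.linear_sum[OF linD] by (intro sum.cong refl endo.linear_scale[OF linD])
    then have "\<forall>k<dim V. c k = 0" using famindD[OF p(3)[OF that], of c] x(2) by simp
    then show "x = 0" using c by simp
  qed
  then have "{t. \<not> inj_on (?D t) V} \<subseteq> {t. p t = 0}" by blast
  then show ?thesis using poly_funs_finite_zeros[OF p(1,2)] by (rule finite_subset)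
qed

text \<open>At a proper step an automorphism \<open>G\<close> of \<open>V\<close> takes
  \<open>f M\<close> to \<open>y M\<close>. The induction hypothesis joins \<open>f\<close> to the
  pullback of \<open>y\<close> inside \<open>f M\<close>; applying the pencil from the identity to
  \<open>G\<close> at the same time moves the end of that curve to \<open>y\<close>. One frame
  serves all members, since member \<open>j\<close> is spanned by its first
  \<open>psize (q j)\<close> vectors.\<close>

lemma flag_curve:
  assumes lin: "lin \<eta>" and step: "\<forall>j<M. psize (q (Suc j)) \<le> Suc (psize (q j))"
    and "f \<in> FL \<eta> V M q" "y \<in> FL \<eta> V M q"
  shows "\<exists>e E. finite E \<and> 0 \<notin> E \<and> 1 \<notin> E \<and> (\<forall>k. regular {\<lambda>t. t} (e k)) \<and>
     (\<forall>t. t \<notin> E \<longrightarrow> (\<lambda>j. span ((\<lambda>k. e k t) ` {..<psize (q j)})) \<in> FL \<eta> V M q) \<and>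
     (\<forall>j\<le>M. span ((\<lambda>k. e k 0) ` {..<psize (q j)}) = f j \<and> span ((\<lambda>k. e k 1) ` {..<psize (q j)}) = y j)"
  using assms(2-)
proof (induction M arbitrary: V f y)
  case 0
  have JTV: "JT \<eta> V (q 0)" and fy: "f 0 = V" "y 0 = V" using 0 by (auto simp: FL_def)
  obtain v where v: "span (v ` {..<psize (q 0)}) = V"
    using ex_basis_family[OF JT_subspace[OF JTV]] JT_dim[OF JTV] by metis
  show ?case
    by (rule exI[of _ "\<lambda>k t. v k"], rule exI[of _ "{}"]) (use v JTV fy in \<open>auto simp: FL_def intro: regular_const\<close>)
next
  case (Suc M)
  let ?S = "\<lambda>e t j. span ((\<lambda>k. e k t) ` {..<psize (q j)})"
  have stepM: "\<forall>j<M. psize (q (Suc j)) \<le> Suc (psize (q j))" using Suc.prems(1) by simp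
  have JTV: "JT \<eta> V (q (Suc M))" using FL_JT[OF Suc.prems(2), of "Suc M"] FL_top[OF Suc.prems(2)] by simp
  have fM: "f \<in> FL \<eta> (f M) M q" and yM: "y \<in> FL \<eta> (y M) M q"
    using FL_restrict[OF Suc.prems(2)] FL_restrict[OF Suc.prems(3)] by auto
  have JTf: "JT \<eta> (f M) (q M)" and JTy: "JT \<eta> (y M) (q M)"
    using FL_JT[OF fM] FL_JT[OF yM] by auto
  have fV: "f M \<subseteq> V" and yV: "y M \<subseteq> V"
    using FL_mono[OF Suc.prems(2), of M "Suc M"] FL_mono[OF Suc.prems(3), of M "Suc M"]
      FL_top[OF Suc.prems(2)] FL_top[OF Suc.prems(3)] by auto
  note sV = JT_subspace[OF JTV]
  show ?case
  proof (cases "psize (q (Suc M)) = psize (q M)")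
    case True
    have "f M = V" "y M = V"
      using subspace_dim_equal[OF JT_subspace[OF JTf] sV fV] subspace_dim_equal[OF JT_subspace[OF JTy] sV yV]
        JT_dim[OF JTf] JT_dim[OF JTy] JT_dim[OF JTV] True by auto
    then have "f \<in> FL \<eta> V M q" "y \<in> FL \<eta> V M q" using fM yM by auto
    from Suc.IH[OF stepM this] obtain e E where e: "finite E" "0 \<notin> E" "1 \<notin> E" "\<forall>k. regular {\<lambda>t. t} (e k)"
      "\<And>t. t \<notin> E \<Longrightarrow> ?S e t \<in> FL \<eta> V M q" "\<And>j. j \<le> M \<Longrightarrow> ?S e 0 j = f j \<and> ?S e 1 j = y j" by blast
    have SM: "?S e t (Suc M) = ?S e t M" for t using True by simp
    have "?S e t \<in> FL \<eta> V (Suc M) q" if "t \<notin> E" for t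
    proof -
      have h: "?S e t \<in> FL \<eta> V M q" by (rule e(5)[OF that])
      have "?S e t M = V" using FL_top[OF h] .
      then have top: "?S e t (Suc M) = V" using SM by blast
      show ?thesis unfolding FL_def mem_Collect_eq
      proof (intro conjI allI impI)
        fix j assume "j \<le> Suc M"
        then consider "j \<le> M" | "j = Suc M" by linarith
        then show "JT \<eta> (?S e t j) (q j)"
        proof cases
          case 1 then show ?thesis using FL_JT[OF h] by blast
        next
          case 2 then show ?thesis using JTV top by simp
        qed
      next
        fix j assume "j < Suc M"
        then consider "j < M" | "j = M" by linarith
        then show "?S e t j \<subseteq> ?S e t (Suc j)"
        proof cases
          case 1 then show ?thesis using FL_mono[OF h, of j "Suc j"] by simp
        next
          case 2 then show ?thesis using SM by blast
        qed
      qed (fact top)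
    qed
    note fl = this
    have ends: "?S e 0 j = f j \<and> ?S e 1 j = y j" if "j \<le> Suc M" for j
    proof (cases "j \<le> M")
      case False
      then have j: "j = Suc M" using that by simp
      have "f j = f M" "y j = y M"
        using \<open>f M = V\<close> \<open>y M = V\<close> FL_top[OF Suc.prems(2)] FL_top[OF Suc.prems(3)] j by simp_all
      then show ?thesis using SM e(6)[of M] unfolding j by simp
    qed (use e(6) in blast)
    show ?thesis
    proof (rule exI[of _ e], rule exI[of _ E], intro conjI)
      show "\<forall>t. t \<notin> E \<longrightarrow> ?S e t \<in> FL \<eta> V (Suc M) q" using fl by blast
      show "\<forall>j\<le>Suc M. ?S e 0 j = f j \<and> ?S e 1 j = y j" using ends by blast
    qed (fact e(1-4))+
  next
    case False
    define m where "m = psize (q M)"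
    have pS: "psize (q (Suc M)) = Suc m"
      using False Suc.prems(1) FL_psize_mono[OF Suc.prems(2), of M "Suc M"] by (force simp: m_def)
    have dV: "dim V = Suc (dim (f M))" using JT_dim[OF JTf] JT_dim[OF JTV] pS m_def by simp
    obtain G where G: "iso \<eta> V \<eta> V G" "G ` f M = y M"
      using iso_of_hyperplanes[OF lin lin JTf JTV fV dV JTy JTV yV] by metis
    obtain G' where G': "iso \<eta> V \<eta> V G'" "\<And>x. x \<in> V \<Longrightarrow> G' (G x) = x" "\<And>x. x \<in> V \<Longrightarrow> G (G' x) = x"
      using iso_inverse[OF G(1) sV JT_stable[OF JTV lin]] by metis
    define y2 where "y2 = (\<lambda>j. G' ` y j)"
    have "G' ` y M = f M" unfolding G(2)[symmetric] image_comp using G'(2) fV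
      by (auto simp: subset_iff image_iff)
    then have "y2 \<in> FL \<eta> (f M) M q" unfolding y2_def using FL_image[OF G'(1) yM yV] by simp
    from Suc.IH[OF stepM fM this] obtain e E where e: "finite E" "0 \<notin> E" "1 \<notin> E" "\<forall>k. regular {\<lambda>t. t} (e k)"
      "\<And>t. t \<notin> E \<Longrightarrow> ?S e t \<in> FL \<eta> (f M) M q" "\<And>j. j \<le> M \<Longrightarrow> ?S e 0 j = f j \<and> ?S e 1 j = y2 j" by blast
    have linG: "lin G" using G(1) by (simp add: iso_def)
    \<comment> \<open>Every \<open>D t\<close> commutes with \<eta> on \<open>V\<close>, as the
      identity and \<open>G\<close> do; the injective ones are automorphisms and preserve
      types.\<close>
    define D where "D = (\<lambda>t x. x + t *s (G x - x))"
    have linD: "lin (D t)" for t unfolding D_def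
      by (rule linI) (simp_all add: lin_simps[OF linG] algebra_simps scale_right_distrib scale_right_diff_distrib)
    have D0: "D 0 x = x" and D1: "D 1 x = G x" for x by (simp_all add: D_def)
    define E' where "E' = E \<union> {t. \<not> inj_on (D t) V}"
    have "finite E'" unfolding E'_def D_def using e(1) finite_not_inj_pencil[OF linG sV] by simp
    have "0 \<notin> E'" "1 \<notin> E'" using e(2,3) G(1) by (auto simp: E'_def D0 D1 iso_def inj_on_def)
    have isoD: "iso \<eta> V \<eta> V (D t)" if "t \<notin> E'" for t
    proof -
      have inj: "inj_on (D t) V" using that by (simp add: E'_def)
      have GV: "G x \<in> V" if "x \<in> V" for x using G(1) that by (auto simp: iso_def)
      have sub: "D t ` V \<subseteq> V" unfolding D_def
        using GV by (auto intro!: subspace_add[OF sV] subspace_scale[OF sV] subspace_diff[OF sV])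
      have "D t ` V = V"
      proof (rule subspace_dim_equal[OF endo.linear_subspace_image[OF linD sV] sV sub])
        show "dim V \<le> dim (D t ` V)" using endo.dim_image_eq[OF linD, where S=V] inj sV
          by (metis order_refl span_eq_iff)
      qed
      moreover have "D t (\<eta> x) = \<eta> (D t x)" if "x \<in> V" for x
      proof -
        have "G (\<eta> x) = \<eta> (G x)" using G(1) that by (simp add: iso_def)
        then show ?thesis by (simp add: D_def lin_simps[OF lin])
      qed
      ultimately show ?thesis using linD inj by (auto simp: iso_def)
    qed
    obtain w where w: "w \<in> V" "w \<notin> f M" using dV fV by (metis n_not_Suc_n subsetI subset_antisym)
    have spw: "span (insert w (f M)) = V" by (rule hyperplane_decomp(1)[OF JT_subspace[OF JTf] sV fV dV w])
    \<comment> \<open>Index \<open>m\<close> contributes the vector \<open>w\<close> outside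
      \<open>f M\<close>, so that the frame also spans \<open>V\<close>.\<close>
    define e' where "e' = (\<lambda>k t. D t (if k < m then e k t else w))"
    have reg: "regular {\<lambda>t. t} (e' k)" for k
    proof -
      have r1: "regular {\<lambda>t. t} (\<lambda>t. if k < m then e k t else w)"
        using e(4) regular_const by (cases "k < m") auto

      have r2: "regular {\<lambda>t. t} (\<lambda>t. G (if k < m then e k t else w) - (if k < m then e k t else w))"
      proof -
        have "lin (\<lambda>x. G x - x)" by (rule linI) (simp_all add: lin_simps[OF linG] scale_right_diff_distrib)
        from regular_lin[OF this r1] show ?thesis .
      qed
      show ?thesis unfolding e'_def D_def
        by (intro regular_add[OF r1] regular_scale[OF _ r2] poly_funs.coord) simp
    qed
    have SM: "?S e' t j = D t ` ?S e t j" if "j \<le> M" for t j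
    proof -
      have "psize (q j) \<le> m" unfolding m_def using FL_psize_mono[OF Suc.prems(2), of j M] that by simp
      then have "(\<lambda>k. e' k t) ` {..<psize (q j)} = D t ` (\<lambda>k. e k t) ` {..<psize (q j)}"
        unfolding image_comp e'_def by (intro image_cong) auto
      then show ?thesis using endo.linear_span_image[OF linD] by simp
    qed
    have SS: "?S e' t (Suc M) = D t ` span (insert w (?S e t M))" for t
    proof -
      have "(\<lambda>k. e' k t) ` {..<Suc m} = D t ` insert w ((\<lambda>k. e k t) ` {..<m})"
        unfolding lessThan_Suc image_insert image_comp
        by (intro arg_cong2[where f=insert] image_cong) (auto simp: e'_def)
      then have "span ((\<lambda>k. e' k t) ` {..<Suc m}) = D t ` span (insert w ((\<lambda>k. e k t) ` {..<m}))"
        by (simp only: endo.linear_span_image[OF linD])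
      then show ?thesis unfolding pS m_def span_insert_span by simp
    qed
    have fl: "?S e' t \<in> FL \<eta> V (Suc M) q" if t: "t \<notin> E'" for t
    proof -
      have h: "?S e t \<in> FL \<eta> (f M) M q" by (rule e(5)) (use t in \<open>simp add: E'_def\<close>)
      note isoD' = isoD[OF t]
      have top: "?S e' t (Suc M) = V"
        unfolding SS FL_top[OF h] spw using isoD' by (simp add: iso_def)
      show ?thesis unfolding FL_def mem_Collect_eq
      proof (intro conjI allI impI)
        fix j assume "j \<le> Suc M"
        then consider "j \<le> M" | "j = Suc M" by linarith
        then show "JT \<eta> (?S e' t j) (q j)"
        proof cases
          case 1
          have "?S e t j \<subseteq> V" using FL_mono[OF h 1] FL_top[OF h] fV by auto
          then show ?thesis unfolding SM[OF 1] using iso_JT[OF isoD' FL_JT[OF h 1]] by blast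
        next
          case 2 then show ?thesis using JTV top by simp
        qed
      next
        fix j assume "j < Suc M"
        then have "psize (q j) \<le> psize (q (Suc j))"
          using FL_psize_mono[OF Suc.prems(2), of j "Suc j"] by simp
        then show "?S e' t j \<subseteq> ?S e' t (Suc j)" by (intro span_mono image_mono) auto
      qed (fact top)
    qed
    have ends: "?S e' 0 j = f j \<and> ?S e' 1 j = y j" if "j \<le> Suc M" for j
    proof (cases "j \<le> M")
      case True
      have "G ` y2 j = y j" unfolding y2_def image_comp
        using G'(3) FL_mono[OF yM True] yV FL_top[OF yM] by (auto simp: subset_iff image_iff)
      then show ?thesis unfolding SM[OF True] using e(6)[OF True] by (simp add: D0 D1)
    next
      case False
      then have "j = Suc M" using that by simp
      moreover have "?S e' 0 (Suc M) = V" "?S e' 1 (Suc M) = V"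
        using FL_top[OF fl] \<open>0 \<notin> E'\<close> \<open>1 \<notin> E'\<close> by auto
      ultimately show ?thesis using FL_top[OF Suc.prems(2)] FL_top[OF Suc.prems(3)] by simp
    qed
    show ?thesis
    proof (rule exI[of _ e'], rule exI[of _ E'], intro conjI)
      show "\<forall>k. regular {\<lambda>t. t} (e' k)" using reg by blast
      show "\<forall>t. t \<notin> E' \<longrightarrow> ?S e' t \<in> FL \<eta> V (Suc M) q" using fl by blast
      show "\<forall>j\<le>Suc M. ?S e' 0 j = f j \<and> ?S e' 1 j = y j" using ends by blast
    qed (fact \<open>finite E'\<close> \<open>0 \<notin> E'\<close> \<open>1 \<notin> E'\<close>)+
  qed
qed

end

section \<open>Squares of type RS\<close>


definition rs_square :: "(nat \<Rightarrow> nat) \<Rightarrow> (nat \<Rightarrow> nat) \<Rightarrow> (nat \<Rightarrow> nat) \<Rightarrow> (nat \<Rightarrow> nat) \<Rightarrow> bool" where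
  "rs_square nu mu mu' lam \<longleftrightarrow>
     RS0 nu mu mu' lam \<or> RS1 nu mu mu' lam \<or> RS2 nu mu mu' lam \<or> RS3 nu mu mu' lam"

lemma young_inject: "young lam = young mu \<Longrightarrow> lam = mu"
  unfolding young_def by (rule ext, metis (mono_tags, lifting) case_prodD case_prodI mem_Collect_eq
      linorder_neqE_nat less_irrefl)

lemma pprec_irrefl: "\<not> mu \<prec> mu"
  by (simp add: pprec_def)

text \<open>Both diagrams lie in that of \<open>lam\<close>, which has only one square more, so
  \<open>young lam = young mu \<union> young mu'\<close>.\<close>

lemma pprec_join_unique:
  assumes "is_partition lam" "is_partition lam'" "mu \<noteq> mu'" "finite {i. mu i \<noteq> 0}" "finite {i. mu' i \<noteq> 0}"
    and "mu \<prec> lam" "mu' \<prec> lam" "mu \<prec> lam'" "mu' \<prec> lam'"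
  shows "lam = lam'"
proof -
  have "young lam = young mu \<union> young mu'"
    if "is_partition lam" "mu \<prec> lam" "mu' \<prec> lam" for lam
  proof -
    note fl = is_partition_finite[OF that(1)]
    have c: "card (young lam) = Suc (card (young mu))" "card (young mu) = card (young mu')"
      using that(2,3) card_young[OF assms(4)] card_young[OF assms(5)] card_young[OF fl]
      by (auto simp: pprec_def)
    have fm: "finite (young mu)" "finite (young mu')" using assms(4,5) finite_young by auto
    have "young mu \<noteq> young mu'" using assms(3) young_inject by blast
    then have "\<not> young mu' \<subseteq> young mu" using card_subset_eq[OF fm(1), of "young mu'"] c by auto
    then have "young mu \<subset> young mu \<union> young mu'" by blast
    then have "card (young mu) < card (young mu \<union> young mu')"
      using fm by (intro psubset_card_mono) auto
    then have "card (young lam) \<le> card (young mu \<union> young mu')" using c by simp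
    moreover have "young mu \<union> young mu' \<subseteq> young lam" using that by (auto simp: pprec_def)
    ultimately show ?thesis using card_seteq[OF finite_young[OF fl]] by blast
  qed
  from this[OF assms(1,6,7)] this[OF assms(2,8,9)] show ?thesis using young_inject by simp
qed

context fd_flag_space
begin

text \<open>A shear of the rows \<open>s\<close> and \<open>Suc s\<close> moves \<open>F\<close> to a hyperplane of the same type in general
  position with respect to \<open>F\<close>.\<close>

lemma shear_hyperplane:
  assumes lin: "lin \<eta>" and bF: "jordan_basis \<eta> F mu b" and bW: "jordan_basis \<eta> W lam b"
    and lam: "lam = mu(Suc s := Suc (mu (Suc s)))" and part: "is_partition mu" "is_partition lam"
  obtains W2 where "JT \<eta> W2 mu" "W2 \<subseteq> W" "\<not> W2 \<inter> ker_pow \<eta> (mu s) \<subseteq> F"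
proof -
  let ?r = "Suc s"
  define c where "c = Suc (mu ?r)"
  define m where "m = mu s"
  have lr: "lam ?r = c" and ls: "lam s = m" using lam by (auto simp: c_def m_def)
  have cm: "c \<le> m" using is_partition_antimono[OF part(2), of s ?r] lr ls by simp
  have c0: "0 < c" by (simp add: c_def)
  note dW = bW[unfolded jordan_basis_def]
  have sW: "subspace W" by (rule jordan_basis_subspace[OF bW])
  \<comment> \<open>The surjection of the Jordan block of row \<open>s\<close>, of length
    \<open>m\<close>, onto that of row \<open>Suc s\<close>, of length \<open>c\<close>: in terms of
    polynomial rings \<open>k[x]/(x^m) \<rightarrow> k[x]/(x^c)\<close>. It is extended by zero to
    the other rows.\<close>
  define h where "h = (\<lambda>p. if fst p = s \<and> m - c \<le> snd p then b (?r, snd p - (m - c)) else 0)"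
  obtain N where N: "lin N" "\<forall>x\<in>b ` young lam. N x = h (the_inv_into (young lam) b x)"
    using endo.linear_independent_extend[of "b ` young lam" "\<lambda>x. h (the_inv_into (young lam) b x)"] dW
    by blast
  have Nb: "N (b (i, j)) = (if i = s \<and> m - c \<le> j then b (?r, j - (m - c)) else 0)" if "j < lam i" for i j
    using N(2) that dW by (auto simp: mem_young the_inv_into_f_f h_def)
  have idx: "j - (m - c) < lam ?r" if "j < lam s" "m - c \<le> j" for j
    using that cm lr ls by simp
  have NW: "N x \<in> W" if "x \<in> W" for x
  proof -
    have "N ` W = span (N ` b ` young lam)" using dW endo.linear_span_image[OF N(1)] by metis
    also have "\<dots> \<subseteq> W"
      using Nb idx jordan_basis_mem[OF bW] subspace_0[OF sW]
      by (intro span_minimal[OF _ sW]) (auto simp: mem_young)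
    finally show ?thesis using that by blast
  qed
  have NN: "N (N x) = 0" if "x \<in> W" for x
  proof (rule endo.linear_eq_0_on_span[of "\<lambda>x. N (N x)"])
    show "lin (\<lambda>x. N (N x))" by (rule linI) (simp_all add: lin_simps[OF N(1)])
    show "x \<in> span (b ` young lam)" using that dW by simp
    fix z assume "z \<in> b ` young lam"
    then obtain i j where z: "z = b (i, j)" "j < lam i" by (auto simp: mem_young)
    show "N (N z) = 0"
    proof (cases "i = s \<and> m - c \<le> j")
      case True
      then have "N (b (?r, j - (m - c))) = 0" using Nb[of "j - (m - c)" ?r] idx z by simp
      then show ?thesis using Nb[OF z(2)] z True by simp
    next
      case False
      then have "N z = 0" unfolding z(1) Nb[OF z(2)] by (rule if_not_P)
      then show ?thesis by (simp add: lin_simps[OF N(1)])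
    qed
  qed
  have Ncomm: "N (\<eta> x) = \<eta> (N x)" if "x \<in> W" for x
  proof (rule endo.linear_eq_on[of "\<lambda>x. N (\<eta> x)" "\<lambda>x. \<eta> (N x)"])
    show "lin (\<lambda>x. N (\<eta> x))" "lin (\<lambda>x. \<eta> (N x))"
      by (auto intro!: linI simp: lin_simps[OF N(1)] lin_simps[OF lin])
    show "x \<in> span (b ` young lam)" using that dW by simp
    fix z assume "z \<in> b ` young lam"
    then obtain i j where z: "z = b (i, j)" "j < lam i" by (auto simp: mem_young)
    note az = jordan_basis_apply[OF bW z(2)]
    show "N (\<eta> z) = \<eta> (N z)"
    proof (cases "i = s \<and> m - c \<le> j")
      case True
      note ar = jordan_basis_apply[OF bW idx[of j]]
      show ?thesis
      proof (cases "j = m - c")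
        case j: True
        then have "\<eta> (N z) = 0" using ar True Nb[OF z(2)] z by simp
        moreover have "N (\<eta> z) = 0"
          using az Nb[of "j - 1" s] True z j by (auto simp: lin_simps[OF N(1)])
        ultimately show ?thesis by simp
      next
        case j: False
        then have "0 < j" "m - c \<le> j - 1" "j - (m - c) - 1 = j - 1 - (m - c)" "j - (m - c) \<noteq> 0"
          using True by auto
        then show ?thesis using az ar True Nb[OF z(2)] Nb[of "j - 1" s] z by simp
      qed
    next
      case False
      then have "N z = 0" unfolding z(1) Nb[OF z(2)] by (rule if_not_P)
      moreover have "N (\<eta> z) = 0"
        using az Nb[of "j - 1" i] False z by (auto simp: lin_simps[OF N(1)])
      ultimately show ?thesis by (simp add: lin_simps[OF lin])
    qed
  qed
  \<comment> \<open>The shear; it is injective on \<open>W\<close> because \<open>N\<close> squares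
    to zero there.\<close>
  define g where "g = (\<lambda>x. x + N x)"
  have ling: "lin g" unfolding g_def by (rule linI) (simp_all add: lin_simps[OF N(1)] scale_right_distrib)
  have inj: "inj_on g W"
    unfolding endo.linear_inj_on_iff_eq_0[OF ling sW]
  proof (intro ballI impI)
    fix x assume x: "x \<in> W" "g x = 0"
    then have "x = - N x" by (simp add: g_def eq_neg_iff_add_eq_0)
    then have "N x = N (- N x)" by simp
    also have "\<dots> = 0" using NN[OF x(1)] by (simp add: lin_simps[OF N(1)])
    finally show "x = 0" using x(2) by (simp add: g_def)
  qed
  have gW: "g ` W \<subseteq> W" unfolding g_def using NW by (auto intro: subspace_add[OF sW])
  have iso: "iso \<eta> W \<eta> (g ` W) g"
    unfolding iso_def using ling inj Ncomm by (auto simp: g_def lin_simps[OF lin])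
  have FW: "F \<subseteq> W"
  proof -
    have "young mu \<subseteq> young lam" unfolding lam young_add by auto
    then have "span (b ` young mu) \<subseteq> span (b ` young lam)" by (intro span_mono image_mono)
    then show ?thesis using bF bW by (simp add: jordan_basis_def)
  qed
  have JTF: "JT \<eta> F mu" using bF part by (auto simp: JT_def)
  have "JT \<eta> (g ` F) mu" by (rule iso_JT[OF iso JTF FW])
  moreover have "g ` F \<subseteq> W" using gW FW by blast
  moreover have "\<not> g ` F \<inter> ker_pow \<eta> m \<subseteq> F"
  proof
    assume sub: "g ` F \<inter> ker_pow \<eta> m \<subseteq> F"
    \<comment> \<open>The last vector \<open>b (s, m - 1)\<close> of row \<open>s\<close> lies in
      \<open>F\<close>. The shear adds to it the last vector of row \<open>Suc s\<close>, which
      belongs to the one square of \<open>lam\<close> missing in \<open>mu\<close>; both are killed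
      by \<open>\<eta> ^^ m\<close> because \<open>c \<le> m\<close>.\<close>
    have m1: "m - 1 < lam s" "m - 1 < mu s" using cm c0 ls m_def by auto
    have "m - c \<le> m - 1" "m - 1 - (m - c) = c - 1" using cm c0 by auto
    then have gb: "g (b (s, m - 1)) = b (s, m - 1) + b (?r, c - 1)" using Nb[OF m1(1)] by (simp add: g_def)
    have bs: "b (s, m - 1) \<in> F" by (rule jordan_basis_mem[OF bF m1(2)])
    have "(\<eta> ^^ m) (b (s, m - 1)) = 0" "(\<eta> ^^ m) (b (?r, c - 1)) = 0"
      using jordan_basis_apply_pow[OF bW m1(1) lin, of m] jordan_basis_apply_pow[OF bW _ lin, of "c - 1" ?r m]
        lr cm c0 by auto
    then have "g (b (s, m - 1)) \<in> ker_pow \<eta> m"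
      unfolding gb by (simp add: ker_pow_def lin_simps[OF lin_funpow[OF lin]])
    then have "b (s, m - 1) + b (?r, c - 1) \<in> F" using sub bs gb by auto
    then have "b (s, m - 1) + b (?r, c - 1) - b (s, m - 1) \<in> F"
      using bs by (rule subspace_diff[OF jordan_basis_subspace[OF bF]])
    then have "b (?r, mu ?r) \<in> F" by (simp add: c_def)
    then have "b ` young lam \<subseteq> F" unfolding lam young_add
      using jordan_basis_mem[OF bF] by (auto simp: mem_young)
    then have "W \<subseteq> F" using dW span_minimal[OF _ jordan_basis_subspace[OF bF]] by metis
    then have "W = F" using FW by blast
    then have "psize lam = psize mu"
      using jordan_basis_dim[OF bF is_partition_finite[OF part(1)]]
        jordan_basis_dim[OF bW is_partition_finite[OF part(2)]] by argo
    moreover have "psize lam = Suc (psize mu)"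
      unfolding lam by (rule psize_add[OF is_partition_finite[OF part(1)]])
    ultimately show False by simp
  qed
  ultimately show thesis using that unfolding m_def by blast
qed

text \<open>If the square \<open>lam / mu\<close> is in row 0, then \<open>F\<close> is killed by
  the power \<open>mu 0\<close> of \<eta>, and the part of \<open>W\<close> so killed lies in
  \<open>W'\<close>; hence \<open>F = W'\<close>. If it is in row \<open>Suc s\<close>, comparison
  with a sheared hyperplane shows that \<open>W'\<close> leaves \<open>F\<close> inside the kernel
  of the power \<open>mu s\<close>, so the square \<open>mu / nu\<close> is in a row of length at
  most \<open>mu s\<close>. As \<open>F\<close> contains the kernel of the power
  \<open>mu (Suc s)\<close> in \<open>W\<close>, that row is also strictly longer than row
  \<open>Suc s\<close>. Only row \<open>s\<close> is left.\<close>

lemma generic_square: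
  assumes lin: "lin \<eta>" and JW: "JT \<eta> W lam" and JW': "JT \<eta> W' mu" and JF: "JT \<eta> F mu"
    and sub: "W' \<subseteq> W" "F \<subseteq> W" and dW: "dim W = Suc (dim W')"
    and Jnu: "JT \<eta> (W' \<inter> F) nu"
    and min: "\<And>W2 k. JT \<eta> W2 mu \<Longrightarrow> W2 \<subseteq> W \<Longrightarrow>
        dim (W' \<inter> F \<inter> ker_pow \<eta> k) \<le> dim (W2 \<inter> F \<inter> ker_pow \<eta> k)"
  shows "RS1 nu mu mu lam \<or> RS2 nu mu mu lam"
proof -
  have dF: "dim W = Suc (dim F)" using dW JT_dim[OF JW'] JT_dim[OF JF] by simp
  obtain r b where rb: "lam = mu(r := Suc (mu r))" "jordan_basis \<eta> F mu b" "jordan_basis \<eta> W lam b"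
    "\<forall>c. W \<inter> ker_pow \<eta> c \<subseteq> F \<longleftrightarrow> c \<le> mu r"
    by (rule hyperplane_jordan[OF lin JF JW sub(2) dF])
  obtain r' b' where rb': "lam = mu(r' := Suc (mu r'))"
    "\<forall>c. W \<inter> ker_pow \<eta> c \<subseteq> W' \<longleftrightarrow> c \<le> mu r'"
    by (rule hyperplane_jordan[OF lin JW' JW sub(1) dW])
  have "lam r' = Suc (mu r')" using rb'(1) by simp
  then have rr: "r' = r" using rb(1) by (cases "r' = r") auto
  note pm = JT_partition[OF JF] and pl = JT_partition[OF JW] and pn = JT_partition[OF Jnu]
  have prec: "mu \<prec> lam" unfolding rb(1) by (rule pprec_add[OF is_partition_finite[OF pm]])
  show ?thesis
  proof (cases r)
    case 0
    have "F \<subseteq> W \<inter> ker_pow \<eta> (mu 0)" using sub(2) JT_nilpotent[OF JF lin] by (auto simp: ker_pow_def)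
    moreover have "W \<inter> ker_pow \<eta> (mu 0) \<subseteq> W'" using rb'(2) rr 0 by simp
    ultimately have "F \<subseteq> W'" by blast
    then have "F = W'"
      using JT_dim[OF JW'] JT_dim[OF JF] by (intro subspace_dim_equal JT_subspace[OF JF] JT_subspace[OF JW']) auto
    then have "nu = mu" using JT_unique[OF Jnu _ lin] JF by simp
    then have "RS1 nu mu mu lam" using prec rb(1) 0 by (simp add: RS1_def)
    then show ?thesis ..
  next
    case (Suc s)
    let ?m = "mu s"
    obtain W2 where W2: "JT \<eta> W2 mu" "W2 \<subseteq> W" "\<not> W2 \<inter> ker_pow \<eta> ?m \<subseteq> F"
      by (rule shear_hyperplane[OF lin rb(2,3) rb(1)[unfolded Suc] pm pl])
    note sK = subspace_ker_pow[OF lin, of ?m]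
    have s1: "subspace (W2 \<inter> F \<inter> ker_pow \<eta> ?m)" "subspace (W2 \<inter> ker_pow \<eta> ?m)"
      by (intro subspace_inter JT_subspace[OF W2(1)] JT_subspace[OF JF] sK)+
    have "W2 \<inter> F \<inter> ker_pow \<eta> ?m \<subset> W2 \<inter> ker_pow \<eta> ?m" using W2(3) by blast
    then have "dim (W2 \<inter> F \<inter> ker_pow \<eta> ?m) < dim (W2 \<inter> ker_pow \<eta> ?m)"
      using s1 by (intro dim_psubset) (metis span_eq_iff)
    also have "dim (W2 \<inter> ker_pow \<eta> ?m) = dim (W' \<inter> ker_pow \<eta> ?m)"
      using JT_dim_ker_pow[OF W2(1) lin] JT_dim_ker_pow[OF JW' lin] by simp
    finally have "dim (W' \<inter> F \<inter> ker_pow \<eta> ?m) < dim (W' \<inter> ker_pow \<eta> ?m)"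
      using min[OF W2(1,2), of ?m] by simp
    then have nsub: "\<not> W' \<inter> ker_pow \<eta> ?m \<subseteq> F"
      by (metis Int_assoc Int_commute inf.absorb_iff1 less_irrefl)
    then have "dim W' = Suc (dim (W' \<inter> F))"
      using dim_Int_hyperplane[OF JT_subspace[OF JF] JT_subspace[OF JW] sub(2) dF JT_subspace[OF JW'] sub(1)] by blast
    then obtain r2 b2 where r2: "mu = nu(r2 := Suc (nu r2))"
      "\<forall>c. W' \<inter> ker_pow \<eta> c \<subseteq> W' \<inter> F \<longleftrightarrow> c \<le> nu r2"
      using hyperplane_jordan[OF lin Jnu JW' Int_lower1] by metis
    have m2: "mu r2 = Suc (nu r2)" using r2(1) by (metis fun_upd_same)
    have 1: "mu r2 \<le> ?m" using r2(2)[THEN spec, of ?m] nsub m2 by auto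
    have "W' \<inter> ker_pow \<eta> (mu r) \<subseteq> W' \<inter> F"
      using rb(4)[THEN spec, of "mu r"] sub(1) by auto
    then have 2: "mu r < mu r2" using r2(2) m2 by simp
    have "r2 < r" using is_partition_antimono[OF pm, of r r2] 2 by (meson not_less)
    then have rs: "r2 \<le> s" using Suc by simp
    \<comment> \<open>Otherwise row \<open>s\<close> of \<open>nu\<close> would be longer than the
      shortened row \<open>r2\<close> above it.\<close>
    have "r2 = s"
    proof (rule ccontr)
      assume "r2 \<noteq> s"
      then have "nu s = mu s" using r2(1) by (metis fun_upd_other)
      then show False using is_partition_antimono[OF pn rs] 1 m2 by simp
    qed
    have "nu \<prec> mu" using pprec_add[OF is_partition_finite[OF pn], of r2] r2(1) by simp
    then have "RS2 nu mu mu lam" unfolding RS2_def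
      using prec m2 \<open>r2 = s\<close> rb(1) Suc by (intro conjI exI[of _ s]) auto
    then show ?thesis ..
  qed
qed

text \<open>An automorphism of \<open>f (Suc j)\<close> that takes \<open>f j\<close> to
  \<open>W\<close> carries the lower members along.\<close>

lemma FL_replace:
  assumes lin: "lin \<eta>" and f: "f \<in> FL \<eta> V M q" and j: "j < M"
    and d: "psize (q (Suc j)) = Suc (psize (q j))" and W: "JT \<eta> W (q j)" "W \<subseteq> f (Suc j)"
  obtains g where "g \<in> FL \<eta> V M q" "g j = W"
proof -
  have J1: "JT \<eta> (f j) (q j)" "JT \<eta> (f (Suc j)) (q (Suc j))" "f j \<subseteq> f (Suc j)"
    using FL_JT[OF f] FL_mono[OF f, of j "Suc j"] j by auto
  have "dim (f (Suc j)) = Suc (dim (f j))" using JT_dim[OF J1(1)] JT_dim[OF J1(2)] d by simp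
  then obtain G where G: "iso \<eta> (f (Suc j)) \<eta> (f (Suc j)) G" "G ` f j = W"
    using iso_of_hyperplanes[OF lin lin J1 _ W(1) J1(2) W(2)] by metis
  define g where "g = (\<lambda>i. if i \<le> j then G ` f i else f i)"
  have "g \<in> FL \<eta> V M q"
    unfolding FL_def mem_Collect_eq
  proof (intro conjI allI impI)
    show "g M = V" using FL_top[OF f] j by (simp add: g_def)
    fix i assume i: "i \<le> M"
    show "JT \<eta> (g i) (q i)"
    proof (cases "i \<le> j")
      case True
      then have "f i \<subseteq> f (Suc j)" using FL_mono[OF f, of i "Suc j"] j by simp
      from iso_JT[OF G(1) FL_JT[OF f i] this] show ?thesis using True by (simp add: g_def)
    qed (use FL_JT[OF f i] in \<open>simp add: g_def\<close>)
  next
    fix i assume i: "i < M"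
    have "f i \<subseteq> f (Suc i)" using FL_mono[OF f, of i "Suc i"] i by simp
    moreover have "G ` f j \<subseteq> f (Suc j)" using G(2) W(2) by simp
    ultimately show "g i \<subseteq> g (Suc i)" by (cases "i = j") (auto simp: g_def)
  qed
  then show thesis using that G(2) by (simp add: g_def)
qed

text \<open>One pair attains all minima simultaneously. For fixed \<open>i\<close> and
  \<open>j\<close>, the numbers for varying \<open>k\<close> determine the Jordan type of the
  intersection.\<close>

definition minimal_pair where
  "minimal_pair \<eta> V N p M q f f' \<longleftrightarrow> f \<in> FL \<eta> V N p \<and> f' \<in> FL \<eta> V M q \<and>
     (\<forall>g\<in>FL \<eta> V N p. \<forall>g'\<in>FL \<eta> V M q. \<forall>i\<le>N. \<forall>j\<le>M. \<forall>k.
        dim (ker_pow \<eta> k \<inter> f i \<inter> f' j) \<le> dim (ker_pow \<eta> k \<inter> g i \<inter> g' j))"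

lemma JT_Int:
  assumes "lin \<eta>" "JT \<eta> A a" "JT \<eta> B b"
  shows "JT \<eta> (A \<inter> B) (jordan_type \<eta> (A \<inter> B))"
proof -
  have "\<eta> ` (A \<inter> B) \<subseteq> A \<inter> B" using JT_stable[OF assms(2,1)] JT_stable[OF assms(3,1)] by auto
  from JT_exists_sub[OF assms(1,2) subspace_inter[OF JT_subspace[OF assms(2)] JT_subspace[OF assms(3)]] _ this]
  obtain mu where "JT \<eta> (A \<inter> B) mu" by auto
  with JT_jordan_type[OF this assms(1)] show ?thesis by simp
qed

lemma JT_hyperplane_prec:
  assumes "lin \<eta>" "JT \<eta> H mu" "JT \<eta> V lam" "H \<subseteq> V" "dim V = Suc (dim H)"
  shows "mu \<prec> lam"
proof -
  obtain r b where "lam = mu(r := Suc (mu r))" by (rule hyperplane_jordan[OF assms])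
  then show ?thesis using pprec_add[OF is_partition_finite[OF JT_partition[OF assms(2)]]] by simp
qed

lemma JT_preceq:
  assumes "lin \<eta>" "JT \<eta> H mu" "JT \<eta> V lam" "H \<subseteq> V" "dim V \<le> Suc (dim H)"
  shows "mu \<preceq> lam"
proof (cases "dim V = Suc (dim H)")
  case True then show ?thesis using JT_hyperplane_prec[OF assms(1-4)] by (simp add: ppreceq_def)
next
  case False
  then have "H = V" using assms JT_subspace by (intro subspace_dim_equal) auto
  then show ?thesis using JT_unique[OF assms(2) _ assms(1)] assms(3) by (simp add: ppreceq_def)
qed

text \<open>Squares with \<open>W \<subseteq> H\<close> or \<open>W' = W\<close> are of type RS0;
  hyperplanes \<open>W'\<close> and \<open>H \<inter> W\<close> of \<open>W\<close> of different
  types give RS3. Minimality enters only if their types agree: by \<open>FL_replace\<close> each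
  competing hyperplane of \<open>W\<close> is member \<open>j\<close> of a flag, which is compared
  while the first flag is kept.\<close>

lemma minimal_pair_top_square:
  assumes lin: "lin \<eta>" and min: "minimal_pair \<eta> V (Suc N) p M q f f'"
    and stepq: "\<forall>j<M. psize (q (Suc j)) \<le> Suc (psize (q j))"
    and dV: "dim V \<le> Suc (dim (f N))" and j: "j < M"
  shows "rs_square (jordan_type \<eta> (f N \<inter> f' j)) (jordan_type \<eta> (f N \<inter> f' (Suc j))) (q j) (q (Suc j))"
proof -
  have f: "f \<in> FL \<eta> V (Suc N) p" and f': "f' \<in> FL \<eta> V M q" using min by (auto simp: minimal_pair_def)
  define H W W' where "H = f N" and "W = f' (Suc j)" and "W' = f' j"
  have JH: "JT \<eta> H (p N)" and JV: "JT \<eta> V (p (Suc N))" and HV: "H \<subseteq> V"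
    using FL_JT[OF f] FL_mono[OF f, of N "Suc N"] FL_top[OF f] by (auto simp: H_def)
  have JW: "JT \<eta> W (q (Suc j))" and JW': "JT \<eta> W' (q j)" and WW: "W' \<subseteq> W" and WV: "W \<subseteq> V"
    using FL_JT[OF f'] FL_mono[OF f', of j "Suc j"] FL_mono[OF f', of "Suc j" M] FL_top[OF f'] j
    by (auto simp: W_def W'_def)
  define mu nu where "mu = jordan_type \<eta> (H \<inter> W)" and "nu = jordan_type \<eta> (H \<inter> W')"
  have Jmu: "JT \<eta> (H \<inter> W) mu" unfolding mu_def by (rule JT_Int[OF lin JH JW])
  have Jnu: "JT \<eta> (H \<inter> W') nu" unfolding nu_def by (rule JT_Int[OF lin JH JW'])
  have dW: "dim W \<le> Suc (dim W')" using stepq j JT_dim[OF JW] JT_dim[OF JW'] by simp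
  have sub: "subspace H" "subspace V" "subspace W" "subspace W'"
    using JT_subspace[OF JH] JT_subspace[OF JV] JT_subspace[OF JW] JT_subspace[OF JW'] by auto
  have "rs_square nu mu (q j) (q (Suc j))"
  proof (cases "W \<subseteq> H")
    case True
    then have e: "H \<inter> W = W" "H \<inter> W' = W'" using WW by auto
    have "mu = q (Suc j)" "nu = q j"
      using JT_unique[OF Jmu[unfolded e] JW lin] JT_unique[OF Jnu[unfolded e] JW' lin] by auto
    moreover have "q j \<preceq> q (Suc j)" by (rule JT_preceq[OF lin JW' JW WW dW])
    ultimately show ?thesis by (simp add: rs_square_def RS0_def)
  next
    case nWH: False
    have dV': "dim V = Suc (dim H)"
    proof (rule ccontr)
      assume "dim V \<noteq> Suc (dim H)"
      then have "dim V \<le> dim H" using dV by (simp add: H_def)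
      then have "H = V" using subspace_dim_equal[OF sub(1,2) HV] by simp
      then show False using nWH WV by simp
    qed
    have dF: "dim W = Suc (dim (H \<inter> W))"
      using dim_Int_hyperplane[OF sub(1,2) HV dV' sub(3) WV nWH] by (simp add: Int_commute)
    show ?thesis
    proof (cases "dim W = Suc (dim W')")
      case False
      then have "W' = W" using dW by (intro subspace_dim_equal sub WW) auto
      then have "q j = q (Suc j)" "nu = mu" using JT_unique[OF JW' _ lin] JW by (auto simp: mu_def nu_def)
      moreover have "mu \<preceq> q (Suc j)" using JT_preceq[OF lin Jmu JW] dF by simp
      ultimately show ?thesis by (simp add: rs_square_def RS0_def)
    next
      case dW': True
      have e: "H \<inter> W' = W' \<inter> (H \<inter> W)" using WW by auto
      show ?thesis
      proof (cases "mu = q j")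
        case True
        have "RS1 nu mu mu (q (Suc j)) \<or> RS2 nu mu mu (q (Suc j))"
        proof (rule generic_square[OF lin JW _ Jmu WW _ dW'])
          show "JT \<eta> W' mu" using JW' True by simp
          show "JT \<eta> (W' \<inter> (H \<inter> W)) nu" using Jnu e by simp
          fix W2 k assume W2: "JT \<eta> W2 mu" "W2 \<subseteq> W"
          have "psize (q (Suc j)) = Suc (psize (q j))" using dW' JT_dim[OF JW] JT_dim[OF JW'] by simp
          then obtain g where g: "g \<in> FL \<eta> V M q" "g j = W2"
            using FL_replace[OF lin f' j] W2 True unfolding W_def by metis
          have "dim (ker_pow \<eta> k \<inter> f N \<inter> f' j) \<le> dim (ker_pow \<eta> k \<inter> f N \<inter> g j)"
            using min f g(1) j unfolding minimal_pair_def by (meson le_SucI less_imp_le order_refl)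
          moreover have "W' \<inter> (H \<inter> W) \<inter> ker_pow \<eta> k = ker_pow \<eta> k \<inter> f N \<inter> f' j"
            using WW unfolding H_def W'_def by auto
          moreover have "W2 \<inter> (H \<inter> W) \<inter> ker_pow \<eta> k = ker_pow \<eta> k \<inter> f N \<inter> g j"
            using W2(2) g(2) unfolding H_def by auto
          ultimately show "dim (W' \<inter> (H \<inter> W) \<inter> ker_pow \<eta> k) \<le> dim (W2 \<inter> (H \<inter> W) \<inter> ker_pow \<eta> k)"
            by simp
        qed simp
        then show ?thesis using True by (auto simp: rs_square_def)
      next
        case False
        then have "W' \<noteq> H \<inter> W" using JT_unique[OF JW' _ lin] Jmu by auto
        have n1: "\<not> W' \<subseteq> H \<inter> W"
        proof
          assume "W' \<subseteq> H \<inter> W"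
          then have "W' = H \<inter> W" using dF dW' by (intro subspace_dim_equal sub subspace_inter) auto
          then show False using \<open>W' \<noteq> H \<inter> W\<close> by blast
        qed
        have n2: "\<not> H \<inter> W \<subseteq> W'"
        proof
          assume "H \<inter> W \<subseteq> W'"
          then have "H \<inter> W = W'" using dF dW' by (intro subspace_dim_equal sub subspace_inter) auto
          then show False using \<open>W' \<noteq> H \<inter> W\<close> by blast
        qed
        have d1: "dim W' = Suc (dim (H \<inter> W'))"
          using dim_Int_hyperplane[OF subspace_inter[OF sub(1,3)] sub(3) Int_lower2 dF sub(4) WW n1]
          unfolding e .
        have d2: "dim (H \<inter> W) = Suc (dim (H \<inter> W'))"
          using dim_Int_hyperplane[OF sub(4,3) WW dW' subspace_inter[OF sub(1,3)] Int_lower2 n2]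
          unfolding e by (simp add: Int_commute)
        have "nu \<prec> q j" by (rule JT_hyperplane_prec[OF lin Jnu JW' Int_lower2 d1])
        moreover have "nu \<prec> mu" by (rule JT_hyperplane_prec[OF lin Jnu Jmu _ d2]) (use WW in auto)
        moreover have "mu \<prec> q (Suc j)" by (rule JT_hyperplane_prec[OF lin Jmu JW Int_lower2 dF])
        moreover have "q j \<prec> q (Suc j)" by (rule JT_hyperplane_prec[OF lin JW' JW WW dW'])
        ultimately show ?thesis using False by (simp add: rs_square_def RS3_def)
      qed
    qed
  qed
  then show ?thesis by (simp add: mu_def nu_def H_def W_def W'_def)
qed

end

section \<open>Lifting flags from a hyperplane\<close>


text \<open>The square at which the second flag leaves the hyperplane: the entries on the left
  agree, those on the right differ, and only RS1 allows this.\<close>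

lemma RS1_if_all_equal_left:
  assumes "rs_square nu mu nu lam" "psize lam = Suc (psize mu)"
  shows "mu = nu" "mu 0 + 1 = lam 0"
  using assms pprec_irrefl by (auto simp: rs_square_def RS0_def RS1_def RS2_def RS3_def)

lemma rs_square_same_top:
  assumes "rs_square nu nu mu' lam" "psize mu' = Suc (psize nu)" "psize lam = Suc (psize nu)"
  shows "lam = mu'"
  using assms pprec_irrefl by (auto simp: rs_square_def RS0_def RS1_def RS2_def RS3_def)

lemma rs_square_step:
  assumes "rs_square nu mu mu' lam" "nu \<noteq> mu" "psize lam = Suc (psize mu)"
  shows "RS2 nu mu mu' lam \<or> RS3 nu mu mu' lam"
  using assms by (auto simp: rs_square_def RS0_def RS1_def)

lemma rs_square_psize:
  assumes "rs_square nu mu mu' lam" "psize lam \<le> Suc (psize mu')"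
  shows "psize mu \<le> Suc (psize nu)"
  using assms by (auto simp: rs_square_def RS0_def RS1_def RS2_def RS3_def pprec_def)

context fd_flag_space
begin

lemma insert_span_Int:
  assumes "subspace H" "v \<notin> H" "subspace A" "A \<subseteq> H"
  shows "span (insert v A) \<inter> H = A"
proof
  show "A \<subseteq> span (insert v A) \<inter> H" using assms(4) by (auto intro: span_base)
  show "span (insert v A) \<inter> H \<subseteq> A"
  proof
    fix x assume x: "x \<in> span (insert v A) \<inter> H"
    then obtain k where k: "x - k *s v \<in> A"
      using assms(3) by (auto simp: span_insert span_eq_iff[THEN iffD2, OF assms(3)])
    have "x - k *s v \<in> H" using k assms(4) by blast
    with x have "x - (x - k *s v) \<in> H" by (blast intro: subspace_diff[OF assms(1)])
    then have "k *s v \<in> H" by simp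
    then have "k = 0" using assms(2) subspace_scale[OF assms(1), of "k *s v" "inverse k"] by (cases "k = 0") auto
    then show "x \<in> A" using k by simp
  qed
qed

text \<open>The hypothesis \<open>gen\<close> bounds from below the row length at which \<open>v\<close> enters; that this bound is
  attained follows step by step, since each square of type RS prescribes the largest length compatible
  with the previous one.\<close>

lemma lift_types:
  assumes lin: "lin \<theta>" and h: "h \<in> FL \<theta> H M q'" and v: "v \<notin> H"
    and sq: "\<forall>j<M. rs_square (q' j) (q' (Suc j)) (q j) (q (Suc j))"
    and j0: "j0 < M" and eq: "q j0 = q' j0"
    and r: "\<forall>j. j0 < j \<and> j \<le> M \<longrightarrow> q j = (q' j)(r j := Suc (q' j (r j))) \<and> is_partition (q j)"
    and u: "\<theta> v \<in> h j0"
    and gen: "\<forall>j. j0 < j \<and> j \<le> M \<longrightarrow> (\<forall>y\<in>h j. (\<theta> ^^ (q' j (r j))) (v + y) \<noteq> 0)"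
    and j: "Suc j0 \<le> j" "j \<le> M"
  shows "JT \<theta> (span (insert v (h j))) (q j)"
  using j
proof (induction j rule: dec_induct)
  let ?W = "\<lambda>j. span (insert v (h j))"
  have JH: "JT \<theta> H (q' M)" using FL_JT[OF h, of M] FL_top[OF h] by simp
  have hH: "h j \<subseteq> H" if "j \<le> M" for j using FL_mono[OF h that] FL_top[OF h] by simp
  have sizes: "psize (q j) = Suc (psize (q' j))" if "j0 < j" "j \<le> M" for j
    using r that psize_add[OF is_partition_finite[OF JT_partition[OF FL_JT[OF h that(2)]]]] by metis
  \<comment> \<open>The type of \<open>?W j\<close> is that of \<open>h j\<close> with one more
    square, in some row \<open>r'\<close>. By \<open>gen\<close> the kernel of the power
    \<open>q' j (r j)\<close> in \<open>?W j\<close> stays inside \<open>h j\<close>, so row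
    \<open>r'\<close> is at least as long as row \<open>r j\<close>.\<close>
  have ext: "\<exists>r'. is_partition ((q' j)(r' := Suc (q' j r'))) \<and>
      JT \<theta> (?W j) ((q' j)(r' := Suc (q' j r'))) \<and>
      (\<forall>c. ?W j \<inter> ker_pow \<theta> c \<subseteq> h j \<longleftrightarrow> c \<le> q' j r') \<and> q' j (r j) \<le> q' j r'"
    if j: "j0 < j" "j \<le> M" for j
  proof -
    have Jj: "JT \<theta> (h j) (q' j)" by (rule FL_JT[OF h j(2)])
    have vj: "v \<notin> h j" using v hH[OF j(2)] by blast
    have uj: "\<theta> v \<in> h j" using u FL_mono[OF h, of j0 j] j by auto
    obtain r' b where r': "is_partition ((q' j)(r' := Suc (q' j r')))"
      "jordan_basis \<theta> (?W j) ((q' j)(r' := Suc (q' j r'))) b"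
      "\<forall>c. ?W j \<inter> ker_pow \<theta> c \<subseteq> h j \<longleftrightarrow> c \<le> q' j r'"
      by (rule extend_jordan[OF lin Jj vj uj])
    have "?W j \<inter> ker_pow \<theta> (q' j (r j)) \<subseteq> h j"
    proof
      fix x assume x: "x \<in> ?W j \<inter> ker_pow \<theta> (q' j (r j))"
      have sj: "subspace (h j)" by (rule JT_subspace[OF Jj])
      obtain k where k: "x - k *s v \<in> h j"
        using x by (auto simp: span_insert span_eq_iff[THEN iffD2, OF sj])
      have "k = 0"
      proof (rule ccontr)
        assume k0: "k \<noteq> 0"
        define y where "y = inverse k *s (x - k *s v)"
        have y: "y \<in> h j" unfolding y_def by (rule subspace_scale[OF sj k])
        have "v + y = inverse k *s x" using k0 by (simp add: y_def scale_right_diff_distrib)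
        then have "(\<theta> ^^ (q' j (r j))) (v + y) = 0"
          using x by (simp add: ker_pow_def lin_simps[OF lin_funpow[OF lin]])
        then show False using gen j y by blast
      qed
      then show "x \<in> h j" using k by simp
    qed
    then show ?thesis using r' by (intro exI[of _ r']) (auto simp: JT_def)
  qed
  {
    case base
    have b: "j0 < Suc j0" "Suc j0 \<le> M" using j0 by auto
    have sq0: "rs_square (q' j0) (q' (Suc j0)) (q' j0) (q (Suc j0))" using sq j0 eq by metis
    note R1 = RS1_if_all_equal_left[OF sq0 sizes[OF b]]
    have rj: "q (Suc j0) = (q' (Suc j0))(r (Suc j0) := Suc (q' (Suc j0) (r (Suc j0))))" using r b by blast
    have r0: "r (Suc j0) = 0"
    proof (rule ccontr)
      assume "r (Suc j0) \<noteq> 0"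
      then have "q (Suc j0) 0 = q' (Suc j0) 0" using rj by (metis fun_upd_other)
      then show False using R1 by simp
    qed
    obtain r' where r': "is_partition ((q' (Suc j0))(r' := Suc (q' (Suc j0) r')))"
      "JT \<theta> (?W (Suc j0)) ((q' (Suc j0))(r' := Suc (q' (Suc j0) r')))"
      "q' (Suc j0) (r (Suc j0)) \<le> q' (Suc j0) r'" using ext[OF b] by blast
    \<comment> \<open>Row \<open>r'\<close> is at least as long as row 0, and among rows of equal
      length only the first can receive a square.\<close>
    have "r' = 0"
      using is_partition_addD[OF r'(1), of 0] r'(3) r0 by (cases "r' = 0") auto
    then have "(q' (Suc j0))(r' := Suc (q' (Suc j0) r')) = q (Suc j0)" using rj r0 by simp
    then show ?case using r'(2) by metis
  next
    case (step j)
    have a: "j0 < j" "j \<le> M" "j < M" and b: "j0 < Suc j" "Suc j \<le> M" using step by auto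
    have IH: "JT \<theta> (?W j) (q j)" using step.IH a by blast
    have sqj: "rs_square (q' j) (q' (Suc j)) (q j) (q (Suc j))" using sq a by blast
    have hh: "h j \<subseteq> h (Suc j)" using FL_mono[OF h, of j "Suc j"] b by simp
    have Jh: "JT \<theta> (h j) (q' j)" "JT \<theta> (h (Suc j)) (q' (Suc j))" using FL_JT[OF h] a b by auto
    define nu mu lam where "nu = q' j" and "mu = q' (Suc j)" and "lam = q (Suc j)"
    obtain r' where r': "is_partition (mu(r' := Suc (mu r')))"
      "JT \<theta> (?W (Suc j)) (mu(r' := Suc (mu r')))"
      "\<forall>c. ?W (Suc j) \<inter> ker_pow \<theta> c \<subseteq> h (Suc j) \<longleftrightarrow> c \<le> mu r'"
      "mu (r (Suc j)) \<le> mu r'" using ext[OF b] unfolding mu_def by blast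
    have lam: "lam = mu(r (Suc j) := Suc (mu (r (Suc j))))" "is_partition lam"
      using r b unfolding lam_def mu_def by blast+
    note pmu = JT_partition[OF Jh(2), folded mu_def] and pnu = JT_partition[OF Jh(1), folded nu_def]
    have qj: "q j = nu(r j := Suc (nu (r j)))" "is_partition (q j)" using r a unfolding nu_def by blast+
    have WW: "?W j \<subseteq> ?W (Suc j)" using hh by (intro span_mono) auto
    have dW: "dim (?W (Suc j)) = Suc (psize mu)"
      using JT_dim[OF r'(2)] psize_add[OF is_partition_finite[OF pmu]] by simp
    have dWj: "dim (?W j) = Suc (psize nu)" using JT_dim[OF IH] sizes[OF a(1,2)] by (simp add: nu_def)
    show ?case
    proof (cases "nu = mu")
      case True
      then have "h j = h (Suc j)"
        using Jh JT_dim[OF Jh(1)] JT_dim[OF Jh(2)] hh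
        by (intro subspace_dim_equal JT_subspace[OF Jh(1)] JT_subspace[OF Jh(2)]) (auto simp: nu_def mu_def)
      moreover have "q (Suc j) = q j"
        using rs_square_same_top[of nu "q j" "q (Suc j)"] sqj True sizes[OF a(1,2)] sizes[OF b]
        by (simp add: nu_def mu_def)
      ultimately show ?thesis using IH by simp
    next
      case False
      then have "RS2 nu mu (q j) lam \<or> RS3 nu mu (q j) lam"
        using rs_square_step[OF sqj] sizes[OF b] unfolding nu_def mu_def lam_def by blast
      then show ?thesis
      proof
        \<comment> \<open>The type of the lifted member covers both \<open>q j\<close> and
          \<open>mu\<close>, as \<open>lam\<close> does, and two distinct partitions have at most
          one common cover.\<close>
        assume R3: "RS3 nu mu (q j) lam"
        have smu: "psize mu = Suc (psize nu)" using R3 by (simp add: RS3_def pprec_def)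
        have dd: "dim (?W (Suc j)) = Suc (dim (?W j))" using dW dWj smu by simp
        have p1: "q j \<prec> mu(r' := Suc (mu r'))" by (rule JT_hyperplane_prec[OF lin IH r'(2) WW dd])
        have p2: "mu \<prec> mu(r' := Suc (mu r'))" by (rule pprec_add[OF is_partition_finite[OF pmu]])
        have "mu(r' := Suc (mu r')) = lam"
          using R3 p1 p2 lam(2) by (intro pprec_join_unique[OF r'(1) lam(2) _ is_partition_finite[OF pmu]
                is_partition_finite[OF qj(2)]]) (auto simp: RS3_def)
        then show ?thesis using r'(2) by (simp add: lam_def)
      next
        assume R2: "RS2 nu mu (q j) lam"
        then have mq: "mu = q j" by (simp add: RS2_def)
        obtain i where i: "mu (i + 1) + 1 = lam (i + 1)" "nu i + 1 = mu i" using R2 by (auto simp: RS2_def)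
        have ri: "r (Suc j) = Suc i"
        proof (rule ccontr)
          assume "r (Suc j) \<noteq> Suc i"
          then have "lam (Suc i) = mu (Suc i)" unfolding lam(1) by simp
          then show False using i(1) by simp
        qed
        have rj: "r j = i"
        proof (rule ccontr)
          assume "r j \<noteq> i"
          then have "mu i = nu i" unfolding mq qj(1) by simp
          then show False using i(2) by simp
        qed
        have sj: "subspace (h j)" by (rule JT_subspace[OF Jh(1)])
        obtain r2 b2 where r2: "q j = nu(r2 := Suc (nu r2))" "\<forall>c. ?W j \<inter> ker_pow \<theta> c \<subseteq> h j \<longleftrightarrow> c \<le> nu r2"
        proof (rule hyperplane_jordan[OF lin Jh(1)[folded nu_def] IH])
          show "h j \<subseteq> ?W j" by (auto intro: span_base)
          show "dim (?W j) = Suc (dim (h j))" using dWj JT_dim[OF Jh(1)] by (simp add: nu_def)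
        qed
        have "r2 = i"
        proof (rule ccontr)
          assume "r2 \<noteq> i"
          then have "mu i = nu i" unfolding mq r2(1) by simp
          then show False using i(2) by simp
        qed
        \<comment> \<open>A vector by which \<open>?W j\<close> leaves \<open>h j\<close>, killed by
          the power \<open>mu i\<close>, also leaves \<open>h (Suc j)\<close>. Hence
          \<open>mu r' < mu i\<close>, so \<open>r'\<close> is below row \<open>i\<close>; the lower
          bound on the length of row \<open>r'\<close> excludes rows below
          \<open>Suc i\<close>.\<close>
        then have "\<not> ?W j \<inter> ker_pow \<theta> (mu i) \<subseteq> h j" using r2(2) i(2) by auto
        moreover have "?W j \<inter> h (Suc j) \<subseteq> h j"
          using insert_span_Int[OF JT_subspace[OF JH] v sj hH[OF a(2)]] hH[OF b(2)] by blast
        ultimately have "\<not> ?W (Suc j) \<inter> ker_pow \<theta> (mu i) \<subseteq> h (Suc j)" using WW by blast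
        then have ub: "mu r' < mu i" using r'(3) by auto
        then have "i < r'" using is_partition_antimono[OF pmu, of r' i] by (meson leD not_le)
        moreover have "\<not> Suc i < r'" using is_partition_addD[OF r'(1), of "Suc i"] r'(4) ri by auto
        ultimately have "r' = Suc i" by simp
        then have "mu(r' := Suc (mu r')) = q (Suc j)" using lam(1) ri unfolding lam_def by simp
        then show ?thesis using r'(2) by metis
      qed
    qed
  }
qed

text \<open>Staying outside an image is an open condition only while the dimension of the image is
  constant, hence the second condition on \<open>t\<close>. Vectors \<open>g (e k t0)\<close>
  forming a basis of the image at \<open>t0\<close> are independent together with
  \<open>x t0\<close>. This persists, and by the constant dimension the same indices still span the
  image.\<close>

lemma notin_image_generic:
  assumes lin: "lin g" and fin: "finite I" and reg: "\<And>k. k \<in> I \<Longrightarrow> regular C (e k)" "regular C x"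
    and x0: "x t0 \<notin> g ` span ((\<lambda>k. e k t0) ` I)"
  shows "\<exists>p\<in>poly_funs C. p t0 \<noteq> 0 \<and> (\<forall>t. p t \<noteq> 0 \<and>
      dim (g ` span ((\<lambda>k. e k t) ` I)) = dim (g ` span ((\<lambda>k. e k t0) ` I)) \<longrightarrow>
      x t \<notin> g ` span ((\<lambda>k. e k t) ` I))"
proof -
  have S: "g ` span ((\<lambda>k. e k t) ` I) = span ((\<lambda>k. g (e k t)) ` I)" for t
    using endo.linear_span_image[OF lin, of "(\<lambda>k. e k t) ` I"] by (simp add: image_comp o_def)
  let ?v = "\<lambda>t k. g (e k t)"
  obtain B0 where B0: "B0 \<subseteq> ?v t0 ` I" "independent B0" "?v t0 ` I \<subseteq> span B0"
    using maximal_independent_subset[of "?v t0 ` I"] by blast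
  obtain I' where I': "I' \<subseteq> I" "inj_on (?v t0) I'" "B0 = ?v t0 ` I'"
    using B0(1) by (auto simp: subset_image_inj)
  have finI': "finite I'" using I'(1) fin by (rule finite_subset)
  have spB: "span B0 = span (?v t0 ` I)"
    using B0 by (intro antisym span_mono span_minimal) auto
  \<comment> \<open>\<open>None\<close> stands for \<open>x\<close>, and \<open>Some k\<close> for
    the basis vector of index \<open>k\<close>.\<close>
  let ?J = "insert None (Some ` I')"
  define w where "w = (\<lambda>i t. case i of None \<Rightarrow> x t | Some k \<Rightarrow> g (e k t))"
  have wS: "(\<lambda>i. w i t) ` Some ` I' = ?v t ` I'" for t by (simp add: w_def image_comp o_def)
  have wi: "(\<lambda>i. w i t) ` ?J = insert (x t) (?v t ` I')" for t
    unfolding image_insert wS by (simp add: w_def)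
  have "famind ?J (\<lambda>i. w i t0)"
  proof -
    have xB: "x t0 \<notin> span B0" using x0 S spB by simp
    then have "independent (insert (x t0) B0)" using B0(2) by (intro independent_insertI)
    moreover have "inj_on (\<lambda>i. w i t0) ?J"
      using I'(2) xB span_base[of _ B0] unfolding I'(3) by (auto simp: inj_on_def w_def) (metis imageI)+
    ultimately show ?thesis using finI' I'(3) wi by (simp add: famind_iff)
  qed
  moreover have "regular C (w i)" if "i \<in> ?J" for i
  proof (cases i)
    case None then have "w i = x" by (simp add: w_def)
    then show ?thesis using reg(2) by simp
  next
    case (Some k)
    then have "k \<in> I" using that I'(1) by auto
    moreover have "w i = (\<lambda>t. g (e k t))" using Some by (simp add: w_def)
    ultimately show ?thesis using regular_lin[OF lin reg(1)] by simp
  qed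
  ultimately obtain p where p: "p \<in> poly_funs C" "p t0 \<noteq> 0" "\<And>t. p t \<noteq> 0 \<Longrightarrow> famind ?J (\<lambda>i. w i t)"
    using famind_generic[of ?J C w t0] finI' by blast
  have "x t \<notin> g ` span ((\<lambda>k. e k t) ` I)"
    if t: "p t \<noteq> 0" "dim (g ` span ((\<lambda>k. e k t) ` I)) = dim (g ` span ((\<lambda>k. e k t0) ` I))" for t
  proof -
    have fam: "inj_on (\<lambda>i. w i t) ?J" "independent (insert (x t) (?v t ` I'))"
      using p(3)[OF t(1)] finI' wi by (auto simp: famind_iff)
    have inj: "inj_on (?v t) I'" using fam(1) by (auto simp: inj_on_def w_def)
    have ind: "independent (?v t ` I')" by (rule independent_mono[OF fam(2)]) auto
    have xn: "x t \<notin> ?v t ` I'" using fam(1) by (force simp: inj_on_def w_def)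
    have "dim (span (?v t ` I')) = card I'" using ind inj by (simp add: dim_eq_card_independent card_image)
    also have "\<dots> = dim (span B0)" using B0(2) I' by (simp add: dim_eq_card_independent card_image)
    also have "\<dots> = dim (span (?v t ` I))" using spB t(2) unfolding S by simp
    finally have "span (?v t ` I') = span (?v t ` I)"
      using I'(1) by (intro subspace_dim_equal span_mono) auto
    moreover have "x t \<notin> span (?v t ` I')"
      using fam(2) xn by (auto simp: dependent_def insert_Diff_if)
    ultimately show ?thesis using S by simp
  qed
  then show ?thesis using p(1,2) by blast
qed

end


section \<open>Lifting with a deformed nilpotent map and conjugating back\<close>

context fd_flag_space
begin

lemma funpow_cong_on:
  assumes "\<eta> ` H \<subseteq> H" "\<And>x. x \<in> H \<Longrightarrow> \<theta> x = \<eta> x" "x \<in> H"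
  shows "(\<theta> ^^ k) x = (\<eta> ^^ k) x"
  by (induction k) (simp_all add: assms(2) funpow_stable[OF assms(1,3)])

lemma FL_cong_map:
  assumes "f \<in> FL \<eta> V M q" "\<And>x. x \<in> V \<Longrightarrow> \<theta> x = \<eta> x"
  shows "f \<in> FL \<theta> V M q"
proof -
  have "JT \<theta> (f j) (q j)" if "j \<le> M" for j
  proof (rule JT_cong[OF FL_JT[OF assms(1) that]])
    fix x assume "x \<in> f j"
    then show "\<theta> x = \<eta> x" using assms(2) FL_mono[OF assms(1) that] FL_top[OF assms(1)] by auto
  qed
  then show ?thesis using assms(1) by (auto simp: FL_def)
qed

text \<open>Members up to \<open>j0\<close> stay inside \<open>H\<close> and later ones receive
  \<open>v\<close>; the resulting flag is stable under \<theta> and is carried to \<eta> by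
  \<open>G\<close>.\<close>

lemma FL_extend:
  assumes lin: "lin \<theta>" "lin \<eta>" and iso: "iso \<theta> V \<eta> V G" and j0: "j0 < M"
    and h: "h \<in> FL \<theta> H M q'" and HV: "H \<subseteq> V" and V: "span (insert v H) = V"
    and q: "\<And>j. j \<le> j0 \<Longrightarrow> q j = q' j"
    and W: "\<And>j. Suc j0 \<le> j \<Longrightarrow> j \<le> M \<Longrightarrow> JT \<theta> (span (insert v (h j))) (q j)"
  shows "(\<lambda>j. G ` (if j \<le> j0 then h j else span (insert v (h j)))) \<in> FL \<eta> V M q"
proof -
  define w where "w = (\<lambda>j. if j \<le> j0 then h j else span (insert v (h j)))"
  have "w \<in> FL \<theta> V M q"
    unfolding FL_def mem_Collect_eq
  proof (intro conjI allI impI)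
    show "w M = V" using j0 FL_top[OF h] V by (simp add: w_def)
    fix j assume "j \<le> M"
    then show "JT \<theta> (w j) (q j)" using FL_JT[OF h] q W by (simp add: w_def)
  next
    fix j assume "j < M"
    then have hh: "h j \<subseteq> h (Suc j)" using FL_mono[OF h, of j "Suc j"] by simp
    also have "h (Suc j) \<subseteq> span (insert v (h (Suc j)))" by (auto intro: span_base)
    finally have "h j \<subseteq> span (insert v (h (Suc j)))" .
    moreover have "span (insert v (h j)) \<subseteq> span (insert v (h (Suc j)))" using hh by (intro span_mono) auto
    ultimately show "w j \<subseteq> w (Suc j)" using hh by (auto simp: w_def)
  qed
  from FL_image[OF iso this order_refl] iso show ?thesis by (simp add: w_def iso_def)
qed

lemma iso_Int_ker_dim:
  assumes lin: "lin \<theta>" "lin \<eta>" and iso: "iso \<theta> V \<eta> V2 G" and sV: "subspace V" "\<theta> ` V \<subseteq> V"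
    and A: "subspace A" "A \<subseteq> V" and B: "subspace B" "B \<subseteq> V"
  shows "dim (ker_pow \<eta> k \<inter> G ` A \<inter> G ` B) = dim (ker_pow \<theta> k \<inter> A \<inter> B)"
proof -
  have G: "lin G" "inj_on G V" "\<And>x. x \<in> V \<Longrightarrow> G (\<theta> x) = \<eta> (G x)" using iso by (auto simp: iso_def)
  have kp: "G x \<in> ker_pow \<eta> k \<longleftrightarrow> x \<in> ker_pow \<theta> k" if x: "x \<in> V" for x
  proof -
    have "G ((\<theta> ^^ k) x) = (\<eta> ^^ k) (G x)"
      using intertwine_funpow[of \<theta> V G \<eta> x k] sV(2) G(3) x by blast
    moreover have "(\<theta> ^^ k) x \<in> V" by (rule funpow_stable[OF sV(2) x])
    then have "G ((\<theta> ^^ k) x) = 0 \<longleftrightarrow> (\<theta> ^^ k) x = 0"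
      using G(2) endo.linear_inj_on_iff_eq_0[OF G(1) sV(1)] endo.linear_0[OF G(1)] by auto
    ultimately show ?thesis by (simp add: ker_pow_def)
  qed
  have "G ` A \<inter> G ` B = G ` (A \<inter> B)" by (rule inj_on_image_Int[OF G(2) A(2) B(2), symmetric])
  then have "ker_pow \<eta> k \<inter> G ` A \<inter> G ` B = ker_pow \<eta> k \<inter> G ` (A \<inter> B)" by blast
  also have "\<dots> = G ` (ker_pow \<theta> k \<inter> A \<inter> B)" using kp A(2) by auto
  also have "dim \<dots> = dim (ker_pow \<theta> k \<inter> A \<inter> B)"
  proof (rule endo.dim_image_eq[OF G(1)])
    have "span (ker_pow \<theta> k \<inter> A \<inter> B) = ker_pow \<theta> k \<inter> A \<inter> B"
      by (subst span_eq_iff) (intro subspace_inter subspace_ker_pow lin A B)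
    moreover have "ker_pow \<theta> k \<inter> A \<inter> B \<subseteq> V" using A(2) by blast
    ultimately show "inj_on G (span (ker_pow \<theta> k \<inter> A \<inter> B))"
      using inj_on_subset[OF G(2)] by metis
  qed
  finally show ?thesis .
qed

lemma dim_image_pow_JT:
  assumes "lin \<eta>" "JT \<eta> A mu" "JT \<eta> B mu"
  shows "dim ((\<eta> ^^ s) ` A) = dim ((\<eta> ^^ s) ` B)"
proof -
  obtain G where iso: "iso \<eta> A \<eta> B G" by (rule iso_of_JT[OF assms(2,3,1,1)])
  then have G: "lin G" "inj_on G A" "G ` A = B" "\<And>x. x \<in> A \<Longrightarrow> G (\<eta> x) = \<eta> (G x)" by (auto simp: iso_def)
  note st = JT_stable[OF assms(2,1)]
  have sub: "(\<eta> ^^ s) ` A \<subseteq> A" using funpow_stable[OF st] by blast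
  have "(\<eta> ^^ s) ` B = G ` ((\<eta> ^^ s) ` A)"
    unfolding G(3)[symmetric] image_comp
    using intertwine_funpow[OF st, of G \<eta> _ s] G(4) by (intro image_cong) auto
  also have "dim \<dots> = dim ((\<eta> ^^ s) ` A)"
  proof (rule endo.dim_image_eq[OF G(1)])
    have "subspace ((\<eta> ^^ s) ` A)"
      by (rule endo.linear_subspace_image[OF lin_funpow[OF assms(1)] JT_subspace[OF assms(2)]])
    then have "span ((\<eta> ^^ s) ` A) = (\<eta> ^^ s) ` A" by (simp only: span_eq_iff)
    then show "inj_on G (span ((\<eta> ^^ s) ` A))" using inj_on_subset[OF G(2) sub] by metis
  qed
  finally show ?thesis by simp
qed

text \<open>The lifted flag ends in \<open>V\<close>, so on \<open>V\<close> the map \<theta> has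
  the same type \<open>q M\<close> as \<eta>, and an isomorphism preserving \<open>H\<close>
  conjugates the lifted pair back. Intersections with members of the first flag are unchanged: these
  members lie in \<open>H\<close>, where adjoining \<open>v\<close> to \<open>h' j\<close> gives
  nothing new and \<theta> equals \<eta>.\<close>

lemma lift_pair:
  assumes lin: "lin \<eta>" "lin \<theta>" and \<theta>: "\<And>x. x \<in> H \<Longrightarrow> \<theta> x = \<eta> x"
    and JH: "JT \<eta> H (p N)" and JV: "JT \<eta> V (p (Suc N))" "JT \<eta> V (q M)" and HV: "H \<subseteq> V"
    and dV: "dim V = Suc (dim H)" and v: "v \<in> V" "v \<notin> H"
    and h: "h \<in> FL \<eta> H N p" and h': "h' \<in> FL \<eta> H M q'"
    and sq: "\<forall>j<M. rs_square (q' j) (q' (Suc j)) (q j) (q (Suc j))"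
    and j0: "j0 < M" and eq: "\<And>j. j \<le> j0 \<Longrightarrow> q j = q' j"
    and r: "\<forall>j. j0 < j \<and> j \<le> M \<longrightarrow> q j = (q' j)(r j := Suc (q' j (r j))) \<and> is_partition (q j)"
    and u: "\<theta> v \<in> h' j0"
    and gen: "\<forall>j. j0 < j \<and> j \<le> M \<longrightarrow> (\<forall>y\<in>h' j. (\<theta> ^^ (q' j (r j))) (v + y) \<noteq> 0)"
  obtains g g' where "g \<in> FL \<eta> V (Suc N) p" "g' \<in> FL \<eta> V M q"
    "\<And>i j k. i \<le> N \<Longrightarrow> j \<le> M \<Longrightarrow> dim (ker_pow \<eta> k \<inter> g i \<inter> g' j) = dim (ker_pow \<eta> k \<inter> h i \<inter> h' j)"
proof -
  have sH: "subspace H" and sV: "subspace V" using JT_subspace[OF JH] JT_subspace[OF JV(1)] .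
  have spV: "span (insert v H) = V" by (rule hyperplane_decomp(1)[OF sH sV HV dV v])
  have h\<theta>: "h \<in> FL \<theta> H N p" "h' \<in> FL \<theta> H M q'"
    using FL_cong_map[OF h \<theta>] FL_cong_map[OF h' \<theta>] by auto
  have W: "JT \<theta> (span (insert v (h' j))) (q j)" if "Suc j0 \<le> j" "j \<le> M" for j
    by (rule lift_types[OF lin(2) h\<theta>(2) v(2) sq j0 eq[OF order_refl] r u gen that])
  have JV\<theta>: "JT \<theta> V (q M)" using W[of M] j0 FL_top[OF h'] spV by simp
  have JH\<theta>: "JT \<theta> H (p N)" by (rule JT_cong[OF JH \<theta>])
  obtain G where G: "iso \<theta> V \<eta> V G" "G ` H = H"
    by (rule iso_of_hyperplanes[OF lin(2,1) JH\<theta> JV\<theta> HV dV JH JV(2) HV])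
  define g' where "g' = (\<lambda>j. G ` (if j \<le> j0 then h' j else span (insert v (h' j))))"
  have g': "g' \<in> FL \<eta> V M q" unfolding g'_def
    using FL_extend[OF lin(2,1) G(1) j0 h\<theta>(2) HV spV] eq W by blast
  define g where "g = (\<lambda>i. if i \<le> N then G ` h i else V)"
  have gN: "(\<lambda>i. G ` h i) \<in> FL \<eta> H N p" using FL_image[OF G(1) h\<theta>(1) HV] G(2) by simp
  have g: "g \<in> FL \<eta> V (Suc N) p"
    unfolding FL_def mem_Collect_eq
  proof (intro conjI allI impI)
    show "g (Suc N) = V" by (simp add: g_def)
    fix i assume "i \<le> Suc N"
    then show "JT \<eta> (g i) (p i)" using FL_JT[OF gN, of i] JV(1) by (cases "i = Suc N") (auto simp: g_def)
  next
    fix i assume i: "i < Suc N"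
    show "g i \<subseteq> g (Suc i)"
      using FL_mono[OF gN, of i "Suc i"] FL_mono[OF gN, of i N] FL_top[OF gN] HV i by (auto simp: g_def)
  qed
  have "dim (ker_pow \<eta> k \<inter> g i \<inter> g' j) = dim (ker_pow \<eta> k \<inter> h i \<inter> h' j)" if ij: "i \<le> N" "j \<le> M" for i j k
  proof -
    define B where "B = (if j \<le> j0 then h' j else span (insert v (h' j)))"
    have hi: "subspace (h i)" "h i \<subseteq> H"
      using JT_subspace[OF FL_JT[OF h ij(1)]] FL_mono[OF h ij(1)] FL_top[OF h] by auto
    have hj: "subspace (h' j)" "h' j \<subseteq> H"
      using JT_subspace[OF FL_JT[OF h' ij(2)]] FL_mono[OF h' ij(2)] FL_top[OF h'] by auto
    have "span (insert v (h' j)) \<subseteq> span (insert v H)" using hj by (intro span_mono) auto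
    then have B: "subspace B" "B \<subseteq> V" "B \<inter> H = h' j"
      using hj HV spV insert_span_Int[OF sH v(2) hj] by (auto simp: B_def)
    have st: "\<theta> ` V \<subseteq> V" by (rule JT_stable[OF JV\<theta> lin(2)])
    have "dim (ker_pow \<eta> k \<inter> g i \<inter> g' j) = dim (ker_pow \<theta> k \<inter> h i \<inter> B)"
      using iso_Int_ker_dim[OF lin(2,1) G(1) sV st hi(1) _ B(1,2)] hi(2) HV ij(1)
      by (simp add: g_def g'_def B_def)
    also have "ker_pow \<theta> k \<inter> h i \<inter> B = ker_pow \<theta> k \<inter> h i \<inter> h' j" using B(3) hi(2) by blast
    also have "\<dots> = ker_pow \<eta> k \<inter> h i \<inter> h' j"
    proof -
      have "(\<theta> ^^ k) x = (\<eta> ^^ k) x" if "x \<in> H" for x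
        using funpow_cong_on[of \<eta> H \<theta> x k] JT_stable[OF JH lin(1)] \<theta> that by blast
      then have "x \<in> ker_pow \<theta> k \<longleftrightarrow> x \<in> ker_pow \<eta> k" if "x \<in> H" for x using that by (simp add: ker_pow_def)
      then show ?thesis using hi(2) by blast
    qed
    finally show ?thesis .
  qed
  then show thesis using that g g' by blast
qed

text \<open>Two generic conditions are imposed on one curve. The lift has to exist, which is tested
  at \<open>t = 0\<close>, the given pair of traces; the intersections must not exceed those at
  \<open>t = 1\<close>, the competing pair. Over an infinite field some \<open>t\<close> meets both,
  and minimality of \<open>(f, f')\<close> is applied to the lift at this \<open>t\<close>.\<close>

lemma minimal_pair_restrict:
  assumes inf: "infinite (UNIV :: 'a set)" and lin: "lin \<eta>"
    and min: "minimal_pair \<eta> V (Suc N) p M q f f'"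
    and stepp: "\<forall>i<Suc N. psize (p (Suc i)) \<le> Suc (psize (p i))"
    and stepq: "\<forall>j<M. psize (q (Suc j)) \<le> Suc (psize (q j))" and q0: "psize (q 0) = 0"
    and dV: "dim V = Suc (dim (f N))"
    and q': "\<And>j. j \<le> M \<Longrightarrow> JT \<eta> (f' j \<inter> f N) (q' j)"
    and sq: "\<forall>j<M. rs_square (q' j) (q' (Suc j)) (q j) (q (Suc j))"
  shows "minimal_pair \<eta> (f N) N p M q' f (\<lambda>j. f' j \<inter> f N)"
proof -
  define H where "H = f N"
  have f: "f \<in> FL \<eta> V (Suc N) p" and f': "f' \<in> FL \<eta> V M q" using min by (auto simp: minimal_pair_def)
  have JH: "JT \<eta> H (p N)" and JV: "JT \<eta> V (p (Suc N))" "JT \<eta> V (q M)" and HV: "H \<subseteq> V"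
    using FL_JT[OF f] FL_mono[OF f, of N "Suc N"] FL_top[OF f] FL_JT[OF f', of M] FL_top[OF f']
    by (auto simp: H_def)
  note dV' = dV[folded H_def]
  have sH: "subspace H" and sV: "subspace V" using JT_subspace[OF JH] JT_subspace[OF JV(1)] .
  have fN: "f \<in> FL \<eta> H N p" using FL_restrict[OF f, of N] by (simp add: H_def)
  have f'H: "(\<lambda>j. f' j \<inter> H) \<in> FL \<eta> H M q'"
    unfolding FL_def mem_Collect_eq
  proof (intro conjI allI impI)
    show "f' M \<inter> H = H" using FL_top[OF f'] HV by auto
    show "j \<le> M \<Longrightarrow> JT \<eta> (f' j \<inter> H) (q' j)" for j using q' by (simp add: H_def)
    show "j < M \<Longrightarrow> f' j \<inter> H \<subseteq> f' (Suc j) \<inter> H" for j using FL_mono[OF f', of j "Suc j"] by auto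
  qed
  have stepq': "\<forall>j<M. psize (q' (Suc j)) \<le> Suc (psize (q' j))"
    using rs_square_psize sq stepq by blast
  have "dim (ker_pow \<eta> k \<inter> f i \<inter> (f' j \<inter> H)) \<le> dim (ker_pow \<eta> k \<inter> g i \<inter> g' j)"
    if g: "g \<in> FL \<eta> H N p" and g': "g' \<in> FL \<eta> H M q'" and i: "i \<le> N" and j: "j \<le> M" for g g' i j k
  proof -
    have "f' 0 \<subseteq> H"
    proof -
      have "dim (f' 0) = 0" using FL_dim[OF f', of 0] q0 by simp
      then have "f' 0 \<subseteq> {0}" by simp
      then show ?thesis using subspace_0[OF sH] by auto
    qed
    \<comment> \<open>\<open>j0 = j1 - 1\<close> will be the last index whose member lies in
      \<open>H\<close>; the vector \<open>v\<close> enters with member \<open>j1\<close>.\<close>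
    define j1 where "j1 = (LEAST j. \<not> f' j \<subseteq> H)"
    have "\<not> f' M \<subseteq> H" using FL_top[OF f'] HV dV' by auto
    then have j1: "\<not> f' j1 \<subseteq> H" "j1 \<le> M" unfolding j1_def by (rule LeastI, rule Least_le)
    have "j1 \<noteq> 0" using j1(1) \<open>f' 0 \<subseteq> H\<close> by metis
    then obtain j0 where j01: "j1 = Suc j0" by (cases j1) auto
    have j0: "j0 < M" using j1(2) j01 by simp
    have le: "f' j \<subseteq> H" if "j \<le> j0" for j
      using not_less_Least[of j "\<lambda>j. \<not> f' j \<subseteq> H"] that j01 unfolding j1_def[symmetric] by simp
    have gt: "\<not> f' j \<subseteq> H" if "j0 < j" "j \<le> M" for j
      using j1(1) j01 FL_mono[OF f', of "Suc j0" j] that by auto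
    obtain v where v: "v \<in> f' (Suc j0)" "v \<notin> H" using j1(1) j01 by auto
    have vV: "v \<in> V" using v(1) FL_mono[OF f', of "Suc j0" M] FL_top[OF f'] j0 by auto
    have q'eq: "q j = q' j" if "j \<le> j0" for j
    proof -
      have "f' j \<inter> H = f' j" using le[OF that] by auto
      then have "JT \<eta> (f' j) (q' j)" using q'[of j] that j0 by (simp add: H_def)
      then show ?thesis using JT_unique[OF FL_JT[OF f'] _ lin] that j0 by simp
    qed
    have hyp: "\<exists>r. q j = (q' j)(r := Suc (q' j r)) \<and> (\<forall>c. f' j \<inter> ker_pow \<eta> c \<subseteq> f' j \<inter> H \<longleftrightarrow> c \<le> q' j r)"
      if "j0 < j" "j \<le> M" for j
    proof -
      have Jj: "JT \<eta> (f' j) (q j)" by (rule FL_JT[OF f' that(2)])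
      have jV: "f' j \<subseteq> V" using FL_mono[OF f' that(2)] FL_top[OF f'] by simp
      have "dim (f' j) = Suc (dim (f' j \<inter> H))"
        by (rule dim_Int_hyperplane[OF sH sV HV dV' JT_subspace[OF Jj] jV gt[OF that]])
      from hyperplane_jordan[OF lin q'[OF that(2), folded H_def] Jj Int_lower1 this] show ?thesis by metis
    qed
    then have "\<forall>j. \<exists>r. j0 < j \<and> j \<le> M \<longrightarrow>
        q j = (q' j)(r := Suc (q' j r)) \<and> (\<forall>c. f' j \<inter> ker_pow \<eta> c \<subseteq> f' j \<inter> H \<longleftrightarrow> c \<le> q' j r)" by blast
    from choice[OF this] obtain r where r: "\<And>j. j0 < j \<Longrightarrow> j \<le> M \<Longrightarrow>
        q j = (q' j)(r j := Suc (q' j (r j))) \<and> (\<forall>c. f' j \<inter> ker_pow \<eta> c \<subseteq> f' j \<inter> H \<longleftrightarrow> c \<le> q' j (r j))"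
      by blast
    \<comment> \<open>The member leaves \<open>H\<close> while growing by at most one dimension, so
      its trace on \<open>H\<close> does not grow. This places \<open>\<eta> v\<close> in
      \<open>f' j0\<close>.\<close>
    have fj0: "f' j0 = f' (Suc j0) \<inter> H"
    proof (rule subspace_dim_equal)
      show "subspace (f' j0)" "subspace (f' (Suc j0) \<inter> H)"
        using JT_subspace[OF FL_JT[OF f']] sH j0 by (auto intro: subspace_inter)
      show "f' j0 \<subseteq> f' (Suc j0) \<inter> H" using le[of j0] FL_mono[OF f', of j0 "Suc j0"] j0 by auto
      show "dim (f' (Suc j0) \<inter> H) \<le> dim (f' j0)"
        using JT_dim[OF q'[of "Suc j0", folded H_def]] FL_dim[OF f', of j0] j0 q'eq[of j0]
          psize_add[OF is_partition_finite[OF JT_partition[OF q'[of "Suc j0"]]]] r[of "Suc j0"] stepq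
        by (metis Suc_le_mono Suc_leI le_refl lessI less_imp_le)
    qed
    have u0: "\<eta> v \<in> f' j0"
      unfolding fj0 using JT_hyperplane_image[OF lin JH JV(1) HV dV'] vV
        JT_stable[OF FL_JT[OF f', of "Suc j0"] lin] v(1) j0 by auto
    let ?S = "\<lambda>q e t j. span ((\<lambda>k. e k t) ` {..<psize (q j)})"
    obtain e E1 where e: "finite E1" "\<forall>k. regular {\<lambda>t. t} (e k)"
      "\<forall>t. t \<notin> E1 \<longrightarrow> ?S p e t \<in> FL \<eta> H N p" "\<forall>i\<le>N. ?S p e 0 i = f i \<and> ?S p e 1 i = g i"
      using flag_curve[OF lin _ fN g] stepp by auto
    obtain e' E2 where e': "finite E2" "\<forall>k. regular {\<lambda>t. t} (e' k)"
      "\<forall>t. t \<notin> E2 \<longrightarrow> ?S q' e' t \<in> FL \<eta> H M q'" "\<forall>j\<le>M. ?S q' e' 0 j = f' j \<inter> H \<and> ?S q' e' 1 j = g' j"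
      using flag_curve[OF lin stepq' f'H g'] by blast
    have "\<eta> v \<in> ?S q' e' 0 j0" using e'(4) j0 u0 le[of j0] by auto
    then obtain c where c: "\<eta> v = (\<Sum>k<psize (q' j0). c k *s e' k 0)"
      by (auto simp: span_image_sum)
    \<comment> \<open>The coefficients of \<open>\<eta> v\<close> are kept in the moving frame:
      \<open>u\<close> starts at \<open>\<eta> v\<close> and stays in the moving member
      \<open>j0\<close>.\<close>
    define u where "u = (\<lambda>t. \<Sum>k<psize (q' j0). c k *s e' k t)"
    have uS: "u t \<in> ?S q' e' t j0" for t unfolding u_def by (intro span_sum span_scale span_base) auto
    have ureg: "regular {\<lambda>t. t} u" unfolding u_def
      using e'(2) by (intro regular_sum regular_scale poly_funs.const) auto
    \<comment> \<open>With \<open>\<theta> v = u t\<close>, the vector in question is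
      \<open>(\<theta> ^^ Suc s) (v + y)\<close>. At \<open>t = 0\<close> it is nonzero for all
      \<open>y\<close>, because \<open>r j\<close> is the row in which the type of
      \<open>f' j\<close> exceeds that of its trace. Types are constant along the curve, so the
      dimensions of the images are constant and \<open>notin_image_generic\<close> applies.\<close>
    have bad: "\<exists>B. finite B \<and> (\<forall>t. t \<notin> B \<and> t \<notin> E2 \<longrightarrow> (\<forall>y\<in>?S q' e' t j.
        \<forall>s. q' j (r j) = Suc s \<longrightarrow> (\<eta> ^^ s) (u t) + (\<eta> ^^ Suc s) y \<noteq> 0))" if j: "j0 < j" "j \<le> M" for j
    proof (cases "q' j (r j)")
      case 0 then show ?thesis by (intro exI[of _ "{}"]) simp
    next
      case (Suc s)
      let ?A = "\<lambda>t. (\<eta> ^^ Suc s) ` ?S q' e' t j"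
      have ls: "lin (\<eta> ^^ s)" "lin (\<eta> ^^ Suc s)" by (rule lin_funpow[OF lin])+
      have "(\<eta> ^^ s) (u 0) \<notin> ?A 0"
      proof
        assume "(\<eta> ^^ s) (u 0) \<in> ?A 0"
        then obtain y where y: "y \<in> f' j \<inter> H" "(\<eta> ^^ s) (u 0) = (\<eta> ^^ Suc s) y" using e'(4) j by auto
        have "(\<eta> ^^ Suc s) (v - y) = (\<eta> ^^ s) (\<eta> v) - (\<eta> ^^ Suc s) y"
          by (simp add: lin_simps[OF ls(2)] funpow_swap1 del: funpow.simps) (simp add: funpow_swap1)
        also have "\<dots> = 0" using y(2) c by (simp add: u_def)
        finally have "v - y \<in> ker_pow \<eta> (q' j (r j))" using Suc by (simp add: ker_pow_def)
        moreover have "v \<in> f' j" using v(1) FL_mono[OF f', of "Suc j0" j] j by auto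
        then have "v - y \<in> f' j" using y(1) JT_subspace[OF FL_JT[OF f' j(2)]] by (auto intro: subspace_diff)
        ultimately have "v - y \<in> H" using r[OF j] by blast
        then have "v - y + y \<in> H" using y(1) by (intro subspace_add[OF sH]) auto
        then show False using v(2) by simp
      qed
      then have "\<exists>P\<in>poly_funs {\<lambda>t. t}. P 0 \<noteq> 0 \<and>
          (\<forall>t. P t \<noteq> 0 \<and> dim (?A t) = dim (?A 0) \<longrightarrow> (\<eta> ^^ s) (u t) \<notin> ?A t)"
        using e'(2) by (intro notin_image_generic[of "\<eta> ^^ Suc s" "{..<psize (q' j)}" "{\<lambda>t. t}" e'
              "\<lambda>t. (\<eta> ^^ s) (u t)" 0] ls regular_lin[OF ls(1) ureg]) auto
      then obtain P where P: "P \<in> poly_funs {\<lambda>t. t}" "P 0 \<noteq> 0"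
        "\<And>t. P t \<noteq> 0 \<Longrightarrow> dim (?A t) = dim (?A 0) \<Longrightarrow> (\<eta> ^^ s) (u t) \<notin> ?A t" by blast
      have "(\<eta> ^^ s) (u t) + (\<eta> ^^ Suc s) y \<noteq> 0" if t: "P t \<noteq> 0" "t \<notin> E2" and y: "y \<in> ?S q' e' t j" for t y
      proof
        assume a: "(\<eta> ^^ s) (u t) + (\<eta> ^^ Suc s) y = 0"
        have "JT \<eta> (?S q' e' t j) (q' j)" "JT \<eta> (?S q' e' 0 j) (q' j)"
          using e'(3,4) t(2) FL_JT[of "?S q' e' t" \<eta> H M q' j] q'[OF j(2)] j by (auto simp: H_def)
        then have "dim (?A t) = dim (?A 0)" by (rule dim_image_pow_JT[OF lin])
        then have nin: "(\<eta> ^^ s) (u t) \<notin> ?A t" by (rule P(3)[OF t(1)])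
        have "(\<eta> ^^ s) (u t) = (\<eta> ^^ Suc s) (- y)"
          using a by (simp add: lin_simps[OF ls(2)] eq_neg_iff_add_eq_0 del: funpow.simps)
        moreover have "- y \<in> ?S q' e' t j" using y by (rule span_neg)
        ultimately show False using nin by blast
      qed
      then show ?thesis using poly_funs_finite_zeros[OF P(1,2)] Suc
        by (intro exI[of _ "{t. P t = 0}"]) auto
    qed
    then have "\<forall>j. \<exists>B. j0 < j \<and> j \<le> M \<longrightarrow> finite B \<and> (\<forall>t. t \<notin> B \<and> t \<notin> E2 \<longrightarrow> (\<forall>y\<in>?S q' e' t j.
        \<forall>s. q' j (r j) = Suc s \<longrightarrow> (\<eta> ^^ s) (u t) + (\<eta> ^^ Suc s) y \<noteq> 0))" by blast
    from choice[OF this] obtain Bad where Bad0: "\<forall>j. j0 < j \<and> j \<le> M \<longrightarrow> finite (Bad j) \<and>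
        (\<forall>t. t \<notin> Bad j \<and> t \<notin> E2 \<longrightarrow> (\<forall>y\<in>?S q' e' t j.
        \<forall>s. q' j (r j) = Suc s \<longrightarrow> (\<eta> ^^ s) (u t) + (\<eta> ^^ Suc s) y \<noteq> 0))" ..
    have Bad: "finite (Bad j)" if "j0 < j" "j \<le> M" for j using Bad0 that by blast
    have Bad2: "(\<eta> ^^ s) (u t) + (\<eta> ^^ Suc s) y \<noteq> 0"
      if "j0 < j" "j \<le> M" "t \<notin> Bad j" "t \<notin> E2" "y \<in> ?S q' e' t j" "q' j (r j) = Suc s" for j t y s
      using Bad0[THEN spec, of j] that by blast
    have fam1: "famind {..<psize (p i)} (\<lambda>k. e k 1)"
    proof (rule famind_if_dim)
      have "dim ((\<lambda>k. e k 1) ` {..<psize (p i)}) = dim (g i)" using e(4) i by (metis dim_span)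
      then show "card {..<psize (p i)} \<le> dim ((\<lambda>k. e k 1) ` {..<psize (p i)})" using FL_dim[OF g i] by simp
    qed simp
    have fam2: "famind {..<psize (q' j)} (\<lambda>k. e' k 1)"
    proof (rule famind_if_dim)
      have "dim ((\<lambda>k. e' k 1) ` {..<psize (q' j)}) = dim (g' j)" using e'(4) j by (metis dim_span)
      then show "card {..<psize (q' j)} \<le> dim ((\<lambda>k. e' k 1) ` {..<psize (q' j)})" using FL_dim[OF g' j] by simp
    qed simp
    \<comment> \<open>Semicontinuity at the other end of the curves, where the pair is
      \<open>(g, g')\<close>.\<close>
    have "\<exists>P\<in>poly_funs {\<lambda>t. t}. P 1 \<noteq> 0 \<and> (\<forall>t. P t \<noteq> 0 \<longrightarrow>
       dim (ker_pow \<eta> k \<inter> ?S p e t i \<inter> ?S q' e' t j) \<le> dim (ker_pow \<eta> k \<inter> ?S p e 1 i \<inter> ?S q' e' 1 j))"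
      by (rule dim_Int_generic[where I="{..<psize (p i)}" and J="{..<psize (q' j)}" and e=e and e'=e' and ?x0.0=1])
        (use e(2) e'(2) fam1 fam2 subspace_ker_pow[OF lin] in auto)
    then obtain P where P: "P \<in> poly_funs {\<lambda>t. t}" "P 1 \<noteq> 0"
      "\<And>t. P t \<noteq> 0 \<Longrightarrow> dim (ker_pow \<eta> k \<inter> ?S p e t i \<inter> ?S q' e' t j) \<le> dim (ker_pow \<eta> k \<inter> g i \<inter> g' j)"
      using e(4) e'(4) i j by auto
    have "finite (E1 \<union> E2 \<union> {t. P t = 0} \<union> (\<Union>j\<in>{j0<..M}. Bad j))"
      using e(1) e'(1) poly_funs_finite_zeros[OF P(1,2)] Bad by auto
    from ex_new_if_finite[OF inf this]
    obtain t where t: "t \<notin> E1 \<union> E2 \<union> {t. P t = 0} \<union> (\<Union>j\<in>{j0<..M}. Bad j)" ..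
    have "\<exists>\<chi>. fnl \<chi> \<and> (\<forall>y\<in>H. \<chi> y = 0) \<and> \<chi> v = 1"
      by (rule separating_functional[OF sH v(2)]) blast
    then obtain \<chi> where \<chi>: "fnl \<chi>" "\<And>y. y \<in> H \<Longrightarrow> \<chi> y = 0" "\<chi> v = 1" by blast
    define \<theta> where "\<theta> = (\<lambda>x. \<eta> x + \<chi> x *s (u t - \<eta> v))"
    have lin\<theta>: "lin \<theta>" unfolding \<theta>_def
      by (rule linI) (simp_all add: lin_simps[OF lin] fnl_simps[OF \<chi>(1)] scale_left_distrib scale_right_distrib algebra_simps)
    have \<theta>H: "\<theta> x = \<eta> x" if "x \<in> H" for x using \<chi>(2)[OF that] by (simp add: \<theta>_def)
    have \<theta>v: "\<theta> v = u t" using \<chi>(3) by (simp add: \<theta>_def)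
    have h: "?S p e t \<in> FL \<eta> H N p" and h': "?S q' e' t \<in> FL \<eta> H M q'" using e(3) e'(3) t by auto
    have gen: "(\<theta> ^^ (q' j (r j))) (v + y) \<noteq> 0" if j: "j0 < j" "j \<le> M" and y: "y \<in> ?S q' e' t j" for j y
    proof (cases "q' j (r j)")
      case 0
      have "y \<in> H" using y FL_mono[OF h' j(2)] FL_top[OF h'] by auto
      have "v + y \<noteq> 0"
      proof
        assume "v + y = 0"
        then have "v = - y" by (simp add: eq_neg_iff_add_eq_0)
        then show False using v(2) subspace_neg[OF sH \<open>y \<in> H\<close>] by simp
      qed
      then show ?thesis using 0 by simp
    next
      case (Suc s)
      have yH: "y \<in> H" using y FL_mono[OF h' j(2)] FL_top[OF h'] by auto
      have uH: "u t \<in> H" using uS[of t] FL_mono[OF h', of j0 M] FL_top[OF h'] j0 by auto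
      have st: "\<eta> ` H \<subseteq> H" by (rule JT_stable[OF JH lin])
      have pow: "(\<theta> ^^ k) x = (\<eta> ^^ k) x" if "x \<in> H" for x k
        using funpow_cong_on[of \<eta> H \<theta> x k] st \<theta>H that by blast
      have "(\<theta> ^^ Suc s) (v + y) = (\<theta> ^^ s) (\<theta> (v + y))" by (simp add: funpow_swap1)
      also have "\<theta> (v + y) = u t + \<eta> y" using \<theta>v \<theta>H[OF yH] by (simp add: lin_simps[OF lin\<theta>])
      also have "(\<theta> ^^ s) (u t + \<eta> y) = (\<eta> ^^ s) (u t + \<eta> y)"
        using uH yH st by (intro pow subspace_add[OF sH]) auto
      also have "\<dots> = (\<eta> ^^ s) (u t) + (\<eta> ^^ Suc s) y"
        by (simp add: lin_simps[OF lin_funpow[OF lin]] funpow_swap1)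
      finally have eq: "(\<theta> ^^ Suc s) (v + y) = (\<eta> ^^ s) (u t) + (\<eta> ^^ Suc s) y" .
      have "t \<notin> Bad j" "t \<notin> E2" using t j by auto
      from Bad2[OF j this y Suc] show ?thesis unfolding Suc eq .
    qed
    have r': "\<forall>j. j0 < j \<and> j \<le> M \<longrightarrow> q j = (q' j)(r j := Suc (q' j (r j))) \<and> is_partition (q j)"
      using r JT_partition[OF FL_JT[OF f']] by blast
    have u': "\<theta> v \<in> ?S q' e' t j0" unfolding \<theta>v by (rule uS)
    have gen': "\<forall>j. j0 < j \<and> j \<le> M \<longrightarrow> (\<forall>y\<in>?S q' e' t j. (\<theta> ^^ (q' j (r j))) (v + y) \<noteq> 0)"
      using gen by blast
    obtain G G' where GG: "G \<in> FL \<eta> V (Suc N) p" "G' \<in> FL \<eta> V M q"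
      "\<And>i j k. i \<le> N \<Longrightarrow> j \<le> M \<Longrightarrow> dim (ker_pow \<eta> k \<inter> G i \<inter> G' j) = dim (ker_pow \<eta> k \<inter> ?S p e t i \<inter> ?S q' e' t j)"
      using lift_pair[OF lin lin\<theta> \<theta>H JH JV HV dV' vV v(2) h h' sq j0 q'eq r' u' gen'] by blast
    have "f i \<subseteq> H" using FL_mono[OF fN i] FL_top[OF fN] by simp
    then have "ker_pow \<eta> k \<inter> f i \<inter> (f' j \<inter> H) = ker_pow \<eta> k \<inter> f i \<inter> f' j" by auto
    also have "dim \<dots> \<le> dim (ker_pow \<eta> k \<inter> G i \<inter> G' j)"
      using min GG(1,2) i j unfolding minimal_pair_def by (meson le_SucI)
    also have "\<dots> \<le> dim (ker_pow \<eta> k \<inter> g i \<inter> g' j)" unfolding GG(3)[OF i j] by (rule P(3)) (use t in auto)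
    finally show ?thesis .
  qed
  then show ?thesis unfolding minimal_pair_def H_def[symmetric] using fN f'H by blast
qed

end


section \<open>Growth diagrams and row insertion\<close>

definition add_box :: "nat \<Rightarrow> (nat \<Rightarrow> nat) \<Rightarrow> nat \<Rightarrow> nat" where
  "add_box r mu = mu(r := Suc (mu r))"

lemma add_box_apply: "add_box r mu i = (if i = r then Suc (mu r) else mu i)"
  by (simp add: add_box_def)

lemmas young_add_box = young_add[folded add_box_def]
lemmas pprec_add_box = pprec_add[folded add_box_def]

lemma finite_add_box: "finite {i. mu i \<noteq> 0} \<Longrightarrow> finite {i. add_box r mu i \<noteq> 0}"
  unfolding add_box_def by (rule finite_support_add)

text \<open>If \<open>(r, j)\<close> is the new square then \<open>(r, mu r)\<close> is new as well,
  so \<open>j = mu r\<close>.\<close>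

lemma pprec_imp_add_box:
  assumes "mu \<prec> lam" "finite {i. mu i \<noteq> 0}" "finite {i. lam i \<noteq> 0}"
  obtains r where "lam = add_box r mu"
proof -
  note f = finite_young[OF assms(2)] finite_young[OF assms(3)]
  have sub: "young mu \<subseteq> young lam" and c: "card (young lam) = Suc (card (young mu))"
    using assms card_young[OF assms(2)] card_young[OF assms(3)] by (auto simp: pprec_def)
  then have "card (young lam - young mu) = 1" using card_Diff_subset[OF f(1) sub] by simp
  then obtain p where p: "young lam - young mu = {p}" by (auto simp: card_1_singleton_iff)
  obtain r j where rj: "p = (r, j)" by (cases p)
  have "(r, j) \<in> young lam - young mu" using p rj by simp
  then have 1: "j < lam r" "mu r \<le> j" by (auto simp: mem_young)
  then have "(r, mu r) \<in> young lam - young mu" by (auto simp: mem_young)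
  then have "j = mu r" using p rj by simp
  then have "young lam = young (add_box r mu)" unfolding young_add_box using p rj sub by blast
  then show thesis using that young_inject by blast
qed

lemma add_box_inject: "add_box r mu = add_box s mu \<Longrightarrow> r = s"
  by (metis add_box_apply n_not_Suc_n)

lemma add_box_cancel: "add_box r mu = add_box r nu \<Longrightarrow> mu = nu"
proof
  fix x assume "add_box r mu = add_box r nu"
  then show "mu x = nu x" by (metis add_box_apply nat.inject)
qed

text \<open>Dual to \<open>pprec_join_unique\<close>: by counting squares,
  \<open>young nu = young mu \<inter> young mu'\<close>.\<close>

lemma pprec_meet_unique:
  assumes "mu \<noteq> mu'" "finite {i. mu i \<noteq> 0}" "finite {i. mu' i \<noteq> 0}"
    "finite {i. nu i \<noteq> 0}" "finite {i. nu' i \<noteq> 0}"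
    "nu \<prec> mu" "nu \<prec> mu'" "nu' \<prec> mu" "nu' \<prec> mu'"
  shows "nu = nu'"
proof -
  have "young nu = young mu \<inter> young mu'" if "finite {i. nu i \<noteq> 0}" "nu \<prec> mu" "nu \<prec> mu'" for nu
  proof -
    have c: "card (young mu) = Suc (card (young nu))" "card (young mu') = Suc (card (young nu))"
      using that card_young[OF assms(2)] card_young[OF assms(3)] card_young[OF that(1)]
      by (auto simp: pprec_def)
    note fm = finite_young[OF assms(2)] finite_young[OF assms(3)]
    have "young mu \<noteq> young mu'" using assms(1) young_inject by blast
    then have "\<not> young mu \<subseteq> young mu'" using card_subset_eq[OF fm(2)] c by auto
    then have "young mu \<inter> young mu' \<subset> young mu" by blast
    then have "card (young mu \<inter> young mu') < card (young mu)" using fm by (intro psubset_card_mono)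
    moreover have "young nu \<subseteq> young mu \<inter> young mu'" using that by (auto simp: pprec_def)
    ultimately show ?thesis using c card_seteq[of "young mu \<inter> young mu'" "young nu"] fm by auto
  qed
  from this[OF assms(4,6,7)] this[OF assms(5,8,9)] show ?thesis using young_inject by simp
qed

lemma RS2_unique:
  assumes "RS2 nu mu mu lam" "finite {i. mu i \<noteq> 0}" "finite {i. nu i \<noteq> 0}" "finite {i. lam i \<noteq> 0}"
  obtains i where "mu = add_box i nu" "lam = add_box (Suc i) mu"
proof -
  obtain i where i: "mu (i + 1) + 1 = lam (i + 1)" "nu i + 1 = mu i" and p: "nu \<prec> mu" "mu \<prec> lam"
    using assms(1) by (auto simp: RS2_def)
  obtain r where r: "mu = add_box r nu" using pprec_imp_add_box[OF p(1) assms(3,2)] by blast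
  obtain s where s: "lam = add_box s mu" using pprec_imp_add_box[OF p(2) assms(2,4)] by blast
  have "r = i"
  proof (rule ccontr)
    assume "r \<noteq> i"
    then have "mu i = nu i" using r by (simp add: add_box_apply)
    then show False using i(2) by simp
  qed
  moreover have "s = Suc i"
  proof (rule ccontr)
    assume "s \<noteq> Suc i"
    then have "lam (Suc i) = mu (Suc i)" using s by (simp add: add_box_apply)
    then show False using i(1) by simp
  qed
  ultimately show thesis using that r s by blast
qed

lemma RS1_add_box:
  assumes "RS1 nu mu mu' lam" "finite {i. mu i \<noteq> 0}" "finite {i. lam i \<noteq> 0}"
  shows "nu = mu" "mu' = mu" "lam = add_box 0 mu"
proof -
  show "nu = mu" "mu' = mu" using assms(1) by (auto simp: RS1_def)
  have p: "mu \<prec> lam" and 0: "mu 0 + 1 = lam 0" using assms(1) by (auto simp: RS1_def)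
  obtain s where s: "lam = add_box s mu" using pprec_imp_add_box[OF p assms(2,3)] by blast
  have "s = 0"
  proof (rule ccontr)
    assume "s \<noteq> 0"
    then have "lam 0 = mu 0" using s by (simp add: add_box_apply)
    then show False using 0 by simp
  qed
  then show "lam = add_box 0 mu" using s by simp
qed

text \<open>The inverse local rule. If one of \<open>mu\<close>, \<open>mu'\<close> equals
  \<open>lam\<close>, then \<open>nu\<close> is the other; if both are smaller and differ,
  \<open>nu\<close> is their meet. If both are smaller and agree, the row of the square
  \<open>lam / mu\<close> decides: row 0 gives RS1, and row \<open>Suc i\<close> gives RS2 with
  \<open>nu\<close> obtained by removing a square from row \<open>i\<close>.\<close>

lemma rs_square_unique:
  assumes 1: "rs_square nu mu mu' lam" and 2: "rs_square nu' mu mu' lam"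
    and fin: "finite {i. mu i \<noteq> 0}" "finite {i. mu' i \<noteq> 0}" "finite {i. lam i \<noteq> 0}"
      "finite {i. nu i \<noteq> 0}" "finite {i. nu' i \<noteq> 0}"
  shows "nu = nu'"
proof -
  have ne: "x \<prec> y \<Longrightarrow> x \<noteq> y" for x y using pprec_irrefl by blast
  consider "mu' = lam" | "mu = lam" | "mu \<noteq> lam" "mu' \<noteq> lam" "mu \<noteq> mu'" | "mu \<noteq> lam" "mu' \<noteq> lam" "mu = mu'"
    by blast
  then show ?thesis
  proof cases
    case 1
    have "x = mu" if "rs_square x mu mu' lam" for x
      using that 1 ne by (auto simp: rs_square_def RS0_def RS1_def RS2_def RS3_def)
    then show ?thesis using assms(1,2) by blast
  next
    case 2
    have "x = mu'" if "rs_square x mu mu' lam" for x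
      using that 2 ne by (auto simp: rs_square_def RS0_def RS1_def RS2_def RS3_def)
    then show ?thesis using assms(1,2) by blast
  next
    case 3
    have "x \<prec> mu \<and> x \<prec> mu'" if "rs_square x mu mu' lam" for x
      using that 3 by (auto simp: rs_square_def RS0_def RS1_def RS2_def RS3_def)
    then show ?thesis using pprec_meet_unique[OF 3(3) fin(1,2,4,5)] assms(1,2) by blast
  next
    case 4
    have "RS1 x mu mu lam \<or> RS2 x mu mu lam" if "rs_square x mu mu' lam" for x
      using that 4 by (auto simp: rs_square_def RS0_def RS1_def RS2_def RS3_def)
    then have R: "RS1 nu mu mu lam \<or> RS2 nu mu mu lam" "RS1 nu' mu mu lam \<or> RS2 nu' mu mu lam"
      using assms(1,2) by blast+
    have R1: "x = mu \<and> lam = add_box 0 mu" if "RS1 x mu mu lam" for x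
      using RS1_add_box[OF that fin(1,3)] by simp
    have R2: "\<exists>i. mu = add_box i x \<and> lam = add_box (Suc i) mu"
      if "RS2 x mu mu lam" "finite {i. x i \<noteq> 0}" for x
      using RS2_unique[OF that(1) fin(1) that(2) fin(3)] by blast
    have no: "lam = add_box 0 mu \<Longrightarrow> lam = add_box (Suc i) mu \<Longrightarrow> False" for i
      using add_box_inject[of 0 mu "Suc i"] by simp
    show ?thesis
    proof (cases "RS1 nu mu mu lam")
      case True
      then have "RS1 nu' mu mu lam" using R(2) R1[OF True] R2[OF _ fin(5)] no by blast
      then show ?thesis using R1 True by blast
    next
      case False
      then obtain i where i: "mu = add_box i nu" "lam = add_box (Suc i) mu"
        using R(1) R2[OF _ fin(4)] by blast
      then have "RS2 nu' mu mu lam" using R(2) R1 no by blast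
      then obtain i' where i': "mu = add_box i' nu'" "lam = add_box (Suc i') mu"
        using R2[OF _ fin(5)] by blast
      have "i = i'" using add_box_inject[of "Suc i" mu "Suc i'"] i(2) i'(2) by simp
      then show ?thesis using add_box_cancel i(1) i'(1) by metis
    qed
  qed
qed

text \<open>Propagation from the last row and the last column: downward induction on
  \<open>i\<close>, and inside it on \<open>j\<close>.\<close>

lemma rs_grid_unique:
  assumes "\<And>i j. i \<le> n \<Longrightarrow> j \<le> n \<Longrightarrow> finite {k. A i j k \<noteq> 0} \<and> finite {k. L i j k \<noteq> 0}"
    and "\<And>i j. i < n \<Longrightarrow> j < n \<Longrightarrow> rs_square (A i j) (A i (Suc j)) (A (Suc i) j) (A (Suc i) (Suc j))"
    and "\<And>i j. i < n \<Longrightarrow> j < n \<Longrightarrow> rs_square (L i j) (L i (Suc j)) (L (Suc i) j) (L (Suc i) (Suc j))"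
    and "\<And>i. i \<le> n \<Longrightarrow> A i n = L i n" "\<And>j. j \<le> n \<Longrightarrow> A n j = L n j"
    and "i \<le> n" "j \<le> n"
  shows "A i j = L i j"
proof -
  have "\<forall>j\<le>n. A i j = L i j"
    using assms(6)
  proof (induction i rule: inc_induct)
    case base show ?case using assms(5) by blast
  next
    case (step i)
    show ?case
    proof (intro allI impI)
      fix j assume "j \<le> n"
      then show "A i j = L i j"
      proof (induction j rule: inc_induct)
        case base show ?case using assms(4) step by simp
      next
        case (step j)
        note i = \<open>i < n\<close> and j = \<open>j < n\<close>
        have e: "A (Suc i) j = L (Suc i) j" "A (Suc i) (Suc j) = L (Suc i) (Suc j)"
          using \<open>\<forall>j\<le>n. A (Suc i) j = L (Suc i) j\<close> j by auto
        show ?case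
          using rs_square_unique[of "A i j" "A i (Suc j)" "A (Suc i) j" "A (Suc i) (Suc j)" "L i j"]
            assms(2)[OF i j] assms(3)[OF i j] e step.IH assms(1) i j by simp
      qed
    qed
  qed
  then show ?thesis using assms(7) by blast
qed


section \<open>Restrictions of a tableau to its small entries, and row insertion\<close>

abbreviation restr :: "nat \<Rightarrow> nat list list \<Rightarrow> nat \<Rightarrow> nat" where
  "restr m T \<equiv> shape (map (filter (\<lambda>x. x < m)) T)"

lemma restr_eq: "restr m T = (\<lambda>i. if i < length T then length (filter (\<lambda>x. x < m) (T ! i)) else 0)"
  by (auto simp: shape_def)

lemma shape_Cons: "shape (row # T) = case_nat (length row) (shape T)"
  by (auto simp: shape_def split: nat.split)

lemma finite_shape: "finite {i. shape T i \<noteq> 0}"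
  by (rule finite_subset[of _ "{..<length T}"]) (auto simp: shape_def split: if_splits)

lemma add_box_case_nat:
  "add_box 0 (case_nat k mu) = case_nat (Suc k) mu"
  "add_box (Suc r) (case_nat k mu) = case_nat k (add_box r mu)"
  by (auto simp: fun_eq_iff add_box_apply split: nat.split)

definition rows_increasing :: "nat list list \<Rightarrow> bool" where
  "rows_increasing T \<longleftrightarrow> (\<forall>row\<in>set T. sorted_wrt (<) row)"

lemma row_insert_None:
  "row_insert x row = (row', None) \<Longrightarrow> row' = row @ [x] \<and> (\<forall>z\<in>set row. z \<le> x)"
  by (induction row arbitrary: row') (auto split: if_splits prod.splits)

lemma row_insert_Some:
  "row_insert x row = (row', Some y) \<Longrightarrow>
     \<exists>us vs. row = us @ y # vs \<and> row' = us @ x # vs \<and> (\<forall>z\<in>set us. z \<le> x) \<and> x < y"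
proof (induction row arbitrary: row')
  case (Cons a row)
  show ?case
  proof (cases "x < a")
    case True then show ?thesis using Cons.prems by (intro exI[of _ "[]"] exI[of _ row]) auto
  next
    case False
    obtain zs b where r: "row_insert x row = (zs, b)" by (cases "row_insert x row")
    then have "row' = a # zs" "b = Some y" using Cons.prems False by auto
    then obtain us vs where "row = us @ y # vs" "zs = us @ x # vs" "\<forall>z\<in>set us. z \<le> x" "x < y"
      using Cons.IH r by blast
    then show ?thesis using False \<open>row' = a # zs\<close> by (intro exI[of _ "a # us"] exI[of _ vs]) auto
  qed
qed simp

lemma tab_insert_Cons:
  "tab_insert x (row # rows) =
     (case row_insert x row of (row', None) \<Rightarrow> (row' # rows, 0)
      | (row', Some y) \<Rightarrow> (row' # fst (tab_insert y rows), Suc (snd (tab_insert y rows))))"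
  by (auto split: prod.splits option.splits)

declare tab_insert.simps(2) [simp del]

lemma tab_insert_shape: "shape (fst (tab_insert x T)) = add_box (snd (tab_insert x T)) (shape T)
    \<and> snd (tab_insert x T) \<le> length T
    \<and> length (fst (tab_insert x T)) = (if snd (tab_insert x T) < length T then length T else Suc (length T))"
proof (induction T arbitrary: x)
  case Nil show ?case by (auto simp: shape_def fun_eq_iff add_box_apply)
next
  case (Cons row rows)
  obtain row' b where rb: "row_insert x row = (row', b)" by (cases "row_insert x row")
  show ?case
  proof (cases b)
    case None
    then show ?thesis using rb row_insert_None[of x row row']
      by (simp add: tab_insert_Cons shape_Cons add_box_case_nat)
  next
    case (Some y)
    then have "length row' = length row" using row_insert_Some[of x row row' y] rb by auto
    then show ?thesis using rb Some Cons.IH[of y]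
      by (simp add: tab_insert_Cons shape_Cons add_box_case_nat)
  qed
qed

lemma tab_insert_mset: "mset (concat (fst (tab_insert x T))) = add_mset x (mset (concat T))"
proof (induction T arbitrary: x)
  case (Cons row rows)
  obtain row' b where rb: "row_insert x row = (row', b)" by (cases "row_insert x row")
  show ?case
  proof (cases b)
    case None then show ?thesis using rb row_insert_None[of x row row'] by (simp add: tab_insert_Cons)
  next
    case (Some y) then show ?thesis using rb row_insert_Some[of x row row' y] Cons.IH[of y]
      by (auto simp: tab_insert_Cons)
  qed
qed simp

lemma tab_insert_rows_increasing:
  assumes "rows_increasing T" "distinct (x # concat T)"
  shows "rows_increasing (fst (tab_insert x T))"
  using assms
proof (induction T arbitrary: x)
  case Nil show ?case by (simp add: rows_increasing_def)
next
  case (Cons row rows)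
  obtain row' b where rb: "row_insert x row = (row', b)" by (cases "row_insert x row")
  have srt: "sorted_wrt (<) row" "rows_increasing rows" using Cons.prems by (auto simp: rows_increasing_def)
  show ?case
  proof (cases b)
    case None
    then have "row' = row @ [x]" "\<forall>z\<in>set row. z \<le> x" using rb row_insert_None by auto
    moreover from this have "\<forall>z\<in>set row. z < x" using Cons.prems(2) by (auto simp: le_less)
    ultimately have "sorted_wrt (<) row'" using srt by (auto simp: sorted_wrt_append)
    then show ?thesis using rb None srt by (auto simp: tab_insert_Cons rows_increasing_def)
  next
    case (Some y)
    then obtain us vs where uv: "row = us @ y # vs" "row' = us @ x # vs" "\<forall>z\<in>set us. z \<le> x" "x < y"
      using rb row_insert_Some by blast
    then have "\<forall>z\<in>set us. z < x" using Cons.prems(2) by (auto simp: le_less)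
    then have "sorted_wrt (<) row'" using srt uv by (auto simp: sorted_wrt_append)
    moreover have "rows_increasing (fst (tab_insert y rows))"
      using Cons.IH[of y] srt(2) Cons.prems(2) uv(1) by auto
    ultimately show ?thesis using rb Some by (auto simp: tab_insert_Cons rows_increasing_def)
  qed
qed

text \<open>An entry bumped by row insertion is larger than the inserted one, so entries below
  \<open>m\<close> are never moved.\<close>

lemma restr_insert_large:
  assumes "m \<le> x"
  shows "restr m (fst (tab_insert x T)) = restr m T"
  using assms
proof (induction T arbitrary: x)
  case Nil then show ?case by (auto simp: shape_def fun_eq_iff)
next
  case (Cons row rows)
  obtain row' b where rb: "row_insert x row = (row', b)" by (cases "row_insert x row")
  show ?case
  proof (cases b)
    case None
    then show ?thesis using rb row_insert_None[of x row row'] Cons.prems by (simp add: tab_insert_Cons shape_Cons)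
  next
    case (Some y)
    then obtain us vs where "row = us @ y # vs" "row' = us @ x # vs" "x < y"
      using rb row_insert_Some[of x row row' y] by blast
    then show ?thesis using rb Some Cons.prems Cons.IH[of y] by (simp add: tab_insert_Cons shape_Cons)
  qed
qed

text \<open>In the first row \<open>y\<close> comes after all entries below \<open>m\<close>. What
  it bumps, if anything, is at least \<open>m\<close>, so by \<open>restr_insert_large\<close> the
  other rows do not change below \<open>m\<close>.\<close>

lemma restr_insert_max:
  assumes "y < m" "\<forall>z\<in>set (concat T). z < m \<longrightarrow> z < y"
  shows "restr m (fst (tab_insert y T)) = add_box 0 (restr m T)"
proof (cases T)
  case Nil then show ?thesis using assms by (auto simp: shape_def fun_eq_iff add_box_apply)
next
  case (Cons row rows)
  obtain row' b where rb: "row_insert y row = (row', b)" by (cases "row_insert y row")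
  show ?thesis
  proof (cases b)
    case None
    then show ?thesis using rb row_insert_None[of y row row'] assms Cons
      by (simp add: tab_insert_Cons shape_Cons add_box_case_nat)
  next
    case (Some z)
    then obtain us vs where uv: "row = us @ z # vs" "row' = us @ y # vs" "y < z"
      using rb row_insert_Some[of y row row' z] by blast
    then have "m \<le> z" using assms(2) Cons by (auto simp: not_less[symmetric])
    then show ?thesis using rb Some uv assms(1) Cons restr_insert_large[of m z rows]
      by (simp add: tab_insert_Cons shape_Cons add_box_case_nat)
  qed
qed

lemma restr_Suc_notin: "i \<notin> set (concat T) \<Longrightarrow> restr (Suc i) T = restr i T"
proof -
  assume i: "i \<notin> set (concat T)"
  have "filter (\<lambda>x. x < Suc i) row = filter (\<lambda>x. x < i) row" if "row \<in> set T" for row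
    using that i by (intro filter_cong) (auto simp: less_Suc_eq)
  then have "map (filter (\<lambda>x. x < Suc i)) T = map (filter (\<lambda>x. x < i)) T" by (intro map_cong) auto
  then show ?thesis by (simp only:)
qed

lemma restr_Suc_in:
  assumes "distinct (concat T)" "a < length T" "i \<in> set (T ! a)"
  shows "restr (Suc i) T = add_box a (restr i T)"
  using assms
proof (induction T arbitrary: a)
  case (Cons row rows)
  show ?case
  proof (cases a)
    case 0
    then have i: "i \<in> set row" "distinct row" "i \<notin> set (concat rows)" using Cons.prems by auto
    then obtain us vs where uv: "row = us @ i # vs" "i \<notin> set us" "i \<notin> set vs"
      by (metis split_list distinct.simps(2) distinct_append not_distinct_conv_prefix)
    have "filter (\<lambda>x. x < Suc i) zs = filter (\<lambda>x. x < i) zs" if "i \<notin> set zs" for zs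
      using that by (intro filter_cong) (auto simp: less_Suc_eq)
    then have "length (filter (\<lambda>x. x < Suc i) row) = Suc (length (filter (\<lambda>x. x < i) row))"
      using uv by simp
    then show ?thesis using restr_Suc_notin[OF i(3)] 0
      by (simp add: shape_Cons add_box_case_nat)
  next
    case (Suc a')
    then have "i \<in> set (rows ! a')" "a' < length rows" "distinct (concat rows)" using Cons.prems by auto
    moreover have "i \<notin> set row" using Cons.prems Suc calculation by (auto dest: nth_mem)
    then have "filter (\<lambda>x. x < Suc i) row = filter (\<lambda>x. x < i) row"
      by (intro filter_cong) (auto simp: less_Suc_eq)
    ultimately show ?thesis using Cons.IH[of a'] Suc
      by (simp add: shape_Cons add_box_case_nat)
  qed
qed simp

text \<open>If \<open>i\<close> is in the row in which the smaller restriction grows, it is bumped into the next one.\<close>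

lemma restr_insert_small:
  assumes "rows_increasing T" "distinct (x # concat T)" "x < i"
  shows "\<exists>s. restr i (fst (tab_insert x T)) = add_box s (restr i T) \<and>
    restr (Suc i) (fst (tab_insert x T)) =
      add_box (if s < length T \<and> i \<in> set (T ! s) then Suc s else s) (restr (Suc i) T)"
  using assms
proof (induction T arbitrary: x)
  case Nil then show ?case by (intro exI[of _ 0]) (auto simp: shape_def fun_eq_iff add_box_apply)
next
  case (Cons row rows)
  obtain row' b where rb: "row_insert x row = (row', b)" by (cases "row_insert x row")
  have srt: "sorted_wrt (<) row" "rows_increasing rows" using Cons.prems by (auto simp: rows_increasing_def)
  show ?case
  proof (cases b)
    case None
    then have r: "row' = row @ [x]" "\<forall>z\<in>set row. z \<le> x" using rb row_insert_None by auto
    then have "i \<notin> set row" using Cons.prems(3) by auto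
    then show ?thesis using rb None r Cons.prems(3)
      by (intro exI[of _ 0]) (simp add: tab_insert_Cons shape_Cons add_box_case_nat)
  next
    case (Some y)
    then obtain us vs where uv: "row = us @ y # vs" "row' = us @ x # vs" "\<forall>z\<in>set us. z \<le> x" "x < y"
      using rb row_insert_Some by blast
    have vs: "\<forall>z\<in>set vs. y < z" using srt(1) uv(1) by (auto simp: sorted_wrt_append)
    have ius: "i \<notin> set us" using uv(3) Cons.prems(3) by auto
    consider "y < i" | "y = i" | "i < y" by linarith
    then show ?thesis
    proof cases
      case 1
      obtain s where s: "restr i (fst (tab_insert y rows)) = add_box s (restr i rows)"
        "restr (Suc i) (fst (tab_insert y rows)) =
          add_box (if s < length rows \<and> i \<in> set (rows ! s) then Suc s else s) (restr (Suc i) rows)"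
        using Cons.IH[of y] srt(2) Cons.prems(2) uv(1) 1 by auto
      have e: "(if Suc s < length (row # rows) \<and> i \<in> set ((row # rows) ! Suc s) then Suc (Suc s) else Suc s) =
        Suc (if s < length rows \<and> i \<in> set (rows ! s) then Suc s else s)" by simp
      show ?thesis
        unfolding tab_insert_Cons rb Some
        by (intro exI[of _ "Suc s"], unfold e)
          (use s uv 1 Cons.prems(3) in \<open>simp add: shape_Cons add_box_case_nat\<close>)
    next
      \<comment> \<open>Here \<open>i\<close> itself is bumped. Below \<open>i\<close> the first row
        grows; below \<open>Suc i\<close> it keeps its length, and \<open>i\<close>, now the largest
        entry below \<open>Suc i\<close> among the remaining rows, joins the next row.\<close>
      case 2
      have nin: "i \<notin> set (concat rows)" using Cons.prems(2) uv(1) 2 by auto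
      have "restr (Suc i) (fst (tab_insert y rows)) = add_box 0 (restr (Suc i) rows)"
        using 2 nin by (intro restr_insert_max) (auto simp: less_Suc_eq)
      moreover have "restr i (fst (tab_insert y rows)) = restr i rows"
        using 2 by (intro restr_insert_large) simp
      moreover have "filter (\<lambda>x. x < i) vs = []" "filter (\<lambda>x. x < Suc i) vs = []"
        using vs 2 by (force simp: filter_empty_conv)+
      ultimately show ?thesis
        unfolding tab_insert_Cons rb Some
        using uv 2 Cons.prems(3)
        by (intro exI[of _ 0]) (simp add: shape_Cons add_box_case_nat)
    next
      case 3
      have "restr (Suc i) (fst (tab_insert y rows)) = restr (Suc i) rows"
        "restr i (fst (tab_insert y rows)) = restr i rows"
        using 3 by (intro restr_insert_large; simp)+
      moreover have "filter (\<lambda>x. x < i) vs = []" "filter (\<lambda>x. x < Suc i) vs = []"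
        using vs 3 by (force simp: filter_empty_conv)+
      moreover have "i \<notin> set row" using ius vs 3 uv(1) by auto
      ultimately show ?thesis
        unfolding tab_insert_Cons rb Some
        using uv 3 Cons.prems(3)
        by (intro exI[of _ 0]) (simp add: shape_Cons add_box_case_nat)
    qed
  qed
qed

text \<open>For \<open>i < x\<close> nothing changes below \<open>Suc i\<close> (RS0), and for
  \<open>x = i\<close> the first row grows (RS1). For \<open>x < i\<close> the type is RS0, RS2 or
  RS3 according as \<open>i\<close> is absent, in the row that grows below \<open>i\<close>, or in
  another row.\<close>

lemma rs_square_insert:
  assumes "rows_increasing T" "distinct (x # concat T)"
  shows "rs_square (restr i T) (restr i (fst (tab_insert x T)))
    (restr (Suc i) T) (restr (Suc i) (fst (tab_insert x T)))"
proof -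
  have d: "distinct (concat T)" and xT: "x \<notin> set (concat T)" using assms(2) by auto
  note prec = pprec_add_box
  have row: "\<exists>a<length T. i \<in> set (T ! a)" if "i \<in> set (concat T)"
    using that by (auto simp: in_set_conv_nth[of _ T])
  consider "i < x" | "x = i" | "x < i" by linarith
  then show ?thesis
  proof cases
    case 1
    then have "restr i (fst (tab_insert x T)) = restr i T" "restr (Suc i) (fst (tab_insert x T)) = restr (Suc i) T"
      by (auto intro: restr_insert_large)
    moreover have "restr i T \<preceq> restr (Suc i) T"
    proof (cases "i \<in> set (concat T)")
      case True
      then obtain a where "a < length T" "i \<in> set (T ! a)" using row by blast
      from restr_Suc_in[OF d this] show ?thesis using prec[OF finite_shape] by (simp add: ppreceq_def)
    next
      case False then show ?thesis using restr_Suc_notin by (simp add: ppreceq_def)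
    qed
    ultimately show ?thesis by (simp add: rs_square_def RS0_def)
  next
    case 2
    have "restr i (fst (tab_insert x T)) = restr i T" using 2 by (intro restr_insert_large) simp
    moreover have e: "restr (Suc i) T = restr i T" using restr_Suc_notin xT 2 by simp
    moreover have "restr (Suc i) (fst (tab_insert x T)) = add_box 0 (restr i T)"
      unfolding e[symmetric] using 2 xT by (intro restr_insert_max) (auto simp: less_Suc_eq)
    ultimately show ?thesis using prec[OF finite_shape] by (simp add: rs_square_def RS1_def add_box_apply)
  next
    case 3
    obtain s where s: "restr i (fst (tab_insert x T)) = add_box s (restr i T)"
      "restr (Suc i) (fst (tab_insert x T)) =
        add_box (if s < length T \<and> i \<in> set (T ! s) then Suc s else s) (restr (Suc i) T)"
      using restr_insert_small[OF assms 3] by blast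
    show ?thesis
    proof (cases "i \<in> set (concat T)")
      case False
      then have "\<not> (s < length T \<and> i \<in> set (T ! s))" by auto
      then have "restr (Suc i) (fst (tab_insert x T)) = add_box s (restr (Suc i) T)"
        unfolding s(2) by (simp only: if_False)
      then show ?thesis using s(1) restr_Suc_notin[OF False] prec[OF finite_shape]
        by (simp add: rs_square_def RS0_def ppreceq_def)
    next
      case True
      then obtain a where a: "a < length T" "i \<in> set (T ! a)" using row by blast
      define nu where "nu = restr i T"
      have fnu: "finite {i. nu i \<noteq> 0}" unfolding nu_def by (rule finite_shape)
      note fr = finite_add_box[OF fnu]
      have mu': "restr (Suc i) T = add_box a nu" unfolding nu_def by (rule restr_Suc_in[OF d a])
      have aux: "s < length T \<and> i \<in> set (T ! s) \<longleftrightarrow> s = a"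
      proof
        assume "s < length T \<and> i \<in> set (T ! s)"
        then have "restr (Suc i) T = add_box s nu" unfolding nu_def using restr_Suc_in[OF d] by blast
        then show "s = a" using mu' add_box_inject by metis
      qed (use a in auto)
      show ?thesis
      proof (cases "s = a")
        case True
        have l: "restr (Suc i) (fst (tab_insert x T)) = add_box (Suc a) (add_box a nu)"
          using s(2) aux True mu' by simp
        have m: "restr i (fst (tab_insert x T)) = add_box a nu" using s(1) True by (simp add: nu_def)
        have "RS2 nu (add_box a nu) (add_box a nu) (add_box (Suc a) (add_box a nu))"
          unfolding RS2_def
        proof (intro conjI exI[of _ a])
          show "nu \<prec> add_box a nu" by (rule prec[OF fnu])
          show "add_box a nu \<prec> add_box (Suc a) (add_box a nu)" by (rule prec[OF fr])
        qed (auto simp: add_box_apply)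
        then show ?thesis unfolding l m mu' nu_def[symmetric] by (simp add: rs_square_def)
      next
        case False
        have l: "restr (Suc i) (fst (tab_insert x T)) = add_box s (add_box a nu)"
          using s(2) aux False mu' by simp
        have m: "restr i (fst (tab_insert x T)) = add_box s nu" using s(1) by (simp add: nu_def)
        have comm: "add_box s (add_box a nu) = add_box a (add_box s nu)" using False by (auto simp: fun_eq_iff add_box_apply)
        have "RS3 nu (add_box s nu) (add_box a nu) (add_box s (add_box a nu))"
          unfolding RS3_def
        proof (intro conjI)
          show "nu \<prec> add_box s nu" "nu \<prec> add_box a nu" by (rule prec[OF fnu])+
          show "add_box a nu \<prec> add_box s (add_box a nu)" by (rule prec[OF fr])
          show "add_box s nu \<prec> add_box s (add_box a nu)" unfolding comm by (rule prec[OF fr])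
          show "add_box s nu \<noteq> add_box a nu" using False add_box_inject by blast
        qed
        then show ?thesis unfolding l m mu' nu_def[symmetric] by (simp add: rs_square_def)
      qed
    qed
  qed
qed

section \<open>Invariants of the Schensted correspondence\<close>

lemma add_entry_shape:
  assumes "r \<le> length Q"
  shows "shape (add_entry r x Q) = add_box r (shape Q)"
    and "length (add_entry r x Q) = (if r < length Q then length Q else Suc (length Q))"
  using assms by (auto simp: add_entry_def shape_def fun_eq_iff nth_append nth_list_update add_box_apply)

lemma restr_add_entry:
  assumes "m \<le> x" "r \<le> length Q"
  shows "restr m (add_entry r x Q) = restr m Q"
  using assms by (auto simp: restr_eq add_entry_def fun_eq_iff nth_append nth_list_update)

lemma add_entry_mset: "r \<le> length Q \<Longrightarrow> mset (concat (add_entry r x Q)) = add_mset x (mset (concat Q))"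
proof (cases "r < length Q")
  case True
  have "concat (Q[r := Q ! r @ [x]]) = concat (take r Q) @ (Q ! r @ [x]) @ concat (drop (Suc r) Q)"
    using True by (simp add: upd_conv_take_nth_drop)
  moreover have "concat Q = concat (take r Q) @ (Q ! r) @ concat (drop (Suc r) Q)"
    using True by (metis concat.simps(2) concat_append id_take_nth_drop)
  ultimately show ?thesis using True by (simp add: add_entry_def)
qed (simp add: add_entry_def)

lemma RS_Suc:
  "RS (Suc n) \<sigma> = (fst (tab_insert (\<sigma> n) (fst (RS n \<sigma>))),
     add_entry (snd (tab_insert (\<sigma> n) (fst (RS n \<sigma>)))) n (snd (RS n \<sigma>)))"
  by (simp add: RS_def split: prod.splits)

lemma RS_invariants:
  assumes "inj_on \<sigma> {..<n}"
  shows "rows_increasing (fst (RS n \<sigma>)) \<and> distinct (concat (fst (RS n \<sigma>))) \<and>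
    mset (concat (fst (RS n \<sigma>))) = mset_set (\<sigma> ` {..<n}) \<and>
    mset (concat (snd (RS n \<sigma>))) = mset_set {..<n} \<and>
    length (snd (RS n \<sigma>)) = length (fst (RS n \<sigma>)) \<and> shape (snd (RS n \<sigma>)) = shape (fst (RS n \<sigma>))"
  using assms
proof (induction n)
  case 0 show ?case by (simp add: RS_def rows_increasing_def)
next
  case (Suc n)
  have inj: "inj_on \<sigma> {..<n}" using Suc.prems by (rule inj_on_subset) auto
  define P Q where "P = fst (RS n \<sigma>)" and "Q = snd (RS n \<sigma>)"
  have IH: "rows_increasing P" "distinct (concat P)" "mset (concat P) = mset_set (\<sigma> ` {..<n})"
    "mset (concat Q) = mset_set {..<n}" "length Q = length P" "shape Q = shape P"
    using Suc.IH[OF inj] by (auto simp: P_def Q_def)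
  have "\<sigma> n \<notin> \<sigma> ` {..<n}" using Suc.prems by (auto simp: lessThan_Suc)
  moreover have "set (concat P) = \<sigma> ` {..<n}" using IH(3) by (metis finite_set_mset_mset_set finite_imageI finite_lessThan set_mset_mset)
  ultimately have dx: "distinct (\<sigma> n # concat P)" using IH(2) by simp
  note ts = tab_insert_shape[of "\<sigma> n" P]
  have ms: "mset (concat (fst (tab_insert (\<sigma> n) P))) = mset_set (\<sigma> ` {..<Suc n})"
    unfolding tab_insert_mset IH(3) lessThan_Suc image_insert
    using \<open>\<sigma> n \<notin> \<sigma> ` {..<n}\<close> by (subst mset_set.insert) auto
  have "distinct (concat (fst (tab_insert (\<sigma> n) P)))"
    using tab_insert_mset[of "\<sigma> n" P] dx by (metis mset.simps(2) mset_eq_imp_distinct_iff)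
  moreover have "mset (concat (add_entry (snd (tab_insert (\<sigma> n) P)) n Q)) = mset_set {..<Suc n}"
    using add_entry_mset[of "snd (tab_insert (\<sigma> n) P)" Q n] ts IH(4,5) by (simp add: lessThan_Suc)
  moreover have "shape (add_entry (snd (tab_insert (\<sigma> n) P)) n Q) = shape (fst (tab_insert (\<sigma> n) P))"
    using add_entry_shape(1)[of "snd (tab_insert (\<sigma> n) P)" Q n] ts IH(5,6) by simp
  moreover have "length (add_entry (snd (tab_insert (\<sigma> n) P)) n Q) = length (fst (tab_insert (\<sigma> n) P))"
    using add_entry_shape(2)[of "snd (tab_insert (\<sigma> n) P)" Q n] ts IH(5) by simp
  ultimately show ?case
    using tab_insert_rows_increasing[OF IH(1) dx] ms unfolding RS_Suc P_def[symmetric] Q_def[symmetric] by simp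
qed

lemma restr_all: "\<forall>x\<in>set (concat T). x < m \<Longrightarrow> restr m T = shape T"
proof -
  assume h: "\<forall>x\<in>set (concat T). x < m"
  then have "map (filter (\<lambda>x. x < m)) T = T" by (intro map_idI) (auto simp: filter_id_conv)
  then show ?thesis by simp
qed

lemma set_concat_RS:
  assumes "inj_on \<sigma> {..<n}"
  shows "set (concat (fst (RS n \<sigma>))) = \<sigma> ` {..<n}" "set (concat (snd (RS n \<sigma>))) = {..<n}"
  using RS_invariants[OF assms]
  by (metis finite_set_mset_mset_set finite_imageI finite_lessThan set_mset_mset)+

text \<open>Entries recorded from step \<open>j\<close> on are at least \<open>j\<close>, so below
  \<open>j\<close> the recording tableau no longer changes.\<close>

lemma RS_recording:
  assumes "inj_on \<sigma> {..<n}" "j \<le> n"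
  shows "restr j (snd (RS n \<sigma>)) = shape (fst (RS j \<sigma>))"
  using assms(2,1)
proof (induction rule: dec_induct)
  case base
  then show ?case using set_concat_RS(2)[OF base] RS_invariants[OF base]
    by (metis lessThan_iff restr_all)
next
  case (step n)
  have inj: "inj_on \<sigma> {..<n}" using step.prems by (rule inj_on_subset) auto
  have "snd (tab_insert (\<sigma> n) (fst (RS n \<sigma>))) \<le> length (snd (RS n \<sigma>))"
    using tab_insert_shape[of "\<sigma> n" "fst (RS n \<sigma>)"] RS_invariants[OF inj] by simp
  then show ?case unfolding RS_Suc snd_conv using restr_add_entry[of j n] step.hyps step.IH[OF inj] by simp
qed

lemma RS_square:
  assumes "inj_on \<sigma> {..<Suc j}"
  shows "rs_square (restr i (fst (RS j \<sigma>))) (restr i (fst (RS (Suc j) \<sigma>)))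
    (restr (Suc i) (fst (RS j \<sigma>))) (restr (Suc i) (fst (RS (Suc j) \<sigma>)))"
proof -
  have inj: "inj_on \<sigma> {..<j}" using assms by (rule inj_on_subset) auto
  note I = RS_invariants[OF inj]
  have "\<sigma> j \<notin> set (concat (fst (RS j \<sigma>)))" unfolding set_concat_RS[OF inj] using assms by (auto simp: lessThan_Suc)
  then have "distinct (\<sigma> j # concat (fst (RS j \<sigma>)))" using I by simp
  then show ?thesis unfolding RS_Suc fst_conv using I by (intro rs_square_insert) auto
qed

lemma psize_shape: "psize (shape T) = length (concat T)"
proof -
  have "psize (shape T) = (\<Sum>i<length T. shape T i)"
    unfolding psize_def by (rule sum.mono_neutral_left) (auto simp: shape_def split: if_splits)
  also have "\<dots> = (\<Sum>i<length T. length (T ! i))" by (intro sum.cong) (auto simp: shape_def)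
  also have "\<dots> = sum_list (map length T)"
    by (simp add: sum_list_sum_nth atLeast0LessThan)
  finally show ?thesis by (simp add: length_concat)
qed

text \<open>Links the growth diagram to relative positions: the right side is the rank function of
  \<sigma>, and the left side will be the dimension of \<open>f i \<inter> f' j\<close>.\<close>

lemma psize_restr_RS:
  assumes "inj_on \<sigma> {..<j}"
  shows "psize (restr i (fst (RS j \<sigma>))) = card {k. k < j \<and> \<sigma> k < i}"
proof -
  note I = RS_invariants[OF assms]
  have "psize (restr i (fst (RS j \<sigma>))) = length (filter (\<lambda>x. x < i) (concat (fst (RS j \<sigma>))))"
    by (simp add: psize_shape filter_concat)
  also have "\<dots> = card (set (filter (\<lambda>x. x < i) (concat (fst (RS j \<sigma>)))))"
    using I by (intro distinct_card[symmetric]) simp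
  also have "set (filter (\<lambda>x. x < i) (concat (fst (RS j \<sigma>)))) = \<sigma> ` {k. k < j \<and> \<sigma> k < i}"
    using set_concat_RS(1)[OF assms] by auto
  also have "card \<dots> = card {k. k < j \<and> \<sigma> k < i}"
    by (intro card_image inj_on_subset[OF assms]) auto
  finally show ?thesis .
qed


section \<open>Standard tableaux and chains of partitions\<close>

lemma SYT_unique:
  assumes T: "T \<in> SYT lam" and T': "T' \<in> SYT lam"
    and eq: "\<And>m. m \<le> psize lam \<Longrightarrow> restr m T = restr m T'"
  shows "T = T'"
proof -
  have shp: "shape T = shape T'" using T T' by (simp add: SYT_def)
  have len: "length T = card {i. lam i \<noteq> 0}" if "T \<in> SYT lam" for T
  proof -
    have T: "[] \<notin> set T" "lam = shape T" using that by (auto simp: SYT_def)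
    have "T ! i \<noteq> []" if "i < length T" for i using nth_mem[OF that] T(1) by metis
    then have "lam i \<noteq> 0 \<longleftrightarrow> i < length T" for i unfolding T(2) by (simp add: shape_def)
    then have "{i. lam i \<noteq> 0} = {..<length T}" by (auto simp del: neq0_conv)
    then show ?thesis by simp
  qed
  have ll: "length T = length T'" using len[OF T] len[OF T'] by simp
  show ?thesis
  proof (rule nth_equalityI[OF ll])
    fix i assume i: "i < length T"
    have inc: "sorted_wrt (<) (T ! i)" "sorted_wrt (<) (T' ! i)"
      using T T' i ll by (auto simp: SYT_def)
    have sub: "set (T ! i) \<subseteq> {..<psize lam}" "set (T' ! i) \<subseteq> {..<psize lam}"
    proof -
      have "T ! i \<in> set T" "T' ! i \<in> set T'" using i ll by auto
      then have "set (T ! i) \<subseteq> set (concat T)" "set (T' ! i) \<subseteq> set (concat T')" by auto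
      then show "set (T ! i) \<subseteq> {..<psize lam}" "set (T' ! i) \<subseteq> {..<psize lam}"
        using T T' by (auto simp: SYT_def)
    qed
    \<comment> \<open>Comparing the restrictions at \<open>m\<close> and \<open>Suc m\<close>
      reveals whether \<open>m\<close> occurs in a given row, and an increasing row is determined by
      its set of entries.\<close>
    have cnt: "length (filter (\<lambda>x. x < Suc m) xs) = length (filter (\<lambda>x. x < m) xs) + (if m \<in> set xs then 1 else 0)"
      if "distinct xs" for xs :: "nat list" and m
      using that by (induction xs) (auto simp: less_Suc_eq)
    have dist: "distinct (T ! i)" "distinct (T' ! i)"
      using inc by (auto simp: strict_sorted_iff)
    have "m \<in> set (T ! i) \<longleftrightarrow> m \<in> set (T' ! i)" for m
    proof (cases "m < psize lam")
      case True
      have "length (filter (\<lambda>x. x < k) (T ! i)) = length (filter (\<lambda>x. x < k) (T' ! i))" if "k \<le> psize lam" for k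
        using fun_cong[OF eq[OF that], of i] i ll by (simp add: restr_eq)
      from this[of m] this[of "Suc m"] True show ?thesis
        using cnt[OF dist(1), of m] cnt[OF dist(2), of m] by (auto split: if_splits)
    next
      case False then show ?thesis using sub by auto
    qed
    then have "set (T ! i) = set (T' ! i)" by blast
    then show "T ! i = T' ! i" using inc
      by (simp add: strict_sorted_iff sorted_distinct_set_unique)
  qed
qed

text \<open>The new entry \<open>n\<close> exceeds all others and is put at the end of a row, so
  rows stay increasing; columns do because the enlarged shape is a partition, so the square above
  the new one is already filled.\<close>

lemma SYT_add_entry:
  assumes T: "T \<in> SYT lam" and part: "is_partition (add_box r lam)" and n: "psize lam = n"
  shows "add_entry r n T \<in> SYT (add_box r lam)" "r \<le> length T"
proof -
  have T': "[] \<notin> set T" "shape T = lam" "is_partition lam" "distinct (concat T)" "set (concat T) = {..<n}"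
    "\<forall>row\<in>set T. sorted_wrt (<) row"
    "\<forall>i j. i + 1 < length T \<and> j < length (T ! (i + 1)) \<longrightarrow> T ! i ! j < T ! (i + 1) ! j"
    using T n by (auto simp: SYT_def)
  have lam: "lam i = (if i < length T then length (T ! i) else 0)" for i using T'(2) by (auto simp: shape_def)
  have less: "lam r < lam i" if "i < r" for i
    using is_partition_antimono[OF part, of i r] that by (simp add: add_box_apply)
  show r: "r \<le> length T"
  proof (rule ccontr)
    assume "\<not> r \<le> length T"
    then have "lam r < lam (length T)" using less by simp
    then show False by (simp add: lam)
  qed
  let ?T = "add_entry r n T"
  have nth: "?T ! i = (if i = r then (if r < length T then T ! r else []) @ [n] else T ! i)" if "i < length ?T" for i
    using that r by (auto simp: add_entry_def nth_append nth_list_update)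
  have len: "length ?T = (if r < length T then length T else Suc (length T))" by (rule add_entry_shape(2)[OF r])
  have ms: "mset (concat ?T) = add_mset n (mset (concat T))" by (rule add_entry_mset[OF r])
  have ent: "T ! i ! j < n" if "i < length T" "j < length (T ! i)" for i j
  proof -
    have "T ! i ! j \<in> set (concat T)" using that by (auto intro: nth_mem)
    then show ?thesis using T'(5) by auto
  qed
  show "?T \<in> SYT (add_box r lam)"
    unfolding SYT_def mem_Collect_eq
  proof (intro conjI allI impI ballI)
    show "[] \<notin> set ?T" using T'(1) r by (auto simp: add_entry_def dest: set_update_subset_insert[THEN subsetD])
    show "shape ?T = add_box r lam" using add_entry_shape(1)[OF r] T'(2) by simp
    show "is_partition (add_box r lam)" by (rule part)
    have "mset (concat ?T) = mset (n # concat T)" using ms by simp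
    moreover have "distinct (n # concat T)" using T'(4,5) by simp
    ultimately show "distinct (concat ?T)" by (metis mset_eq_imp_distinct_iff)
    have "psize (add_box r lam) = Suc n"
      unfolding add_box_def using psize_add[OF is_partition_finite[OF T'(3)]] n by simp
    moreover have "set (concat ?T) = insert n (set (concat T))" using ms by (metis set_mset_add_mset_insert set_mset_mset)
    ultimately show "set (concat ?T) = {..<psize (add_box r lam)}" using T'(5) by (simp add: lessThan_Suc)
  next
    fix row assume "row \<in> set ?T"
    then obtain i where i: "i < length ?T" "row = ?T ! i" by (metis in_set_conv_nth)
    show "sorted_wrt (<) row"
    proof (cases "i = r")
      case True
      have "sorted_wrt (<) (T ! r @ [n])" if "r < length T"
        using T'(6) nth_mem[OF that] ent[OF that] by (auto simp: sorted_wrt_append in_set_conv_nth[of _ "T ! r"])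
      then show ?thesis unfolding i(2) nth[OF i(1)] using True by simp
    next
      case False
      then have "i < length T" using i(1) len r by (auto split: if_splits)
      then show ?thesis unfolding i(2) nth[OF i(1)] using T'(6) False by simp
    qed
  next
    fix i j assume ij: "i + 1 < length ?T \<and> j < length (?T ! (i + 1))"
    have i': "i < length ?T" "i + 1 < length ?T" using ij by auto
    have iT: "i < length T" using i' len r by (auto split: if_splits)
    have anti: "lam (i + 1) \<le> lam i" by (rule is_partition_antimono[OF T'(3)]) simp
    have leni: "length (T ! i) = lam i" using iT by (simp add: lam)
    have Ti: "?T ! i ! j = T ! i ! j" if "j < lam i"
      using nth[OF i'(1)] that leni iT by (auto simp: nth_append)
    show "?T ! i ! j < ?T ! (i + 1) ! j"
    proof (cases "i + 1 = r")
      case True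
      then have "lam r < lam i" using less[of i] by simp
      have R: "?T ! (i + 1) = (if r < length T then T ! r else []) @ [n]" using nth[OF i'(2)] True by simp
      have lr: "length (if r < length T then T ! r else []) = lam r" by (simp add: lam)
      have "j \<le> lam r" using ij unfolding R length_append lr by simp
      then have ji: "j < lam i" using \<open>lam r < lam i\<close> by simp
      show ?thesis
      proof (cases "j = lam r")
        case True
        then have "?T ! (i + 1) ! j = n" unfolding R using lr by (metis nth_append_length)
        then show ?thesis using Ti[OF ji] ent[OF iT, of j] ji leni by simp
      next
        case False
        then have jr: "j < lam r" using \<open>j \<le> lam r\<close> by simp
        then have rT: "r < length T" by (simp add: lam split: if_splits)
        then have "?T ! (i + 1) ! j = T ! (i + 1) ! j" unfolding R using jr lr True by (simp add: nth_append)
        moreover have "T ! i ! j < T ! (i + 1) ! j" using T'(7) \<open>i + 1 = r\<close> rT jr lam by metis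
        ultimately show ?thesis using Ti[OF ji] by simp
      qed
    next
      case False
      have i1: "i + 1 < length T" using i'(2) len r False by (auto split: if_splits)
      have R: "?T ! (i + 1) = T ! (i + 1)" using nth[OF i'(2)] False by simp
      then have j: "j < length (T ! (i + 1))" using ij by simp
      then have "j < lam i" using anti i1 by (simp add: lam)
      then show ?thesis using Ti R T'(7) i1 j by simp
    qed
  qed
qed

text \<open>Together with \<open>SYT_unique\<close> this makes the definite description in
  \<open>flag_tableau\<close> meaningful, since the types of the members of a stable flag of a
  nilpotent map form such a chain.\<close>

lemma SYT_of_chain:
  assumes "q 0 = (\<lambda>_. 0)" "\<And>i. i \<le> n \<Longrightarrow> is_partition (q i)" "\<And>i. i < n \<Longrightarrow> q i \<prec> q (Suc i)"
  shows "\<exists>T\<in>SYT (q n). psize (q n) = n \<and> (\<forall>m\<le>n. restr m T = q m)"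
  using assms
proof (induction n)
  case 0
  have "[] \<in> SYT (q 0)" using 0 by (auto simp: SYT_def shape_def psize_def)
  moreover have "restr 0 [] = q 0" using 0 by (simp add: shape_def)
  ultimately show ?case using 0 by (intro bexI[of _ "[]"]) (auto simp: psize_def)
next
  case (Suc n)
  obtain T where T: "T \<in> SYT (q n)" "psize (q n) = n" "\<And>m. m \<le> n \<Longrightarrow> restr m T = q m"
    using Suc.IH Suc.prems by (metis le_SucI less_SucI)
  have p: "is_partition (q n)" "is_partition (q (Suc n))" "q n \<prec> q (Suc n)" using Suc.prems by auto
  obtain r where r: "q (Suc n) = add_box r (q n)"
    using pprec_imp_add_box[OF p(3) is_partition_finite[OF p(1)] is_partition_finite[OF p(2)]] by blast
  note A = SYT_add_entry[OF T(1) p(2)[unfolded r] T(2)]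
  have S: "psize (q (Suc n)) = Suc n" using p(3) T(2) by (simp add: pprec_def)
  have "restr m (add_entry r n T) = q m" if "m \<le> Suc n" for m
  proof (cases "m = Suc n")
    case True
    have "set (concat (add_entry r n T)) = {..<Suc n}" using A(1) S r by (simp add: SYT_def)
    then have "restr m (add_entry r n T) = shape (add_entry r n T)" using True by (intro restr_all) auto
    then show ?thesis using A(1) r True by (simp add: SYT_def)
  next
    case False
    then show ?thesis using restr_add_entry[of m n r T] A(2) T(3)[of m] that by simp
  qed
  then show ?case using A(1) r S by (intro bexI[of _ "add_entry r n T"]) auto
qed

lemma shape_chain_eq_iff:
  assumes "psize (shape T) = n"
  shows "shape_chain T = map q (rev [0..<n + 1]) \<longleftrightarrow> (\<forall>m\<le>n. restr m T = q m)"
  unfolding shape_chain_def assms by (auto simp: less_Suc_eq_le simp del: upt_Suc)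

section \<open>Minimal pairs, relative positions and tableaux of flags\<close>


lemma card_count_Suc:
  "card {l. l < Suc k \<and> P l} = card {l. l < k \<and> P l} + (if P k then 1 else 0)"
proof -
  have "{l. l < Suc k \<and> P l} = (if P k then insert k {l. l < k \<and> P l} else {l. l < k \<and> P l})"
    by (auto simp: less_Suc_eq)
  then show ?thesis by simp
qed

context fd_flag_space
begin

text \<open>Induction on \<open>N\<close> with \<open>V\<close>, \<open>q\<close> and
  \<open>f'\<close> general, because passing to \<open>f N\<close> replaces the second flag by its
  traces. These may repeat, which is why sizes are only required to grow by at most one.\<close>

theorem minimal_pair_squares:
  assumes inf: "infinite (UNIV :: 'a set)" and lin: "lin \<eta>"
    and "minimal_pair \<eta> V N p M q f f'"
    and "\<forall>i<N. psize (p (Suc i)) \<le> Suc (psize (p i))"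
    and "\<forall>j<M. psize (q (Suc j)) \<le> Suc (psize (q j))" and "psize (q 0) = 0"
    and "i < N" "j < M"
  shows "rs_square (jordan_type \<eta> (f i \<inter> f' j)) (jordan_type \<eta> (f i \<inter> f' (Suc j)))
    (jordan_type \<eta> (f (Suc i) \<inter> f' j)) (jordan_type \<eta> (f (Suc i) \<inter> f' (Suc j)))"
  using assms(3-)
proof (induction N arbitrary: V q f' i j)
  case (Suc N)
  have f: "f \<in> FL \<eta> V (Suc N) p" and f': "f' \<in> FL \<eta> V M q" using Suc.prems(1) by (auto simp: minimal_pair_def)
  have JV: "JT \<eta> V (p (Suc N))" and JH: "JT \<eta> (f N) (p N)" and HV: "f N \<subseteq> V"
    using FL_JT[OF f] FL_top[OF f] FL_mono[OF f, of N "Suc N"] by auto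
  have dV: "dim V \<le> Suc (dim (f N))" using Suc.prems(2) JT_dim[OF JV] JT_dim[OF JH] by simp
  have jt: "jordan_type \<eta> (f (Suc N) \<inter> f' j) = q j" if "j \<le> M" for j
  proof -
    have "f (Suc N) \<inter> f' j = f' j" using FL_top[OF f] FL_mono[OF f' that] FL_top[OF f'] by auto
    then show ?thesis using JT_jordan_type[OF FL_JT[OF f' that] lin] by simp
  qed
  have top: "rs_square (jordan_type \<eta> (f N \<inter> f' j)) (jordan_type \<eta> (f N \<inter> f' (Suc j))) (q j) (q (Suc j))"
    if "j < M" for j by (rule minimal_pair_top_square[OF lin Suc.prems(1,3) dV that])
  show ?case
  proof (cases "i = N")
    case True then show ?thesis using top[OF Suc.prems(6)] jt Suc.prems(6) by simp
  next
    case False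
    then have i: "i < N" using Suc.prems(5) by simp
    have stepp: "\<forall>i<N. psize (p (Suc i)) \<le> Suc (psize (p i))" using Suc.prems(2) by simp
    show ?thesis
    proof (cases "dim V = Suc (dim (f N))")
      case True
      define q' where "q' = (\<lambda>j. jordan_type \<eta> (f N \<inter> f' j))"
      have Jq: "JT \<eta> (f' j \<inter> f N) (q' j)" if "j \<le> M" for j
        using JT_Int[OF lin JH FL_JT[OF f' that]] unfolding q'_def by (simp add: Int_commute)
      have sq: "\<forall>j<M. rs_square (q' j) (q' (Suc j)) (q j) (q (Suc j))" using top by (simp add: q'_def)
      have min: "minimal_pair \<eta> (f N) N p M q' f (\<lambda>j. f' j \<inter> f N)"
        by (rule minimal_pair_restrict[OF inf lin Suc.prems(1,2,3,4) True Jq sq])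
      have step': "\<forall>j<M. psize (q' (Suc j)) \<le> Suc (psize (q' j))"
        using rs_square_psize sq Suc.prems(3) by blast
      have "dim (f' 0 \<inter> f N) \<le> dim (f' 0)" by (intro dim_subset) simp
      then have q0: "psize (q' 0) = 0" using JT_dim[OF Jq[of 0]] FL_dim[OF f', of 0] Suc.prems(4) by simp
      have e: "f i' \<inter> (f' j' \<inter> f N) = f i' \<inter> f' j'" if "i' \<le> N" for i' j'
        using FL_mono[OF f, of i' N] that by auto
      from Suc.IH[OF min stepp step' q0 i Suc.prems(6)] show ?thesis using e i by simp
    next
      case False
      then have VH: "f N = V" using dV by (intro subspace_dim_equal JT_subspace[OF JH] JT_subspace[OF JV] HV) simp
      have "minimal_pair \<eta> V N p M q f f'"
        unfolding minimal_pair_def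
      proof (intro conjI ballI allI impI)
        show "f \<in> FL \<eta> V N p" using FL_restrict[OF f, of N] VH by simp
        show "f' \<in> FL \<eta> V M q" by (rule f')
        fix g g' i j k assume g: "g \<in> FL \<eta> V N p" "g' \<in> FL \<eta> V M q" and ij: "i \<le> N" "j \<le> M"
        \<comment> \<open>As \<open>f N = V\<close>, a competing flag of length \<open>N\<close> is
          prolonged by \<open>V\<close> to one of length \<open>Suc N\<close>, against which the
          given minimality can be used.\<close>
        define g2 where "g2 = g(Suc N := V)"
        have "g2 \<in> FL \<eta> V (Suc N) p"
          unfolding FL_def mem_Collect_eq
        proof (intro conjI allI impI)
          fix i assume "i \<le> Suc N"
          then show "JT \<eta> (g2 i) (p i)" using FL_JT[OF g(1), of i] JV by (cases "i = Suc N") (auto simp: g2_def)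
        next
          fix i assume "i < Suc N"
          then show "g2 i \<subseteq> g2 (Suc i)"
            using FL_mono[OF g(1), of i "Suc i"] FL_mono[OF g(1), of i N] FL_top[OF g(1)] by (auto simp: g2_def)
        qed (simp add: g2_def)
        then have "dim (ker_pow \<eta> k \<inter> f i \<inter> f' j) \<le> dim (ker_pow \<eta> k \<inter> g2 i \<inter> g' j)"
          using Suc.prems(1) g(2) ij unfolding minimal_pair_def by (meson le_SucI)
        then show "dim (ker_pow \<eta> k \<inter> f i \<inter> f' j) \<le> dim (ker_pow \<eta> k \<inter> g i \<inter> g' j)"
          using ij by (simp add: g2_def)
      qed
      from Suc.IH[OF this stepp Suc.prems(3,4) i Suc.prems(6)] show ?thesis .
    qed
  qed
qed simp

section \<open>Relative position of complete flags\<close>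

lemma complete_flags_dim: "f \<in> complete_flags \<Longrightarrow> i \<le> dim UNIV \<Longrightarrow> dim (f i) = i"
  by (simp add: complete_flags_def del: dim_UNIV)

lemma complete_flags_subspace: "f \<in> complete_flags \<Longrightarrow> subspace (f i)"
  by (simp add: complete_flags_def)

lemma complete_flags_Suc: "f \<in> complete_flags \<Longrightarrow> f i \<subseteq> f (Suc i)"
  by (simp add: complete_flags_def)

lemma adapted_span:
  assumes f: "f \<in> complete_flags" and e: "\<And>i. i < dim UNIV \<Longrightarrow> e i \<in> f (Suc i) \<and> e i \<notin> f i"
    and "i \<le> dim UNIV"
  shows "span (e ` {..<i}) = f i"
  using assms(3)
proof (induction i)
  case 0 then show ?case using f by (simp add: complete_flags_def)
next
  case (Suc i)
  have i: "i < dim UNIV" using Suc.prems by simp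
  have "dim (f (Suc i)) = Suc (dim (f i))" using complete_flags_dim[OF f] Suc.prems by simp
  then have "span (insert (e i) (f i)) = f (Suc i)"
    using e[OF i] complete_flags_subspace[OF f] complete_flags_Suc[OF f] by (intro hyperplane_decomp(1)) auto
  then show ?case using Suc.IH Suc.prems unfolding lessThan_Suc image_insert by (metis Suc_leD span_insert_span)
qed

text \<open>In coordinates dual to \<open>e\<close>, membership in the span of a subfamily forces
  all other coordinates to vanish.\<close>

lemma span_Int_dim:
  assumes inj: "inj_on e Y" and ind: "independent (e ` Y)" and fin: "finite Y" and AB: "A \<subseteq> Y" "B \<subseteq> Y"
  shows "dim (span (e ` A) \<inter> span (e ` B)) = card (A \<inter> B)"
proof -
  obtain co where co: "\<forall>p. fnl (co p)" "\<forall>p. \<forall>q\<in>Y. co p (e q) = (if p = q then 1 else 0)"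
    "\<forall>p x. p \<notin> Y \<longrightarrow> co p x = 0"
    by (rule dual_family[OF inj ind])
  have z: "co p x = 0" if "x \<in> span (e ` C)" "C \<subseteq> Y" "p \<notin> C" for p x C
  proof (rule dual.linear_eq_0_on_span)
    show "fnl (co p)" using co(1) by blast
    show "x \<in> span (e ` C)" by (rule that)
    fix y assume "y \<in> e ` C"
    then obtain c where c: "c \<in> C" "y = e c" by blast
    then have "co p (e c) = (if p = c then 1 else 0)" using co(2) that(2) by blast
    then show "co p y = 0" using c that(3) by auto
  qed
  have "span (e ` A) \<inter> span (e ` B) = span (e ` (A \<inter> B))"
  proof
    show "span (e ` (A \<inter> B)) \<subseteq> span (e ` A) \<inter> span (e ` B)"
      by (intro Int_greatest span_mono image_mono) auto
    show "span (e ` A) \<inter> span (e ` B) \<subseteq> span (e ` (A \<inter> B))"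
    proof
      fix x assume x: "x \<in> span (e ` A) \<inter> span (e ` B)"
      have "x \<in> span (e ` Y)" using x span_mono[OF image_mono[OF AB(1)]] by blast
      then have "x = (\<Sum>p\<in>Y. co p x *s e p)"
        using dual_family_expand[of Y co e x] fin co by blast
      also have "\<dots> \<in> span (e ` (A \<inter> B))"
      proof (rule span_sum)
        fix p assume "p \<in> Y"
        show "co p x *s e p \<in> span (e ` (A \<inter> B))"
        proof (cases "p \<in> A \<inter> B")
          case True then show ?thesis by (intro span_scale span_base) auto
        next
          case False
          then have "co p x = 0" using z[of x A p] z[of x B p] x AB by auto
          then show ?thesis by (simp add: span_zero)
        qed
      qed
      finally show "x \<in> span (e ` (A \<inter> B))" .
    qed
  qed
  moreover have "independent (e ` (A \<inter> B))" "inj_on e (A \<inter> B)"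
    using independent_mono[OF ind, of "e ` (A \<inter> B)"] inj_on_subset[OF inj, of "A \<inter> B"] AB by auto
  ultimately show ?thesis by (simp add: dim_eq_card_independent card_image)
qed

text \<open>The dimensions are the rank function of \<sigma>. For existence, each \<open>k\<close>
  yields a vector that enters \<open>f\<close> exactly at step \<open>Suc (\<sigma> k)\<close> and
  \<open>f'\<close> exactly at step \<open>Suc k\<close>; these vectors form the common basis. For
  uniqueness, an adapted basis for \<tau> shows that \<tau> has the same rank function, which
  determines it.\<close>

lemma relative_position_eqI:
  assumes f: "f \<in> complete_flags" and f': "f' \<in> complete_flags" and \<sigma>: "\<sigma> permutes {..<dim UNIV}"
    and d: "\<And>i j. i \<le> dim UNIV \<Longrightarrow> j \<le> dim UNIV \<Longrightarrow> dim (f i \<inter> f' j) = card {k. k < j \<and> \<sigma> k < i}"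
  shows "relative_position f f' = \<sigma>"
  unfolding relative_position_def
proof (rule the_equality)
  define n where "n = dim UNIV"
  note n = n_def[symmetric]
  have \<sigma>n: "\<sigma> k < n" if "k < n" for k using permutes_in_image[OF \<sigma>] that unfolding n by simp
  have \<sigma>inj: "\<sigma> k = \<sigma> l \<Longrightarrow> k = l" for k l using permutes_inj[OF \<sigma>] by (simp add: inj_def)
  have "\<exists>w. w \<in> f (Suc (\<sigma> k)) \<and> w \<notin> f (\<sigma> k) \<and> w \<in> f' (Suc k) \<and> w \<notin> f' k" if k: "k < n" for k
  proof -
    note D = d[unfolded n]
    have "dim (f (Suc (\<sigma> k)) \<inter> f' (Suc k)) = card {l. l < Suc k \<and> \<sigma> l < Suc (\<sigma> k)}"
      using D[of "Suc (\<sigma> k)" "Suc k"] k \<sigma>n[OF k] by simp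
    moreover have "dim (f (\<sigma> k) \<inter> f' (Suc k)) = card {l. l < Suc k \<and> \<sigma> l < \<sigma> k}"
      using D[of "\<sigma> k" "Suc k"] k \<sigma>n[OF k] by simp
    moreover have "card {l. l < Suc k \<and> \<sigma> l < Suc (\<sigma> k)} = Suc (card {l. l < k \<and> \<sigma> l < \<sigma> k})"
    proof -
      have "{l. l < k \<and> \<sigma> l < Suc (\<sigma> k)} = {l. l < k \<and> \<sigma> l < \<sigma> k}"
        using \<sigma>inj by (auto simp: less_Suc_eq)
      then show ?thesis using card_count_Suc[of k "\<lambda>l. \<sigma> l < Suc (\<sigma> k)"] by simp
    qed
    moreover have "card {l. l < Suc k \<and> \<sigma> l < \<sigma> k} = card {l. l < k \<and> \<sigma> l < \<sigma> k}"
      using card_count_Suc[of k "\<lambda>l. \<sigma> l < \<sigma> k"] by simp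
    ultimately have "dim (f (\<sigma> k) \<inter> f' (Suc k)) < dim (f (Suc (\<sigma> k)) \<inter> f' (Suc k))" by simp
    then have "\<not> f (Suc (\<sigma> k)) \<inter> f' (Suc k) \<subseteq> f (\<sigma> k) \<inter> f' (Suc k)" using dim_subset by (meson not_le)
    then obtain w where w: "w \<in> f (Suc (\<sigma> k))" "w \<in> f' (Suc k)" "w \<notin> f (\<sigma> k)" by blast
    \<comment> \<open>No \<open>l < k\<close> has \<open>\<sigma> l = \<sigma> k\<close>, so this
      intersection does not grow at \<open>\<sigma> k\<close>. As \<open>w\<close> is outside
      \<open>f (\<sigma> k)\<close>, it is outside \<open>f' k\<close> too.\<close>
    have "f (\<sigma> k) \<inter> f' k = f (Suc (\<sigma> k)) \<inter> f' k"
    proof (rule subspace_dim_equal)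
      show "subspace (f (\<sigma> k) \<inter> f' k)" "subspace (f (Suc (\<sigma> k)) \<inter> f' k)"
        by (intro subspace_inter complete_flags_subspace f f')+
      show "f (\<sigma> k) \<inter> f' k \<subseteq> f (Suc (\<sigma> k)) \<inter> f' k" using complete_flags_Suc[OF f] by blast
      have "{l. l < k \<and> \<sigma> l < Suc (\<sigma> k)} = {l. l < k \<and> \<sigma> l < \<sigma> k}"
        using \<sigma>inj by (auto simp: less_Suc_eq)
      then show "dim (f (Suc (\<sigma> k)) \<inter> f' k) \<le> dim (f (\<sigma> k) \<inter> f' k)"
        using D[of "Suc (\<sigma> k)" k] D[of "\<sigma> k" k] k \<sigma>n[OF k] by simp
    qed
    then have "w \<notin> f' k" using w by blast
    then show ?thesis using w by blast
  qed
  then have "\<forall>k. \<exists>w. k < n \<longrightarrow> w \<in> f (Suc (\<sigma> k)) \<and> w \<notin> f (\<sigma> k) \<and> w \<in> f' (Suc k) \<and> w \<notin> f' k" by blast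
  from choice[OF this] obtain w where w: "\<And>k. k < n \<Longrightarrow>
    w k \<in> f (Suc (\<sigma> k)) \<and> w k \<notin> f (\<sigma> k) \<and> w k \<in> f' (Suc k) \<and> w k \<notin> f' k" by blast
  define e where "e = restrict (\<lambda>i. w (inv \<sigma> i)) {..<n}"
  have e\<sigma>: "e (\<sigma> k) = w k" if "k < n" for k
    using \<sigma>n[OF that] permutes_inverses(2)[OF \<sigma>] by (simp add: e_def)
  have e: "e i \<in> f (Suc i) \<and> e i \<notin> f i" if "i < n" for i
  proof -
    have "inv \<sigma> i < n" using permutes_in_image[OF permutes_inv[OF \<sigma>]] that unfolding n by simp
    moreover have "\<sigma> (inv \<sigma> i) = i" by (rule permutes_inverses(1)[OF \<sigma>])
    ultimately show ?thesis using w[of "inv \<sigma> i"] that by (simp add: e_def)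
  qed
  have s1: "span (e ` {..<i}) = f i" if "i \<le> n" for i
    using adapted_span[OF f, of e i] e that unfolding n by blast
  have s2: "span ((\<lambda>k. e (\<sigma> k)) ` {..<i}) = f' i" if "i \<le> n" for i
    using adapted_span[OF f', of "\<lambda>k. e (\<sigma> k)" i] e\<sigma> w that unfolding n by simp
  have "span (e ` {..<n}) = UNIV" using s1[of n] f unfolding n_def by (simp add: complete_flags_def del: dim_UNIV)
  moreover have "famind {..<n} e"
  proof (rule famind_if_dim)
    have "dim (e ` {..<n}) = n" using calculation unfolding n_def by (metis dim_span)
    then show "card {..<n} \<le> dim (e ` {..<n})" by simp
  qed simp
  ultimately have "e \<in> frames" by (simp add: frames_def famind_iff n e_def del: dim_UNIV)
  then show "\<sigma> permutes {..<dim UNIV} \<and> (\<exists>e\<in>frames. \<forall>i\<le>dim UNIV.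
      f i = span (e ` {..<i}) \<and> f' i = span ((\<lambda>k. e (\<sigma> k)) ` {..<i}))"
    using s1 s2 \<sigma> unfolding n by blast
next
  fix \<tau> assume \<tau>: "\<tau> permutes {..<dim UNIV} \<and> (\<exists>e\<in>frames. \<forall>i\<le>dim UNIV.
      f i = span (e ` {..<i}) \<and> f' i = span ((\<lambda>k. e (\<tau> k)) ` {..<i}))"
  define n where "n = dim UNIV"
  note n = n_def[symmetric]
  have perm: "\<tau> permutes {..<n}" using \<tau> unfolding n by blast
  from \<tau> obtain e where e0: "e \<in> frames" "\<forall>i\<le>n. f i = span (e ` {..<i}) \<and> f' i = span ((\<lambda>k. e (\<tau> k)) ` {..<i})"
    unfolding n by (elim conjE bexE)
  have e: "f i = span (e ` {..<i})" "f' i = span ((\<lambda>k. e (\<tau> k)) ` {..<i})" if "i \<le> n" for i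
    using e0(2) that by simp_all
  have fr: "inj_on e {..<n}" "independent (e ` {..<n})"
    using e0(1) unfolding frames_def n by simp_all
  have card: "card {k. k < j \<and> \<tau> k < i} = card {k. k < j \<and> \<sigma> k < i}" if ij: "i \<le> n" "j \<le> n" for i j
  proof -
    have "\<tau> ` {..<j} \<subseteq> \<tau> ` {..<n}" using ij(2) by (intro image_mono) simp
    then have "\<tau> ` {..<j} \<subseteq> {..<n}" using permutes_image[OF perm] by simp
    then have "dim (span (e ` {..<i}) \<inter> span (e ` \<tau> ` {..<j})) = card ({..<i} \<inter> \<tau> ` {..<j})"
      using fr ij by (intro span_Int_dim[of e "{..<n}"]) auto
    also have "{..<i} \<inter> \<tau> ` {..<j} = \<tau> ` {k. k < j \<and> \<tau> k < i}" by auto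
    also have "card \<dots> = card {k. k < j \<and> \<tau> k < i}"
      using permutes_inj[OF perm] by (intro card_image) (auto intro: inj_on_subset)
    finally have "dim (f i \<inter> f' j) = card {k. k < j \<and> \<tau> k < i}"
      using e(1)[OF ij(1)] e(2)[OF ij(2)] by (simp add: image_comp o_def)
    then show ?thesis using d[unfolded n, OF ij] by simp
  qed
  have iff: "\<tau> k < i \<longleftrightarrow> \<sigma> k < i" if "k < n" "i \<le> n" for k i
    using card[of i k] card[of i "Suc k"] card_count_Suc[of k "\<lambda>k. \<tau> k < i"] card_count_Suc[of k "\<lambda>k. \<sigma> k < i"] that
    by (auto split: if_splits)
  show "\<tau> = \<sigma>"
  proof
    fix k show "\<tau> k = \<sigma> k"
    proof (cases "k < n")
      case True
      have "\<tau> k < n" "\<sigma> k < n" using permutes_in_image[OF perm, of k] permutes_in_image[OF \<sigma>, of k] True unfolding n by simp_all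
      then show ?thesis using iff[OF True, of "Suc (\<sigma> k)"] iff[OF True, of "Suc (\<tau> k)"] by auto
    next
      case False
      then show ?thesis using permutes_not_in[OF perm, of k] permutes_not_in[OF \<sigma>, of k] unfolding n by simp
    qed
  qed
qed


section \<open>The tableau of a stable flag\<close>

lemma psize_restr_SYT:
  assumes "P \<in> SYT lam" "i \<le> psize lam"
  shows "psize (restr i P) = i"
proof -
  have P: "distinct (concat P)" "set (concat P) = {..<psize lam}" using assms(1) by (auto simp: SYT_def)
  have "psize (restr i P) = length (filter (\<lambda>x. x < i) (concat P))"
    by (simp add: psize_shape filter_concat)
  also have "\<dots> = card (set (filter (\<lambda>x. x < i) (concat P)))" using P(1) by (intro distinct_card[symmetric]) simp
  also have "set (filter (\<lambda>x. x < i) (concat P)) = {..<i}"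
    unfolding set_filter P(2) using assms(2) by auto
  finally show ?thesis by simp
qed

text \<open>The types of the members start at the empty partition and gain one square at each step,
  so they are the chain of a unique tableau \<open>T\<close>; equality of \<open>T\<close> with
  \<open>P\<close> is equality of chains.\<close>

lemma flag_tableau_iff:
  assumes lin: "lin \<eta>" and JU: "JT \<eta> UNIV lam" and P: "P \<in> SYT lam" and f: "f \<in> stable_flags \<eta>"
  shows "flag_tableau \<eta> f = P \<longleftrightarrow> (\<forall>i\<le>dim UNIV. JT \<eta> (f i) (restr i P))"
proof -
  define n where "n = dim UNIV"
  note n = n_def[symmetric]
  have fc: "f \<in> complete_flags" and st: "\<And>i. \<eta> ` f i \<subseteq> f i" using f by (auto simp: stable_flags_def)
  have lam: "jordan_type \<eta> UNIV = lam" by (rule JT_jordan_type[OF JU lin])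
  have pn: "psize lam = n" using JT_dim[OF JU] by (simp add: n_def del: dim_UNIV)
  define q where "q = (\<lambda>i. jordan_type \<eta> (f i))"
  have Jq: "JT \<eta> (f i) (q i)" for i
    using JT_exists_sub[OF lin JU complete_flags_subspace[OF fc] subset_UNIV st[of i]] JT_jordan_type[OF _ lin]
    unfolding q_def by metis
  have "dim (f 0) = 0" using complete_flags_dim[OF fc, of 0] by simp
  then have "psize (q 0) = 0" using JT_dim[OF Jq] by metis
  then have q0: "q 0 = (\<lambda>_. 0)"
    using is_partition_finite[OF JT_partition[OF Jq[of 0]]] by (auto simp: psize_def)
  have qS: "q i \<prec> q (Suc i)" if "i < n" for i
    using JT_hyperplane_prec[OF lin Jq Jq complete_flags_Suc[OF fc]] complete_flags_dim[OF fc] that unfolding n by simp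
  have "f n = UNIV" using fc unfolding n_def by (simp add: complete_flags_def del: dim_UNIV)
  then have qn: "q n = lam" using lam by (simp add: q_def)
  obtain T where T: "T \<in> SYT lam" "\<And>m. m \<le> n \<Longrightarrow> restr m T = q m"
    using SYT_of_chain[of q n] q0 qS JT_partition[OF Jq] qn by metis
  have chain: "shape_chain T' = map (\<lambda>i. jordan_type \<eta> (f i)) (rev [0..<n + 1]) \<longleftrightarrow> (\<forall>m\<le>n. restr m T' = q m)"
    if "T' \<in> SYT lam" for T'
    using shape_chain_eq_iff[of T' n q] that pn unfolding q_def by (simp add: SYT_def)
  have uniq: "T' = T" if "T' \<in> SYT lam" "\<forall>m\<le>n. restr m T' = q m" for T'
    by (rule SYT_unique[OF that(1) T(1)]) (use that(2) T(2) pn in auto)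
  have "flag_tableau \<eta> f = T"
    unfolding flag_tableau_def n lam
  proof (rule the_equality)
    show "T \<in> SYT lam \<and> shape_chain T = map (\<lambda>i. jordan_type \<eta> (f i)) (rev [0..<n + 1])"
      using T chain[OF T(1)] by blast
    show "T' = T" if "T' \<in> SYT lam \<and> shape_chain T' = map (\<lambda>i. jordan_type \<eta> (f i)) (rev [0..<n + 1])" for T'
      using uniq chain that by blast
  qed
  moreover have "T = P \<longleftrightarrow> (\<forall>i\<le>n. JT \<eta> (f i) (restr i P))"
  proof
    assume "T = P" then show "\<forall>i\<le>n. JT \<eta> (f i) (restr i P)" using T(2) Jq by metis
  next
    assume "\<forall>i\<le>n. JT \<eta> (f i) (restr i P)"
    then have "\<forall>m\<le>n. restr m P = q m" using JT_unique[OF _ Jq lin] by blast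
    then show "T = P" using uniq[OF P] by simp
  qed
  ultimately show ?thesis unfolding n by simp
qed

text \<open>Translation to the flags of the previous sections. \<open>FL\<close> leaves members
  beyond the dimension free, hence the extra condition.\<close>

lemma tableau_flags_iff:
  assumes lin: "lin \<eta>" and JU: "JT \<eta> UNIV lam" and P: "P \<in> SYT lam"
  shows "f \<in> tableau_flags \<eta> P \<longleftrightarrow>
    f \<in> FL \<eta> UNIV (dim UNIV) (\<lambda>i. restr i P) \<and> (\<forall>i\<ge>dim UNIV. f i = UNIV)"
proof -
  define n where "n = dim UNIV"
  note n = n_def[symmetric]
  have pn: "psize lam = n" using JT_dim[OF JU] by (simp add: n_def del: dim_UNIV)
  show ?thesis unfolding n
  proof
    assume "f \<in> tableau_flags \<eta> P"
    then have f: "f \<in> stable_flags \<eta>" "flag_tableau \<eta> f = P" by (auto simp: tableau_flags_def)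
    then have J: "\<forall>i\<le>n. JT \<eta> (f i) (restr i P)" using flag_tableau_iff[OF lin JU P f(1)] unfolding n by simp
    have "f \<in> complete_flags" using f(1) by (simp add: stable_flags_def)
    then show "f \<in> FL \<eta> UNIV n (\<lambda>i. restr i P) \<and> (\<forall>i\<ge>n. f i = UNIV)"
      using J by (auto simp: FL_def complete_flags_def n simp del: dim_UNIV)
  next
    assume h: "f \<in> FL \<eta> UNIV n (\<lambda>i. restr i P) \<and> (\<forall>i\<ge>n. f i = UNIV)"
    then have f: "f \<in> FL \<eta> UNIV n (\<lambda>i. restr i P)" and top: "\<And>i. n \<le> i \<Longrightarrow> f i = UNIV" by auto
    have d: "dim (f i) = i" if "i \<le> n" for i
      using FL_dim[OF f that] psize_restr_SYT[OF P] pn that by simp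
    have "f \<in> stable_flags \<eta>"
      unfolding stable_flags_def complete_flags_def mem_Collect_eq n
    proof (intro conjI allI impI)
      fix i
      show "subspace (f i)" using JT_subspace[OF FL_JT[OF f]] top by (cases "i \<le> n") auto
      show "f i \<subseteq> f (i + 1)" using FL_mono[OF f, of i "Suc i"] top by (cases "i < n") auto
      show "\<eta> ` f i \<subseteq> f i"
      proof (cases "i \<le> n")
        case True then show ?thesis by (rule JT_stable[OF FL_JT[OF f] lin])
      qed (use top in simp)
    next
      have "f 0 \<subseteq> {0}" using d[of 0] by simp
      then show "f 0 = {0}" using subspace_0[OF JT_subspace[OF FL_JT[OF f, of 0]]] by auto
    qed (use d top in auto)
    moreover have "\<forall>i\<le>n. JT \<eta> (f i) (restr i P)" using FL_JT[OF f] by blast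
    ultimately show "f \<in> tableau_flags \<eta> P"
      using flag_tableau_iff[OF lin JU P] unfolding tableau_flags_def n by blast
  qed
qed

end

section \<open>Irreducibility and the generic pair\<close>


lemma zariski_open_if_locally:
  assumes "U \<subseteq> X" "\<And>x. x \<in> U \<Longrightarrow> \<exists>p\<in>poly_funs C. p x \<noteq> 0 \<and> (\<forall>y\<in>X. p y \<noteq> 0 \<longrightarrow> y \<in> U)"
  shows "zariski_open X C U"
  unfolding zariski_open_def
proof (intro conjI exI[of _ "{p \<in> poly_funs C. \<forall>y\<in>X - U. p y = 0}"])
  show "X - U = {x \<in> X. \<forall>p\<in>{p \<in> poly_funs C. \<forall>y\<in>X - U. p y = 0}. p x = 0}"
    using assms(2) by blast
qed (use assms(1) in auto)

lemma zariski_openE: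
  assumes "zariski_open X C U" "x \<in> U"
  obtains p where "p \<in> poly_funs C" "p x \<noteq> 0" "\<And>y. y \<in> X \<Longrightarrow> p y \<noteq> 0 \<Longrightarrow> y \<in> U"
proof -
  obtain S where S: "U \<subseteq> X" "S \<subseteq> poly_funs C" "X - U = {x \<in> X. \<forall>p\<in>S. p x = 0}"
    using assms(1) unfolding zariski_open_def by blast
  have "x \<notin> {x \<in> X. \<forall>p\<in>S. p x = 0}" unfolding S(3)[symmetric] using assms(2) by simp
  then obtain p where p: "p \<in> S" "p x \<noteq> 0" using assms(2) S(1) by blast
  have "y \<in> U" if "y \<in> X" "p y \<noteq> 0" for y
  proof (rule ccontr)
    assume "y \<notin> U"
    then have "y \<in> {x \<in> X. \<forall>p\<in>S. p x = 0}" unfolding S(3)[symmetric] using that by simp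
    then show False using p(1) that(2) by blast
  qed
  then show thesis using that p S(2) by blast
qed

context fd_flag_space
begin

abbreviation flag_pair :: "(nat \<Rightarrow> 'b) \<times> (nat \<Rightarrow> 'b) \<Rightarrow> (nat \<Rightarrow> 'b set) \<times> (nat \<Rightarrow> 'b set)" where
  "flag_pair \<equiv> \<lambda>(e, e'). (flag_of e, flag_of e')"

lemma openin_flag_pairs:
  "openin flag_pairs_zariski A \<longleftrightarrow> A \<subseteq> flag_pair ` (frames \<times> frames) \<and>
     zariski_open (frames \<times> frames) frame_pair_coords {x \<in> frames \<times> frames. flag_pair x \<in> A}"
  unfolding flag_pairs_zariski_def openin_quotient_topology openin_zariski topspace_zariski ..

lemma frames_famind:
  assumes "e \<in> frames" "i \<le> dim UNIV"
  shows "famind {..<i} e"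
proof -
  have e: "inj_on e {..<dim UNIV}" "independent (e ` {..<dim UNIV})"
    using assms(1) unfolding frames_def by blast+
  have sub: "{..<i} \<subseteq> {..<dim UNIV}" using assms(2) by (auto simp del: dim_UNIV)
  have "independent (e ` {..<i})" by (rule independent_mono[OF e(2) image_mono[OF sub]])
  then show ?thesis using inj_on_subset[OF e(1) sub] by (simp add: famind_iff)
qed

lemma regular_frame_pair:
  assumes "k < dim UNIV"
  shows "regular frame_pair_coords (\<lambda>x. fst x k)" "regular frame_pair_coords (\<lambda>x. snd x k)"
  unfolding regular_def
proof (safe intro!: poly_funs.coord)
  fix \<phi> :: "'b \<Rightarrow> 'a" assume \<phi>: "fnl \<phi>"
  have "(\<lambda>x. \<phi> (fst x k)) = (\<lambda>(e, e'). \<phi> (e k))" for e' :: "nat \<Rightarrow> 'b" by auto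
  then show "(\<lambda>x. \<phi> (fst x k)) \<in> frame_pair_coords"
    unfolding frame_pair_coords_def using \<phi> assms by blast
  have "(\<lambda>x. \<phi> (snd x k)) = (\<lambda>(e, e'). \<phi> (e' k))" for e' :: "nat \<Rightarrow> 'b" by auto
  then show "(\<lambda>x. \<phi> (snd x k)) \<in> frame_pair_coords"
    unfolding frame_pair_coords_def using \<phi> assms by blast
qed

definition small_Int :: "'b set \<Rightarrow> nat \<Rightarrow> nat \<Rightarrow> nat \<Rightarrow> ((nat \<Rightarrow> 'b set) \<times> (nat \<Rightarrow> 'b set)) set" where
  "small_Int K i j d = {x \<in> flag_pair ` (frames \<times> frames). dim (K \<inter> fst x i \<inter> snd x j) \<le> d}"

text \<open>Checked upstairs on frames: there the members of both flags are spanned by independent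
  families that are polynomial in the point, so \<open>dim_Int_generic\<close> applies.\<close>

lemma openin_small_Int:
  assumes K: "subspace K" and ij: "i \<le> dim UNIV" "j \<le> dim UNIV"
  shows "openin flag_pairs_zariski (small_Int K i j d)"
  unfolding openin_flag_pairs
proof
  show "small_Int K i j d \<subseteq> flag_pair ` (frames \<times> frames)" by (auto simp: small_Int_def)
  show "zariski_open (frames \<times> frames) frame_pair_coords {x \<in> frames \<times> frames. flag_pair x \<in> small_Int K i j d}"
  proof (rule zariski_open_if_locally)
    fix x0 assume x0: "x0 \<in> {x \<in> frames \<times> frames. flag_pair x \<in> small_Int K i j d}"
    let ?A = "\<lambda>x. K \<inter> span ((\<lambda>k. fst x k) ` {..<i}) \<inter> span ((\<lambda>k. snd x k) ` {..<j})"
    have eq: "flag_pair x \<in> small_Int K i j d \<longleftrightarrow> dim (?A x) \<le> d" if "x \<in> frames \<times> frames" for x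
      using that ij by (auto simp: small_Int_def flag_of_def min_def split: prod.splits simp del: dim_UNIV)
    have fam: "famind {..<i} (\<lambda>k. fst x0 k)" "famind {..<j} (\<lambda>k. snd x0 k)"
      using x0 frames_famind[OF _ ij(1), of "fst x0"] frames_famind[OF _ ij(2), of "snd x0"] by auto
    have "\<exists>p\<in>poly_funs frame_pair_coords. p x0 \<noteq> 0 \<and> (\<forall>x. p x \<noteq> 0 \<longrightarrow> dim (?A x) \<le> dim (?A x0))"
    proof (rule dim_Int_generic[where I="{..<i}" and J="{..<j}" and e="\<lambda>k x. fst x k"
          and e'="\<lambda>k x. snd x k" and ?x0.0=x0])
      show "regular frame_pair_coords (\<lambda>x. fst x k)" if "k \<in> {..<i}" for k
        by (rule regular_frame_pair(1)) (use that ij in \<open>auto simp del: dim_UNIV\<close>)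
      show "regular frame_pair_coords (\<lambda>x. snd x k)" if "k \<in> {..<j}" for k
        by (rule regular_frame_pair(2)) (use that ij in \<open>auto simp del: dim_UNIV\<close>)
    qed (use K fam in auto)
    then obtain p where p: "p \<in> poly_funs frame_pair_coords" "p x0 \<noteq> 0"
      "\<forall>x. p x \<noteq> 0 \<longrightarrow> dim (?A x) \<le> dim (?A x0)" by blast
    have d0: "dim (?A x0) \<le> d" using x0 eq by blast
    have "y \<in> {x \<in> frames \<times> frames. flag_pair x \<in> small_Int K i j d}" if "y \<in> frames \<times> frames" "p y \<noteq> 0" for y
      using p(3) that eq[OF that(1)] d0 le_trans by blast
    then show "\<exists>p\<in>poly_funs frame_pair_coords. p x0 \<noteq> 0 \<and> (\<forall>y\<in>frames \<times> frames. p y \<noteq> 0 \<longrightarrow>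
        y \<in> {x \<in> frames \<times> frames. flag_pair x \<in> small_Int K i j d})" using p(1,2) by blast
  qed blast
qed

text \<open>The \<open>restrict\<close> is needed because \<open>frames\<close> consists of
  extensional functions.\<close>

lemma frame_of_span:
  assumes "span (v ` {..<dim UNIV}) = UNIV"
  shows "restrict v {..<dim UNIV} \<in> frames"
    and "i \<le> dim UNIV \<Longrightarrow> flag_of (restrict v {..<dim UNIV}) i = span (v ` {..<i})"
    and "dim UNIV \<le> i \<Longrightarrow> flag_of (restrict v {..<dim UNIV}) i = UNIV"
proof -
  define n where "n = dim UNIV"
  note n = n_def[symmetric]
  have im: "restrict v {..<n} ` {..<i} = v ` {..<i}" if "i \<le> n" for i
    using that by (intro image_cong) auto
  have sp: "span (v ` {..<n}) = UNIV" using assms unfolding n .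
  then have "dim (v ` {..<n}) = n" unfolding n_def by (metis dim_span)
  then have "famind {..<n} v" by (intro famind_if_dim) auto
  then have "inj_on v {..<n}" "independent (v ` {..<n})" by (auto simp: famind_iff)
  then show "restrict v {..<dim UNIV} \<in> frames"
    unfolding frames_def n using im[of n] sp by (auto simp: inj_on_def)
  show "i \<le> dim UNIV \<Longrightarrow> flag_of (restrict v {..<dim UNIV}) i = span (v ` {..<i})"
    unfolding flag_of_def n using im[of i] by (simp add: min_def)
  show "flag_of (restrict v {..<dim UNIV}) i = UNIV" if "dim UNIV \<le> i"
  proof -
    have "min i n = n" using that unfolding n by simp
    then show ?thesis unfolding flag_of_def n by (simp only: im[OF order_refl] sp)
  qed
qed

section \<open>Pairs of flags with prescribed tableaux\<close>

context
  fixes \<eta> :: "'b \<Rightarrow> 'b" and lam :: "nat \<Rightarrow> nat" and P Q :: "nat list list"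
  assumes lin: "lin \<eta>" and JU: "JT \<eta> UNIV lam" and P: "P \<in> SYT lam" and Q: "Q \<in> SYT lam"
    and inf: "infinite (UNIV :: 'a set)"
begin

abbreviation (input) PQ :: "((nat \<Rightarrow> 'b set) \<times> (nat \<Rightarrow> 'b set)) set" where
  "PQ \<equiv> tableau_flags \<eta> P \<times> tableau_flags \<eta> Q"

lemma psize_lam: "psize lam = dim UNIV"
  using JT_dim[OF JU] by simp

text \<open>This is \<open>flag_curve\<close> for the chain of \<open>T\<close>. Member
  \<open>i\<close> has dimension \<open>i\<close> there, so outside the exceptional set the moving
  vectors form a frame.\<close>

lemma tableau_curve:
  assumes T: "T \<in> SYT lam" and f: "f \<in> tableau_flags \<eta> T" and g: "g \<in> tableau_flags \<eta> T"
  obtains e E where "finite E" "0 \<notin> E" "1 \<notin> E" "\<forall>k. regular {\<lambda>t. t} (e k)"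
    "\<forall>t. t \<notin> E \<longrightarrow> restrict (\<lambda>k. e k t) {..<dim UNIV} \<in> frames \<and>
       flag_of (restrict (\<lambda>k. e k t) {..<dim UNIV}) \<in> tableau_flags \<eta> T"
    "flag_of (restrict (\<lambda>k. e k 0) {..<dim UNIV}) = f"
    "flag_of (restrict (\<lambda>k. e k 1) {..<dim UNIV}) = g"
proof -
  define n where "n = dim UNIV"
  note n = n_def[symmetric]
  note iff = tableau_flags_iff[OF lin JU T, unfolded n]
  have ps: "psize (restr i T) = i" if "i \<le> n" for i
    using psize_restr_SYT[OF T] psize_lam that unfolding n by simp
  have "\<forall>j<n. psize (restr (Suc j) T) \<le> Suc (psize (restr j T))" using ps by simp
  note curve = flag_curve[OF lin this]
  have "f \<in> FL \<eta> UNIV n (\<lambda>i. restr i T)" "g \<in> FL \<eta> UNIV n (\<lambda>i. restr i T)"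
    using f g unfolding iff by (blast, blast)
  from curve[OF this] obtain e E where e: "finite E" "0 \<notin> E" "1 \<notin> E" "\<forall>k. regular {\<lambda>t. t} (e k)"
    and fl: "\<forall>t. t \<notin> E \<longrightarrow> (\<lambda>j. span ((\<lambda>k. e k t) ` {..<psize (restr j T)})) \<in> FL \<eta> UNIV n (\<lambda>i. restr i T)"
    and ends: "\<forall>j\<le>n. span ((\<lambda>k. e k 0) ` {..<psize (restr j T)}) = f j \<and>
        span ((\<lambda>k. e k 1) ` {..<psize (restr j T)}) = g j" by (elim exE conjE)
  have sp: "span ((\<lambda>k. e k t) ` {..<n}) = UNIV" if "t \<notin> E" for t
    using FL_top[OF fl[rule_format, OF that]] ps[of n] by simp
  note fs = frame_of_span[unfolded n, OF sp]
  have A: "restrict (\<lambda>k. e k t) {..<n} \<in> frames \<and> flag_of (restrict (\<lambda>k. e k t) {..<n}) \<in> tableau_flags \<eta> T"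
    if t: "t \<notin> E" for t
  proof
    show "restrict (\<lambda>k. e k t) {..<n} \<in> frames" by (rule fs(1)[OF t])
    have "flag_of (restrict (\<lambda>k. e k t) {..<n}) \<in> FL \<eta> UNIV n (\<lambda>i. restr i T)"
      by (rule FL_cong[OF fl[rule_format, OF t]]) (simp add: fs(2)[OF t] ps)
    then show "flag_of (restrict (\<lambda>k. e k t) {..<n}) \<in> tableau_flags \<eta> T"
      using iff fs(3)[OF t] by blast
  qed
  have B: "flag_of (restrict (\<lambda>k. e k t) {..<n}) = h"
    if t: "t \<notin> E" and h: "h \<in> tableau_flags \<eta> T"
      "\<forall>j\<le>n. span ((\<lambda>k. e k t) ` {..<psize (restr j T)}) = h j" for t h
  proof
    fix i show "flag_of (restrict (\<lambda>k. e k t) {..<n}) i = h i"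
    proof (cases "i \<le> n")
      case True
      have "span ((\<lambda>k. e k t) ` {..<psize (restr i T)}) = h i" using h(2) True by blast
      then show ?thesis unfolding fs(2)[OF t True] ps[OF True] .
    next
      case False
      have "\<forall>i\<ge>n. h i = UNIV" using h(1) unfolding iff by (rule conjunct2)
      then show ?thesis using fs(3)[OF t, of i] False by simp
    qed
  qed
  show thesis
    by (rule that[of E e, unfolded n, OF e]) (use A B[OF e(2) f] B[OF e(3) g] ends in auto)
qed


text \<open>One parameter moves both flags, from \<open>x\<close> at 0 to \<open>y\<close> at 1,
  which treats the product directly. Lying in \<open>A\<close> and in \<open>B\<close> is implied by
  the nonvanishing of polynomials in \<open>t\<close> that are nonzero at 0 and at 1 respectively,
  and some parameter outside the exceptional sets is a root of neither.\<close>

lemma PQ_irreducible: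
  assumes A: "openin flag_pairs_zariski A" "x \<in> A \<inter> PQ" and B: "openin flag_pairs_zariski B" "y \<in> B \<inter> PQ"
  shows "A \<inter> B \<inter> PQ \<noteq> {}"
proof -
  define n where "n = dim UNIV"
  note n = n_def[symmetric]
  obtain f f' g g' where xy: "x = (f, f')" "y = (g, g')" by (cases x, cases y)
  have f: "f \<in> tableau_flags \<eta> P" "g \<in> tableau_flags \<eta> P" "f' \<in> tableau_flags \<eta> Q" "g' \<in> tableau_flags \<eta> Q"
    using A(2) B(2) xy by auto
  obtain e E where e: "finite E" "0 \<notin> E" "1 \<notin> E" "\<forall>k. regular {\<lambda>t. t} (e k)"
    "\<forall>t. t \<notin> E \<longrightarrow> restrict (\<lambda>k. e k t) {..<n} \<in> frames \<and>
       flag_of (restrict (\<lambda>k. e k t) {..<n}) \<in> tableau_flags \<eta> P"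
    "flag_of (restrict (\<lambda>k. e k 0) {..<n}) = f" "flag_of (restrict (\<lambda>k. e k 1) {..<n}) = g"
    by (rule tableau_curve[OF P f(1,2), unfolded n])
  obtain e' E' where e': "finite E'" "0 \<notin> E'" "1 \<notin> E'" "\<forall>k. regular {\<lambda>t. t} (e' k)"
    "\<forall>t. t \<notin> E' \<longrightarrow> restrict (\<lambda>k. e' k t) {..<n} \<in> frames \<and>
       flag_of (restrict (\<lambda>k. e' k t) {..<n}) \<in> tableau_flags \<eta> Q"
    "flag_of (restrict (\<lambda>k. e' k 0) {..<n}) = f'" "flag_of (restrict (\<lambda>k. e' k 1) {..<n}) = g'"
    by (rule tableau_curve[OF Q f(3,4), unfolded n])
  define F where "F = (\<lambda>t. (restrict (\<lambda>k. e k t) {..<n}, restrict (\<lambda>k. e' k t) {..<n}))"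
  have coord: "(\<lambda>t. c (F t)) \<in> poly_funs {\<lambda>t. t}" if "c \<in> frame_pair_coords" for c
  proof -
    have "(\<exists>\<phi> i. c = (\<lambda>(e, e'). \<phi> (e i)) \<and> fnl \<phi> \<and> i < n) \<or>
      (\<exists>\<phi> i. c = (\<lambda>(e, e'). \<phi> (e' i)) \<and> fnl \<phi> \<and> i < n)"
      using that unfolding frame_pair_coords_def n Un_iff mem_Collect_eq .
    then show ?thesis
    proof (elim disjE exE conjE)
      fix \<phi> i assume "c = (\<lambda>(e, e'). \<phi> (e i))" "fnl \<phi>" "i < n"
      then show ?thesis using e(4) by (simp add: F_def regular_def)
    next
      fix \<phi> i assume "c = (\<lambda>(e, e'). \<phi> (e' i))" "fnl \<phi>" "i < n"
      then show ?thesis using e'(4) by (simp add: F_def regular_def)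
    qed
  qed
  have gen: "\<exists>p\<in>poly_funs {\<lambda>t. t}. p t0 \<noteq> 0 \<and> (\<forall>t. p t \<noteq> 0 \<and> F t \<in> frames \<times> frames \<longrightarrow> flag_pair (F t) \<in> D)"
    if D: "openin flag_pairs_zariski D" "flag_pair (F t0) \<in> D" "F t0 \<in> frames \<times> frames" for D t0
  proof -
    have "zariski_open (frames \<times> frames) frame_pair_coords {x \<in> frames \<times> frames. flag_pair x \<in> D}"
      using D(1) unfolding openin_flag_pairs by blast
    moreover have "F t0 \<in> {x \<in> frames \<times> frames. flag_pair x \<in> D}" using D(2,3) by blast
    ultimately obtain p where p: "p \<in> poly_funs frame_pair_coords" "p (F t0) \<noteq> 0"
      "\<And>y. y \<in> frames \<times> frames \<Longrightarrow> p y \<noteq> 0 \<Longrightarrow> y \<in> {x \<in> frames \<times> frames. flag_pair x \<in> D}"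
      by (rule zariski_openE) blast
    have "(\<lambda>t. p (F t)) \<in> poly_funs {\<lambda>t. t}" by (rule poly_funs_compose[OF p(1) coord])
    then show ?thesis using p(2,3) by (intro bexI[of _ "\<lambda>t. p (F t)"]) auto
  qed
  have Ffr: "F t \<in> frames \<times> frames" "flag_pair (F t) \<in> PQ" if "t \<notin> E" "t \<notin> E'" for t
    using e(5) e'(5) that by (simp_all add: F_def)
  have F01: "flag_pair (F 0) = x" "flag_pair (F 1) = y" using e(6,7) e'(6,7) xy by (simp_all add: F_def)
  obtain p where p: "p \<in> poly_funs {\<lambda>t. t}" "p 0 \<noteq> 0"
    "\<forall>t. p t \<noteq> 0 \<and> F t \<in> frames \<times> frames \<longrightarrow> flag_pair (F t) \<in> A"
    using gen[OF A(1), of 0] A(2) F01(1) Ffr(1)[OF e(2) e'(2)] by auto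
  obtain q where q: "q \<in> poly_funs {\<lambda>t. t}" "q 1 \<noteq> 0"
    "\<forall>t. q t \<noteq> 0 \<and> F t \<in> frames \<times> frames \<longrightarrow> flag_pair (F t) \<in> B"
    using gen[OF B(1), of 1] B(2) F01(2) Ffr(1)[OF e(3) e'(3)] by auto
  have "finite (E \<union> E' \<union> {t. p t = 0} \<union> {t. q t = 0})"
    using e(1) e'(1) poly_funs_finite_zeros[OF p(1,2)] poly_funs_finite_zeros[OF q(1,2)] by simp
  from ex_new_if_finite[OF inf this] obtain t where t: "t \<notin> E \<union> E' \<union> {t. p t = 0} \<union> {t. q t = 0}" ..
  have tE: "t \<notin> E" "t \<notin> E'" "p t \<noteq> 0" "q t \<noteq> 0" using t by auto
  have "flag_pair (F t) \<in> A" by (rule p(3)[THEN spec, THEN mp, OF conjI, OF tE(3) Ffr(1)[OF tE(1,2)]])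
  moreover have "flag_pair (F t) \<in> B" by (rule q(3)[THEN spec, THEN mp, OF conjI, OF tE(4) Ffr(1)[OF tE(1,2)]])
  ultimately have "flag_pair (F t) \<in> A \<inter> B \<inter> PQ" using Ffr(2)[OF tE(1,2)] by (intro IntI)
  then show ?thesis by (metis empty_iff)
qed

lemma PQ_subset_flags: "PQ \<subseteq> flag_pair ` (frames \<times> frames)"
proof
  fix x assume x: "x \<in> PQ"
  obtain f f' where xf: "x = (f, f')" by (cases x)
  have f: "f \<in> tableau_flags \<eta> P" "f' \<in> tableau_flags \<eta> Q" using x xf by auto
  have "\<exists>e\<in>frames. flag_of e = f"
    by (rule tableau_curve[OF P f(1) f(1)]) metis
  moreover have "\<exists>e\<in>frames. flag_of e = f'"
    by (rule tableau_curve[OF Q f(2) f(2)]) metis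
  ultimately show "x \<in> flag_pair ` (frames \<times> frames)" using xf by force
qed

lemma openin_all_flags: "openin flag_pairs_zariski (flag_pair ` (frames \<times> frames))"
proof -
  have "{x \<in> frames \<times> frames. flag_pair x \<in> flag_pair ` (frames \<times> frames)} = frames \<times> frames" by blast
  moreover have "zariski_open (frames \<times> frames) frame_pair_coords (frames \<times> frames)"
    by (rule zariski_open_if_locally) (auto intro!: bexI[of _ "\<lambda>_. 1"] poly_funs.const)
  ultimately show ?thesis unfolding openin_flag_pairs by simp
qed

text \<open>By induction, irreducibility passes from two open sets to finitely many.\<close>

lemma generic_subset:
  assumes "finite I" "\<And>i. i \<in> I \<Longrightarrow> openin flag_pairs_zariski (D i)" "\<And>i. i \<in> I \<Longrightarrow> D i \<inter> PQ \<noteq> {}"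
    and ne: "PQ \<noteq> {}"
  shows "\<exists>A. openin flag_pairs_zariski A \<and> A \<inter> PQ = PQ \<inter> (\<Inter>i\<in>I. D i) \<and> A \<inter> PQ \<noteq> {}"
  using assms(1-3)
proof (induction I rule: finite_induct)
  case empty
  show ?case
    using openin_all_flags PQ_subset_flags ne by (intro exI[of _ "flag_pair ` (frames \<times> frames)"]) auto
next
  case (insert i I)
  have "\<exists>A. openin flag_pairs_zariski A \<and> A \<inter> PQ = PQ \<inter> (\<Inter>i\<in>I. D i) \<and> A \<inter> PQ \<noteq> {}"
    using insert.prems by (intro insert.IH) simp_all
  then obtain A where A: "openin flag_pairs_zariski A" "A \<inter> PQ = PQ \<inter> (\<Inter>i\<in>I. D i)" "A \<inter> PQ \<noteq> {}"
    by blast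
  have Di: "openin flag_pairs_zariski (D i)" "D i \<inter> PQ \<noteq> {}" using insert.prems by simp_all
  obtain x y where "x \<in> A \<inter> PQ" "y \<in> D i \<inter> PQ" using A(3) Di(2) by blast
  then have "A \<inter> D i \<inter> PQ \<noteq> {}" by (rule PQ_irreducible[OF A(1) _ Di(1)])
  moreover have "A \<inter> D i \<inter> PQ = PQ \<inter> (\<Inter>i\<in>insert i I. D i)"
  proof -
    have "A \<inter> D i \<inter> PQ = (A \<inter> PQ) \<inter> D i" by blast
    also have "\<dots> = PQ \<inter> (\<Inter>i\<in>insert i I. D i)" unfolding A(2) by blast
    finally show ?thesis .
  qed
  ultimately show ?case using openin_Int[OF A(1) Di(1)] by blast
qed

lemma dense_open_minimal:
  assumes nil: "\<forall>v. (\<eta> ^^ m) v = 0"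
  shows "\<exists>U. openin (tableau_flag_pairs_zariski \<eta> P Q) U \<and>
    tableau_flag_pairs_zariski \<eta> P Q closure_of U = PQ \<and>
    (\<forall>(f, f')\<in>U. (f, f') \<in> PQ \<and>
       minimal_pair \<eta> UNIV (dim UNIV) (\<lambda>i. restr i P) (dim UNIV) (\<lambda>j. restr j Q) f f')"
proof (cases "PQ = {}")
  case True
  show ?thesis
    by (intro exI[of _ "{}"] conjI) (simp_all only: True closure_of_empty openin_empty ball_empty)
next
  case ne: False
  define n where "n = dim UNIV"
  note n = n_def[symmetric]
  define val where
    "val = (\<lambda>(i::nat, j::nat, k) (f::nat \<Rightarrow> 'b set, f'::nat \<Rightarrow> 'b set). dim (ker_pow \<eta> k \<inter> f i \<inter> f' j))"
  \<comment> \<open>Each minimum is taken separately over \<open>PQ\<close>; that a single pair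
    attains all of them comes from \<open>generic_subset\<close>.\<close>
  define low where "low = (\<lambda>\<iota>. LEAST d. \<exists>x\<in>PQ. val \<iota> x = d)"
  have low: "\<exists>x\<in>PQ. val \<iota> x = low \<iota>" for \<iota>
  proof -
    obtain x where "x \<in> PQ" using ne by blast
    then have "\<exists>d. \<exists>x\<in>PQ. val \<iota> x = d" by blast
    then show ?thesis unfolding low_def by (rule LeastI_ex)
  qed
  have low_le: "low \<iota> \<le> val \<iota> x" if "x \<in> PQ" for \<iota> x
    unfolding low_def using that by (intro Least_le) blast
  \<comment> \<open>Exponents beyond \<open>m\<close> give the same kernel as \<open>m\<close>, so
    finitely many conditions suffice.\<close>
  define I where "I = {..n} \<times> {..n} \<times> {..m}"
  define D where "D = (\<lambda>(i, j, k). small_Int (ker_pow \<eta> k) i j (low (i, j, k)))"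
  have mem: "x \<in> D \<iota> \<longleftrightarrow> val \<iota> x \<le> low \<iota>" if "x \<in> PQ" for x \<iota>
  proof -
    have "x \<in> flag_pair ` (frames \<times> frames)" using PQ_subset_flags that by blast
    then show ?thesis by (cases \<iota>; cases x) (simp add: D_def small_Int_def val_def)
  qed
  have opD: "openin flag_pairs_zariski (D \<iota>)" if "\<iota> \<in> I" for \<iota>
  proof -
    obtain i j k where ijk: "\<iota> = (i, j, k)" by (cases \<iota>)
    then have "i \<le> n" "j \<le> n" using that by (auto simp: I_def)
    then show ?thesis unfolding ijk D_def prod.case n_def
      by (intro openin_small_Int subspace_ker_pow lin)
  qed
  have neD: "D \<iota> \<inter> PQ \<noteq> {}" for \<iota>
  proof -
    obtain x where "x \<in> PQ" "val \<iota> x = low \<iota>" using low by blast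
    then have "x \<in> D \<iota>" using mem[of x \<iota>] by simp
    then show ?thesis using \<open>x \<in> PQ\<close> by blast
  qed
  have "finite I" by (simp add: I_def)
  then have "\<exists>A. openin flag_pairs_zariski A \<and> A \<inter> PQ = PQ \<inter> (\<Inter>\<iota>\<in>I. D \<iota>) \<and> A \<inter> PQ \<noteq> {}"
    by (rule generic_subset) (rule opD neD ne, assumption?)+
  then obtain A where A: "openin flag_pairs_zariski A" "A \<inter> PQ = PQ \<inter> (\<Inter>\<iota>\<in>I. D \<iota>)" "A \<inter> PQ \<noteq> {}"
    by (elim exE conjE)
  let ?X = "tableau_flag_pairs_zariski \<eta> P Q"
  have top: "topspace ?X = PQ"
  proof -
    have "flag_pair ` (frames \<times> frames) \<subseteq> topspace flag_pairs_zariski"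
      by (rule openin_subset[OF openin_all_flags])
    then show ?thesis unfolding tableau_flag_pairs_zariski_def topspace_subtopology
      using PQ_subset_flags by blast
  qed
  have op: "openin ?X (A \<inter> PQ)"
    unfolding tableau_flag_pairs_zariski_def openin_subtopology using A(1) by blast
  have dense: "?X closure_of (A \<inter> PQ) = PQ"
  proof
    show "?X closure_of (A \<inter> PQ) \<subseteq> PQ" using closure_of_subset_topspace[of ?X] top by blast
    show "PQ \<subseteq> ?X closure_of (A \<inter> PQ)"
    proof
      fix x assume x: "x \<in> PQ"
      show "x \<in> ?X closure_of (A \<inter> PQ)"
        unfolding in_closure_of top
      proof (intro conjI allI impI)
        fix T assume T: "x \<in> T \<and> openin ?X T"
        then obtain T' where T': "openin flag_pairs_zariski T'" "T = T' \<inter> PQ"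
          unfolding tableau_flag_pairs_zariski_def openin_subtopology by blast
        obtain y where y: "y \<in> A \<inter> PQ" using A(3) by blast
        have "x \<in> T' \<inter> PQ" using T T'(2) by blast
        then have "T' \<inter> A \<inter> PQ \<noteq> {}" by (rule PQ_irreducible[OF T'(1) _ A(1) y])
        then show "\<exists>y. y \<in> A \<inter> PQ \<and> y \<in> T" using T'(2) by blast
      qed (fact x)
    qed
  qed
  have "minimal_pair \<eta> UNIV n (\<lambda>i. restr i P) n (\<lambda>j. restr j Q) f f'" if ff: "(f, f') \<in> A \<inter> PQ" for f f'
    unfolding minimal_pair_def
  proof (intro conjI ballI allI impI)
    note iP = tableau_flags_iff[OF lin JU P, unfolded n] and iQ = tableau_flags_iff[OF lin JU Q, unfolded n]
    show "f \<in> FL \<eta> UNIV n (\<lambda>i. restr i P)" "f' \<in> FL \<eta> UNIV n (\<lambda>j. restr j Q)" using ff iP iQ by blast+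
    fix g g' i j k assume g: "g \<in> FL \<eta> UNIV n (\<lambda>i. restr i P)" "g' \<in> FL \<eta> UNIV n (\<lambda>j. restr j Q)"
      and ij: "i \<le> n" "j \<le> n"
    \<comment> \<open>Competing flags in \<open>FL\<close> are arbitrary beyond \<open>n\<close>;
      there they are reset to the whole space, as \<open>tableau_flags\<close> demands.\<close>
    define h h' where "h = (\<lambda>i. if i \<le> n then g i else UNIV)" and "h' = (\<lambda>i. if i \<le> n then g' i else UNIV)"
    have "h \<in> tableau_flags \<eta> P" unfolding iP
      using FL_cong[OF g(1), of h] FL_top[OF g(1)] by (auto simp: h_def)
    moreover have "h' \<in> tableau_flags \<eta> Q" unfolding iQ
      using FL_cong[OF g(2), of h'] FL_top[OF g(2)] by (auto simp: h'_def)
    ultimately have hh: "(h, h') \<in> PQ" by blast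
    define k' where "k' = min k m"
    have ker: "ker_pow \<eta> k = ker_pow \<eta> k'"
    proof (cases "k \<le> m")
      case True then show ?thesis by (simp add: k'_def)
    next
      case False
      have "(\<eta> ^^ k) v = 0" for v
      proof -
        have "(\<eta> ^^ k) v = (\<eta> ^^ m) ((\<eta> ^^ (k - m)) v)"
          using False by (metis comp_apply funpow_add le_add_diff_inverse nat_le_linear)
        then show ?thesis using nil by simp
      qed
      then show ?thesis using nil False by (simp add: k'_def ker_pow_def)
    qed
    have "(i, j, k') \<in> I" using ij by (simp add: I_def k'_def)
    moreover have "(f, f') \<in> PQ \<inter> (\<Inter>\<iota>\<in>I. D \<iota>)" using ff unfolding A(2) .
    ultimately have "val (i, j, k') (f, f') \<le> low (i, j, k')" using mem[of "(f, f')"] by blast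
    also have "\<dots> \<le> val (i, j, k') (h, h')" by (rule low_le[OF hh])
    finally show "dim (ker_pow \<eta> k \<inter> f i \<inter> f' j) \<le> dim (ker_pow \<eta> k \<inter> g i \<inter> g' j)"
      unfolding ker val_def using ij by (simp add: h_def h'_def)
  qed
  then show ?thesis using op dense unfolding n by (intro exI[of _ "A \<inter> PQ"]) auto
qed

text \<open>The types of the intersections and the restricted insertion tableaux of the prefixes of
  \<sigma> form two grids that obey the RS rules. In the last column both are the chain of
  \<open>P\<close>, in the last row the chain of \<open>Q\<close>, so they agree everywhere; their
  sizes then give the relative position.\<close>

lemma minimal_pair_generic:
  assumes ff: "(f, f') \<in> PQ"
    and min: "minimal_pair \<eta> UNIV (dim UNIV) (\<lambda>i. restr i P) (dim UNIV) (\<lambda>j. restr j Q) f f'"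
    and \<sigma>: "\<sigma> permutes {..<dim UNIV}" and RS: "(P, Q) = RS (dim UNIV) \<sigma>"
  shows "RS_family {0..dim UNIV} {0..dim UNIV} (\<lambda>i j. jordan_type \<eta> (f i \<inter> f' j))"
    and "relative_position f f' = \<sigma>"
proof -
  define n where "n = dim UNIV"
  note n = n_def[symmetric]
  have f: "f \<in> FL \<eta> UNIV n (\<lambda>i. restr i P)" and f': "f' \<in> FL \<eta> UNIV n (\<lambda>j. restr j Q)"
    using min unfolding minimal_pair_def n by blast+
  have ps: "psize (restr i T) = i" if "i \<le> n" "T \<in> SYT lam" for i T
    using psize_restr_SYT[OF that(2)] psize_lam that(1) unfolding n by simp
  define A where "A = (\<lambda>i j. jordan_type \<eta> (f i \<inter> f' j))"
  have JA: "JT \<eta> (f i \<inter> f' j) (A i j)" if "i \<le> n" "j \<le> n" for i j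
    unfolding A_def by (rule JT_Int[OF lin FL_JT[OF f that(1)] FL_JT[OF f' that(2)]])
  have sqA: "rs_square (A i j) (A i (Suc j)) (A (Suc i) j) (A (Suc i) (Suc j))" if "i < n" "j < n" for i j
    unfolding A_def
    by (rule minimal_pair_squares[OF inf lin min[unfolded n]]) (use that ps[OF _ P] ps[OF _ Q] ps[OF le0 Q] in simp_all)
  show "RS_family {0..dim UNIV} {0..dim UNIV} (\<lambda>i j. jordan_type \<eta> (f i \<inter> f' j))"
    unfolding RS_family_def A_def[symmetric] n Let_def
  proof (intro conjI ballI allI impI)
    show "is_partition (A i j)" if "i \<in> {0..n}" "j \<in> {0..n}" for i j
      using JT_partition[OF JA] that by simp
    show "RS0 (A i j) (A i (j + 1)) (A (i + 1) j) (A (i + 1) (j + 1)) \<or>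
      RS1 (A i j) (A i (j + 1)) (A (i + 1) j) (A (i + 1) (j + 1)) \<or>
      RS2 (A i j) (A i (j + 1)) (A (i + 1) j) (A (i + 1) (j + 1)) \<or>
      RS3 (A i j) (A i (j + 1)) (A (i + 1) j) (A (i + 1) (j + 1))"
      if "i \<in> {0..n} \<and> i + 1 \<in> {0..n} \<and> j \<in> {0..n} \<and> j + 1 \<in> {0..n}" for i j
      using sqA[of i j] that unfolding rs_square_def by simp
  qed
  have \<sigma>n: "\<sigma> permutes {..<n}" using \<sigma> unfolding n .
  have inj: "inj_on \<sigma> {..<j}" for j using permutes_inj[OF \<sigma>n] by (rule inj_on_subset) simp
  have PQ: "P = fst (RS n \<sigma>)" "Q = snd (RS n \<sigma>)" using RS unfolding n by (metis fst_conv, metis snd_conv)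
  define L where "L = (\<lambda>i j. restr i (fst (RS j \<sigma>)))"
  have AL: "A i j = L i j" if "i \<le> n" "j \<le> n" for i j
  proof (rule rs_grid_unique[where n=n])
    show "i \<le> n" "j \<le> n" by fact+
    show "finite {k. A i j k \<noteq> 0} \<and> finite {k. L i j k \<noteq> 0}" if "i \<le> n" "j \<le> n" for i j
      using is_partition_finite[OF JT_partition[OF JA[OF that]]] finite_shape unfolding L_def by blast
    show "rs_square (A i j) (A i (Suc j)) (A (Suc i) j) (A (Suc i) (Suc j))" if "i < n" "j < n" for i j
      by (rule sqA[OF that])
    show "rs_square (L i j) (L i (Suc j)) (L (Suc i) j) (L (Suc i) (Suc j))" for i j
      unfolding L_def by (rule RS_square[OF inj])
    show "A i n = L i n" if "i \<le> n" for i
    proof -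
      have "f i \<inter> f' n = f i" using FL_top[OF f'] by simp
      then show ?thesis
        unfolding A_def L_def PQ(1)[symmetric] using JT_jordan_type[OF FL_JT[OF f that] lin] by simp
    qed
    show "A n j = L n j" if "j \<le> n" for j
    proof -
      have "f n \<inter> f' j = f' j" using FL_top[OF f] by simp
      then have "A n j = restr j Q" unfolding A_def using JT_jordan_type[OF FL_JT[OF f' that] lin] by simp
      also have "\<dots> = shape (fst (RS j \<sigma>))" unfolding PQ(2) by (rule RS_recording[OF inj that])
      also have "\<dots> = L n j" unfolding L_def
      proof (rule restr_all[symmetric], unfold set_concat_RS(1)[OF inj], rule ballI)
        fix x assume "x \<in> \<sigma> ` {..<j}"
        then have "x \<in> \<sigma> ` {..<n}" using that by auto
        then show "x < n" using permutes_image[OF \<sigma>n] by simp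
      qed
      finally show ?thesis .
    qed
  qed
  show "relative_position f f' = \<sigma>"
  proof (rule relative_position_eqI[OF _ _ \<sigma>])
    show "f \<in> complete_flags" "f' \<in> complete_flags"
      using ff by (auto simp: tableau_flags_def stable_flags_def)
    fix i j assume "i \<le> dim UNIV" "j \<le> dim UNIV"
    then have ij: "i \<le> n" "j \<le> n" unfolding n by auto
    show "dim (f i \<inter> f' j) = card {k. k < j \<and> \<sigma> k < i}"
      unfolding JT_dim[OF JA[OF ij]] AL[OF ij] L_def by (rule psize_restr_RS[OF inj])
  qed
qed

end

end

theorem theorem6p3:
  fixes scale :: "'k::field \<Rightarrow> 'v::ab_group_add \<Rightarrow> 'v"
    and B :: "'v set"
    and n :: nat
    and \<eta> :: "'v \<Rightarrow> 'v"
    and lam :: "nat \<Rightarrow> nat"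
    and P Q :: "nat list list"
    and \<sigma> :: "nat \<Rightarrow> nat"
  assumes "infinite (UNIV :: 'k set)"
    and "finite_dimensional_vector_space scale B"
    and "vector_space.dim scale (UNIV :: 'v set) = n"
    and "Vector_Spaces.linear scale scale \<eta>"
    and "\<exists>m. \<forall>v. (\<eta> ^^ m) v = 0"
    and "flag_space.jordan_type scale \<eta> UNIV = lam"
    and "P \<in> SYT lam" and "Q \<in> SYT lam"
    and "\<sigma> permutes {..<n}"
    and "(P, Q) = RS n \<sigma>"
  shows "\<exists>U. openin (flag_space.tableau_flag_pairs_zariski scale \<eta> P Q) U \<and>
    flag_space.tableau_flag_pairs_zariski scale \<eta> P Q closure_of U =
      flag_space.tableau_flags scale \<eta> P \<times> flag_space.tableau_flags scale \<eta> Q \<and>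
    (\<forall>(f, f') \<in> U.
       RS_family {0..n} {0..n} (\<lambda>i j. flag_space.jordan_type scale \<eta> (f i \<inter> f' j)) \<and>
       flag_space.relative_position scale f f' = \<sigma>)"
proof -
  interpret finite_dimensional_vector_space scale B by (rule assms(2))
  interpret fd_flag_space scale B by unfold_locales
  obtain m where m: "\<forall>v. (\<eta> ^^ m) v = 0" using assms(5) ..
  \<comment> \<open>Nilpotency provides a Jordan basis, so \<open>lam\<close> is a genuine Jordan
    type and not an arbitrary value of the definite description.\<close>
  have "\<exists>mu. JT \<eta> UNIV mu" by (rule JT_exists[OF assms(4) subspace_UNIV subset_UNIV]) (use m in blast)
  then obtain mu where mu: "JT \<eta> UNIV mu" ..
  have "mu = lam" using JT_jordan_type[OF mu assms(4)] assms(6) by simp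
  then have JU: "JT \<eta> UNIV lam" using mu by simp
  note ctx = assms(4) JU assms(7,8,1)
  obtain U where U: "openin (tableau_flag_pairs_zariski \<eta> P Q) U"
    "tableau_flag_pairs_zariski \<eta> P Q closure_of U = tableau_flags \<eta> P \<times> tableau_flags \<eta> Q"
    "\<forall>(f, f')\<in>U. (f, f') \<in> tableau_flags \<eta> P \<times> tableau_flags \<eta> Q \<and>
       minimal_pair \<eta> UNIV n (\<lambda>i. restr i P) n (\<lambda>j. restr j Q) f f'"
    using dense_open_minimal[OF ctx m] unfolding assms(3) by (elim exE conjE)
  show ?thesis
  proof (intro exI[of _ U] conjI ballI)
    fix x assume "x \<in> U"
    then obtain f f' where x: "x = (f, f')" "(f, f') \<in> tableau_flags \<eta> P \<times> tableau_flags \<eta> Q"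
      "minimal_pair \<eta> UNIV n (\<lambda>i. restr i P) n (\<lambda>j. restr j Q) f f'" using U(3) by blast
    note mg = minimal_pair_generic[OF ctx x(2), unfolded assms(3), OF x(3) assms(9,10)]
    show "case x of (f, f') \<Rightarrow> RS_family {0..n} {0..n} (\<lambda>i j. jordan_type \<eta> (f i \<inter> f' j)) \<and>
       relative_position f f' = \<sigma>"
      unfolding x(1) prod.case using mg by blast
  qed (fact U(1) U(2))+
qed

end
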